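(* The category $\mathbf{Mnd}_f(\mathbf{Set})$ of finitary monads on $\mathbf{Set}$ is equivalent to the category of one-object $[\mathbf F, \mathbf{Set}]$-categories (with $[\mathbf F,\mathbf{Set}]$-enriched functors as morphisms).
   Context: $\mathbf F$ is the full subcategory of $\mathbf{Set}$ spanned by the finite cardinals, and $I\colon \mathbf F\to\mathbf{Set}$ is the inclusion. The functor category $[\mathbf F,\mathbf{Set}]$ is a monoidal category with unit object $I$ and tensor product $(A\otimes B)(n)=\int^{m\in\mathbf F} Am\times (Bn)^m$; this is the structure obtained by transporting composition of endofunctors along the equivalence $\mathbf{End}_f(\mathbf{Set})\simeq[\mathbf F,\mathbf{Set}]$ (restriction and left Kan extension along $I$), where $\mathbf{End}_f(\mathbf{Set})$ is the category of finitary (i.e. filtered-colimit-preserving) endofunctors of $\mathbf{Set}$. A monad on $\mathbf{Set}$ is finitary if its underlying endofunctor is. $[\mathbf F,\mathbf{Set}]$-categories are categories enriched in this (non-symmetric) monoidal category, with composition maps $\mathcal M(Y,Z)\otimes\mathcal M(X,Y)\to\mathcal M(X,Z)$. Morphisms in $\mathbf{Mnd}_f(\mathbf{Set})$ are natural transformations of the underlying endofunctors compatible with units and multiplications. *)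

theory Defs
  imports Main "HOL-Library.FuncSet"
begin

section \<open>Categories, functors, natural transformations\<close>

text \<open>Categories are given by hom-families: the hom-sets need not be disjoint, so composition and
  the action of functors on arrows take the objects involved as arguments.
  \<open>Cmp C X Y Z g f\<close> is the composite of \<open>f : X \<rightarrow> Y\<close> and \<open>g : Y \<rightarrow> Z\<close>.\<close>

record ('o, 'a) cat =
  Ob :: "'o set"
  Hom :: "'o \<Rightarrow> 'o \<Rightarrow> 'a set"
  Idn :: "'o \<Rightarrow> 'a"
  Cmp :: "'o \<Rightarrow> 'o \<Rightarrow> 'o \<Rightarrow> 'a \<Rightarrow> 'a \<Rightarrow> 'a"

definition is_category :: "('o, 'a) cat \<Rightarrow> bool" where
  "is_category C \<longleftrightarrow>
     (\<forall>X\<in>Ob C. Idn C X \<in> Hom C X X) \<and>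
     (\<forall>X\<in>Ob C. \<forall>Y\<in>Ob C. \<forall>Z\<in>Ob C. \<forall>f\<in>Hom C X Y. \<forall>g\<in>Hom C Y Z. Cmp C X Y Z g f \<in> Hom C X Z) \<and>
     (\<forall>X\<in>Ob C. \<forall>Y\<in>Ob C. \<forall>f\<in>Hom C X Y.
        Cmp C X X Y f (Idn C X) = f \<and> Cmp C X Y Y (Idn C Y) f = f) \<and>
     (\<forall>W\<in>Ob C. \<forall>X\<in>Ob C. \<forall>Y\<in>Ob C. \<forall>Z\<in>Ob C.
        \<forall>f\<in>Hom C W X. \<forall>g\<in>Hom C X Y. \<forall>h\<in>Hom C Y Z.
        Cmp C W X Z (Cmp C X Y Z h g) f = Cmp C W Y Z h (Cmp C W X Y g f))"

definition full_sub :: "('o, 'a) cat \<Rightarrow> 'o set \<Rightarrow> ('o, 'a) cat" where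
  "full_sub C S = C\<lparr>Ob := Ob C \<inter> S\<rparr>"

record ('o, 'a, 'p, 'b) ftor =
  FOb :: "'o \<Rightarrow> 'p"
  FArr :: "'o \<Rightarrow> 'o \<Rightarrow> 'a \<Rightarrow> 'b"

text \<open>Functors, natural transformations etc. are required to be \<open>undefined\<close> outside their domain
  (the \<open>\<Pi>\<^sub>E\<close> and \<open>\<rightarrow>\<^sub>E\<close> of the library), so that HOL equality is the mathematical one.\<close>

definition is_ftor :: "('o, 'a) cat \<Rightarrow> ('p, 'b) cat \<Rightarrow> ('o, 'a, 'p, 'b) ftor \<Rightarrow> bool" where
  "is_ftor C D F \<longleftrightarrow>
     FOb F \<in> Ob C \<rightarrow>\<^sub>E Ob D \<and>
     FArr F \<in> (\<Pi>\<^sub>E X\<in>Ob C. \<Pi>\<^sub>E Y\<in>Ob C. Hom C X Y \<rightarrow>\<^sub>E Hom D (FOb F X) (FOb F Y)) \<and>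
     (\<forall>X\<in>Ob C. FArr F X X (Idn C X) = Idn D (FOb F X)) \<and>
     (\<forall>X\<in>Ob C. \<forall>Y\<in>Ob C. \<forall>Z\<in>Ob C. \<forall>f\<in>Hom C X Y. \<forall>g\<in>Hom C Y Z.
        FArr F X Z (Cmp C X Y Z g f) =
        Cmp D (FOb F X) (FOb F Y) (FOb F Z) (FArr F Y Z g) (FArr F X Y f))"

definition id_ftor :: "('o, 'a) cat \<Rightarrow> ('o, 'a, 'o, 'a) ftor" where
  "id_ftor C = \<lparr>FOb = (\<lambda>X\<in>Ob C. X), FArr = (\<lambda>X\<in>Ob C. \<lambda>Y\<in>Ob C. \<lambda>f\<in>Hom C X Y. f)\<rparr>"

definition comp_ftor ::
  "('o, 'a) cat \<Rightarrow> ('p, 'b, 'q, 'c) ftor \<Rightarrow> ('o, 'a, 'p, 'b) ftor \<Rightarrow> ('o, 'a, 'q, 'c) ftor" where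
  "comp_ftor C G F =
     \<lparr>FOb = (\<lambda>X\<in>Ob C. FOb G (FOb F X)),
      FArr = (\<lambda>X\<in>Ob C. \<lambda>Y\<in>Ob C. \<lambda>f\<in>Hom C X Y. FArr G (FOb F X) (FOb F Y) (FArr F X Y f))\<rparr>"

definition is_nat ::
  "('o, 'a) cat \<Rightarrow> ('p, 'b) cat \<Rightarrow> ('o, 'a, 'p, 'b) ftor \<Rightarrow> ('o, 'a, 'p, 'b) ftor \<Rightarrow> ('o \<Rightarrow> 'b) \<Rightarrow> bool"
where
  "is_nat C D F G \<alpha> \<longleftrightarrow>
     \<alpha> \<in> (\<Pi>\<^sub>E X\<in>Ob C. Hom D (FOb F X) (FOb G X)) \<and>
     (\<forall>X\<in>Ob C. \<forall>Y\<in>Ob C. \<forall>f\<in>Hom C X Y.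
        Cmp D (FOb F X) (FOb F Y) (FOb G Y) (\<alpha> Y) (FArr F X Y f) =
        Cmp D (FOb F X) (FOb G X) (FOb G Y) (FArr G X Y f) (\<alpha> X))"

definition is_iso :: "('o, 'a) cat \<Rightarrow> 'o \<Rightarrow> 'o \<Rightarrow> 'a \<Rightarrow> bool" where
  "is_iso C X Y f \<longleftrightarrow>
     f \<in> Hom C X Y \<and> (\<exists>g\<in>Hom C Y X. Cmp C X Y X g f = Idn C X \<and> Cmp C Y X Y f g = Idn C Y)"

definition is_nat_iso ::
  "('o, 'a) cat \<Rightarrow> ('p, 'b) cat \<Rightarrow> ('o, 'a, 'p, 'b) ftor \<Rightarrow> ('o, 'a, 'p, 'b) ftor \<Rightarrow> ('o \<Rightarrow> 'b) \<Rightarrow> bool"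
where
  "is_nat_iso C D F G \<alpha> \<longleftrightarrow>
     is_nat C D F G \<alpha> \<and> (\<forall>X\<in>Ob C. is_iso D (FOb F X) (FOb G X) (\<alpha> X))"

definition equivalent_cats :: "('o, 'a) cat \<Rightarrow> ('p, 'b) cat \<Rightarrow> bool" where
  "equivalent_cats C D \<longleftrightarrow>
     is_category C \<and> is_category D \<and>
     (\<exists>F G \<eta> \<epsilon>. is_ftor C D F \<and> is_ftor D C G \<and>
        is_nat_iso C C (id_ftor C) (comp_ftor C G F) \<eta> \<and>
        is_nat_iso D D (comp_ftor D F G) (id_ftor D) \<epsilon>)"

definition ftor_cat ::
  "('o, 'a) cat \<Rightarrow> ('p, 'b) cat \<Rightarrow> (('o, 'a, 'p, 'b) ftor, 'o \<Rightarrow> 'b) cat" where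
  "ftor_cat C D =
     \<lparr>Ob = {F. is_ftor C D F},
      Hom = (\<lambda>F G. {\<alpha>. is_nat C D F G \<alpha>}),
      Idn = (\<lambda>F. \<lambda>X\<in>Ob C. Idn D (FOb F X)),
      Cmp = (\<lambda>F G H \<beta> \<alpha>. \<lambda>X\<in>Ob C. Cmp D (FOb F X) (FOb G X) (FOb H X) (\<beta> X) (\<alpha> X))\<rparr>"


section \<open>The category of sets\<close>

text \<open>HOL has no type of all sets, so, as usual in category theory, ``set'' means ``member of
  a universe'': a collection \<open>U\<close> of subsets of a type \<open>'u\<close> with an infinite member and closed under
  subsets, images and small unions.  It is then also closed, up to bijection, under the
  finite products, quotients and small coproducts that the theory needs.  Every Grothendieck
  universe \<open>V\<close> with an infinite member is covered up to equivalence of categories of sets: take for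
  \<open>'u\<close> a type of cardinality \<open>|V|\<close> and for \<open>U\<close> the sets of cardinality less than \<open>|V|\<close>.
  Closure under power sets is not demanded; it would make the
  existence of universes unprovable in HOL, whereas all subsets of an infinite type form one.\<close>

definition universe :: "'u set set \<Rightarrow> bool" where
  "universe U \<longleftrightarrow>
     (\<exists>A\<in>U. infinite A) \<and>
     (\<forall>A\<in>U. \<forall>B. B \<subseteq> A \<longrightarrow> B \<in> U) \<and>
     (\<forall>A\<in>U. \<forall>f. f ` A \<in> U) \<and>
     (\<forall>I\<in>U. \<forall>A. (\<forall>i\<in>I. A i \<in> U) \<longrightarrow> (\<Union>i\<in>I. A i) \<in> U)"

lemma universe_UNIV: "infinite (UNIV :: 'u set) \<Longrightarrow> universe (UNIV :: 'u set set)"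
  by (auto simp: universe_def)

definition SET :: "'u set set \<Rightarrow> ('u set, 'u \<Rightarrow> 'u) cat" where
  "SET U =
     \<lparr>Ob = U,
      Hom = (\<lambda>A B. A \<rightarrow>\<^sub>E B),
      Idn = (\<lambda>A. \<lambda>x\<in>A. x),
      Cmp = (\<lambda>A B C g f. compose A g f)\<rparr>"

text \<open>The finite cardinals, realised as the initial segments of a chosen copy of \<open>\<nat>\<close> inside the
  (infinite) type \<open>'u\<close>; they are genuine objects of \<open>SET U\<close>, exactly one of each finite size.\<close>

definition num :: "nat \<Rightarrow> 'u" where
  "num = (SOME e. inj e)"

definition fincards :: "'u set set" where
  "fincards = range (\<lambda>n. num ` {..<n})"

definition FIN :: "'u set set \<Rightarrow> ('u set, 'u \<Rightarrow> 'u) cat" where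
  "FIN U = full_sub (SET U) fincards"


section \<open>Finitary monads\<close>

definition is_cocone ::
  "('j, 'k) cat \<Rightarrow> ('o, 'a) cat \<Rightarrow> ('j, 'k, 'o, 'a) ftor \<Rightarrow> 'o \<Rightarrow> ('j \<Rightarrow> 'a) \<Rightarrow> bool" where
  "is_cocone J C D L \<gamma> \<longleftrightarrow>
     L \<in> Ob C \<and> (\<forall>i\<in>Ob J. \<gamma> i \<in> Hom C (FOb D i) L) \<and>
     (\<forall>i\<in>Ob J. \<forall>j\<in>Ob J. \<forall>u\<in>Hom J i j.
        Cmp C (FOb D i) (FOb D j) L (\<gamma> j) (FArr D i j u) = \<gamma> i)"

definition is_colimit ::
  "('j, 'k) cat \<Rightarrow> ('o, 'a) cat \<Rightarrow> ('j, 'k, 'o, 'a) ftor \<Rightarrow> 'o \<Rightarrow> ('j \<Rightarrow> 'a) \<Rightarrow> bool" where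
  "is_colimit J C D L \<gamma> \<longleftrightarrow>
     is_cocone J C D L \<gamma> \<and>
     (\<forall>M \<delta>. is_cocone J C D M \<delta> \<longrightarrow>
        (\<exists>!h. h \<in> Hom C L M \<and> (\<forall>i\<in>Ob J. Cmp C (FOb D i) L M h (\<gamma> i) = \<delta> i)))"

definition is_filtered :: "('j, 'k) cat \<Rightarrow> bool" where
  "is_filtered J \<longleftrightarrow>
     is_category J \<and> Ob J \<noteq> {} \<and>
     (\<forall>i\<in>Ob J. \<forall>j\<in>Ob J. \<exists>k\<in>Ob J. Hom J i k \<noteq> {} \<and> Hom J j k \<noteq> {}) \<and>
     (\<forall>i\<in>Ob J. \<forall>j\<in>Ob J. \<forall>u\<in>Hom J i j. \<forall>v\<in>Hom J i j.
        \<exists>k\<in>Ob J. \<exists>w\<in>Hom J j k. Cmp J i j k w u = Cmp J i j k w v)"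

text \<open>Since hom-sets may overlap, every \<open>U\<close>-small category is isomorphic to one whose objects and
  arrows are elements of \<open>'u\<close>.\<close>

definition is_small :: "'u set set \<Rightarrow> ('u, 'u) cat \<Rightarrow> bool" where
  "is_small U J \<longleftrightarrow> Ob J \<in> U \<and> (\<forall>i\<in>Ob J. \<forall>j\<in>Ob J. Hom J i j \<in> U)"

definition is_finitary :: "'u set set \<Rightarrow> ('u set, 'u \<Rightarrow> 'u, 'u set, 'u \<Rightarrow> 'u) ftor \<Rightarrow> bool" where
  "is_finitary U T \<longleftrightarrow>
     (\<forall>(J :: ('u, 'u) cat) D L \<gamma>.
        is_filtered J \<and> is_small U J \<and> is_ftor J (SET U) D \<and> is_colimit J (SET U) D L \<gamma> \<longrightarrow>
        is_colimit J (SET U) (comp_ftor J T D) (FOb T L) (\<lambda>i. FArr T (FOb D i) L (\<gamma> i)))"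

record ('o, 'a) monad =
  Fun :: "('o, 'a, 'o, 'a) ftor"
  Unit :: "'o \<Rightarrow> 'a"
  Mult :: "'o \<Rightarrow> 'a"

definition is_monad :: "('o, 'a) cat \<Rightarrow> ('o, 'a) monad \<Rightarrow> bool" where
  "is_monad C M \<longleftrightarrow>
     (let T = Fun M; t = FOb T; \<eta> = Unit M; \<mu> = Mult M in
      is_ftor C C T \<and>
      is_nat C C (id_ftor C) T \<eta> \<and>
      is_nat C C (comp_ftor C T T) T \<mu> \<and>
      (\<forall>X\<in>Ob C.
         Cmp C (t X) (t (t X)) (t X) (\<mu> X) (\<eta> (t X)) = Idn C (t X) \<and>
         Cmp C (t X) (t (t X)) (t X) (\<mu> X) (FArr T X (t X) (\<eta> X)) = Idn C (t X) \<and>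
         Cmp C (t (t (t X))) (t (t X)) (t X) (\<mu> X) (\<mu> (t X)) =
         Cmp C (t (t (t X))) (t (t X)) (t X) (\<mu> X) (FArr T (t (t X)) (t X) (\<mu> X))))"

definition is_monad_mor ::
  "('o, 'a) cat \<Rightarrow> ('o, 'a) monad \<Rightarrow> ('o, 'a) monad \<Rightarrow> ('o \<Rightarrow> 'a) \<Rightarrow> bool" where
  "is_monad_mor C M N \<tau> \<longleftrightarrow>
     (let S = Fun M; s = FOb S; T = Fun N; t = FOb T in
      is_nat C C S T \<tau> \<and>
      (\<forall>X\<in>Ob C.
         Cmp C X (s X) (t X) (\<tau> X) (Unit M X) = Unit N X \<and>
         Cmp C (s (s X)) (s X) (t X) (\<tau> X) (Mult M X) =
         Cmp C (s (s X)) (t (t X)) (t X) (Mult N X)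
           (Cmp C (s (s X)) (s (t X)) (t (t X)) (\<tau> (t X)) (FArr S (s X) (t X) (\<tau> X)))))"

definition monad_cat :: "('o, 'a) cat \<Rightarrow> (('o, 'a) monad, 'o \<Rightarrow> 'a) cat" where
  "monad_cat C =
     \<lparr>Ob = {M. is_monad C M},
      Hom = (\<lambda>M N. {\<tau>. is_monad_mor C M N \<tau>}),
      Idn = (\<lambda>M. Idn (ftor_cat C C) (Fun M)),
      Cmp = (\<lambda>L M N. Cmp (ftor_cat C C) (Fun L) (Fun M) (Fun N))\<rparr>"

definition MND_f :: "'u set set \<Rightarrow> (('u set, 'u \<Rightarrow> 'u) monad, 'u set \<Rightarrow> 'u \<Rightarrow> 'u) cat" where
  "MND_f U = full_sub (monad_cat (SET U)) {M. is_finitary U (Fun M)}"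


section \<open>Categories enriched in a monoidal category\<close>

text \<open>The data of a monoidal category.  For \<open>f : X \<rightarrow> X'\<close> and \<open>g : Y \<rightarrow> Y'\<close>, the tensor product
  \<open>f \<otimes> g\<close> is \<open>TArr V X X' Y Y' f g\<close>; the constraints go
  \<open>Assoc V X Y Z : (X \<otimes> Y) \<otimes> Z \<rightarrow> X \<otimes> (Y \<otimes> Z)\<close>,
  \<open>LUnit V X : I \<otimes> X \<rightarrow> X\<close> and \<open>RUnit V X : X \<otimes> I \<rightarrow> X\<close>.\<close>

record ('o, 'a) moncat =
  Base :: "('o, 'a) cat"
  TOb :: "'o \<Rightarrow> 'o \<Rightarrow> 'o"
  TArr :: "'o \<Rightarrow> 'o \<Rightarrow> 'o \<Rightarrow> 'o \<Rightarrow> 'a \<Rightarrow> 'a \<Rightarrow> 'a"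
  TUnit :: "'o"
  Assoc :: "'o \<Rightarrow> 'o \<Rightarrow> 'o \<Rightarrow> 'a"
  LUnit :: "'o \<Rightarrow> 'a"
  RUnit :: "'o \<Rightarrow> 'a"

record ('x, 'o, 'a) ecat =
  EOb :: "'x set"
  EHom :: "'x \<Rightarrow> 'x \<Rightarrow> 'o"
  EId :: "'x \<Rightarrow> 'a"
  ECmp :: "'x \<Rightarrow> 'x \<Rightarrow> 'x \<Rightarrow> 'a"

definition is_ecat :: "('o, 'a) moncat \<Rightarrow> ('x, 'o, 'a) ecat \<Rightarrow> bool" where
  "is_ecat V M \<longleftrightarrow>
     (let S = EOb M; H = EHom M; j = EId M; c = ECmp M; C = Base V; T = TOb V; I = TUnit V in
      H \<in> S \<rightarrow>\<^sub>E S \<rightarrow>\<^sub>E Ob C \<and>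
      j \<in> (\<Pi>\<^sub>E X\<in>S. Hom C I (H X X)) \<and>
      c \<in> (\<Pi>\<^sub>E X\<in>S. \<Pi>\<^sub>E Y\<in>S. \<Pi>\<^sub>E Z\<in>S. Hom C (T (H Y Z) (H X Y)) (H X Z)) \<and>
      (\<forall>X\<in>S. \<forall>Y\<in>S.
         Cmp C (T I (H X Y)) (T (H Y Y) (H X Y)) (H X Y) (c X Y Y)
           (TArr V I (H Y Y) (H X Y) (H X Y) (j Y) (Idn C (H X Y))) = LUnit V (H X Y) \<and>
         Cmp C (T (H X Y) I) (T (H X Y) (H X X)) (H X Y) (c X X Y)
           (TArr V (H X Y) (H X Y) I (H X X) (Idn C (H X Y)) (j X)) = RUnit V (H X Y)) \<and>
      (\<forall>W\<in>S. \<forall>X\<in>S. \<forall>Y\<in>S. \<forall>Z\<in>S.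
         Cmp C (T (T (H Y Z) (H X Y)) (H W X)) (T (H X Z) (H W X)) (H W Z) (c W X Z)
           (TArr V (T (H Y Z) (H X Y)) (H X Z) (H W X) (H W X) (c X Y Z) (Idn C (H W X))) =
         Cmp C (T (T (H Y Z) (H X Y)) (H W X)) (T (H Y Z) (H W Y)) (H W Z) (c W Y Z)
           (Cmp C (T (T (H Y Z) (H X Y)) (H W X)) (T (H Y Z) (T (H X Y) (H W X)))
              (T (H Y Z) (H W Y))
              (TArr V (H Y Z) (H Y Z) (T (H X Y) (H W X)) (H W Y) (Idn C (H Y Z)) (c W X Y))
              (Assoc V (H Y Z) (H X Y) (H W X)))))"

record ('x, 'a) efun =
  EFOb :: "'x \<Rightarrow> 'x"
  EFArr :: "'x \<Rightarrow> 'x \<Rightarrow> 'a"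

definition is_efun ::
  "('o, 'a) moncat \<Rightarrow> ('x, 'o, 'a) ecat \<Rightarrow> ('x, 'o, 'a) ecat \<Rightarrow> ('x, 'a) efun \<Rightarrow> bool" where
  "is_efun V M N P \<longleftrightarrow>
     (let S = EOb M; H = EHom M; K = EHom N; p = EFOb P; q = EFArr P;
          C = Base V; T = TOb V; I = TUnit V in
      p \<in> S \<rightarrow>\<^sub>E EOb N \<and>
      q \<in> (\<Pi>\<^sub>E X\<in>S. \<Pi>\<^sub>E Y\<in>S. Hom C (H X Y) (K (p X) (p Y))) \<and>
      (\<forall>X\<in>S. Cmp C I (H X X) (K (p X) (p X)) (q X X) (EId M X) = EId N (p X)) \<and>
      (\<forall>X\<in>S. \<forall>Y\<in>S. \<forall>Z\<in>S.
         Cmp C (T (H Y Z) (H X Y)) (H X Z) (K (p X) (p Z)) (q X Z) (ECmp M X Y Z) =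
         Cmp C (T (H Y Z) (H X Y)) (T (K (p Y) (p Z)) (K (p X) (p Y))) (K (p X) (p Z))
           (ECmp N (p X) (p Y) (p Z))
           (TArr V (H Y Z) (K (p Y) (p Z)) (H X Y) (K (p X) (p Y)) (q Y Z) (q X Y))))"

definition ecat_cat :: "('o, 'a) moncat \<Rightarrow> (('x, 'o, 'a) ecat, ('x, 'a) efun) cat" where
  "ecat_cat V =
     \<lparr>Ob = {M. is_ecat V M},
      Hom = (\<lambda>M N. {P. is_efun V M N P}),
      Idn = (\<lambda>M. \<lparr>EFOb = (\<lambda>X\<in>EOb M. X),
                   EFArr = (\<lambda>X\<in>EOb M. \<lambda>Y\<in>EOb M. Idn (Base V) (EHom M X Y))\<rparr>),
      Cmp = (\<lambda>L M N Q P.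
        \<lparr>EFOb = (\<lambda>X\<in>EOb L. EFOb Q (EFOb P X)),
         EFArr = (\<lambda>X\<in>EOb L. \<lambda>Y\<in>EOb L.
           Cmp (Base V) (EHom L X Y) (EHom M (EFOb P X) (EFOb P Y))
             (EHom N (EFOb Q (EFOb P X)) (EFOb Q (EFOb P Y)))
             (EFArr Q (EFOb P X) (EFOb P Y)) (EFArr P X Y))\<rparr>)\<rparr>"

definition one_object_ecat_cat :: "('o, 'a) moncat \<Rightarrow> (('x, 'o, 'a) ecat, ('x, 'a) efun) cat" where
  "one_object_ecat_cat V = full_sub (ecat_cat V) {M. \<exists>x. EOb M = {x}}"


section \<open>The substitution tensor product on functors from finite cardinals to sets\<close>

text \<open>For a functor \<open>A\<close> from finite cardinals to sets and a set \<open>X\<close>, the coend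
  \<open>\<integral>\<^sup>m A m \<times> X\<^sup>m\<close> is the quotient of the set of triples \<open>(m, a, f)\<close> with \<open>a \<in> A m\<close> and \<open>f : m \<rightarrow> X\<close>
  by the equivalence relation generated by \<open>(m, a, f' \<circ> u) \<sim> (m', A u a, f')\<close> for \<open>u : m \<rightarrow> m'\<close>.\<close>

type_synonym 'u endo = "('u set, 'u \<Rightarrow> 'u, 'u set, 'u \<Rightarrow> 'u) ftor"
type_synonym 'u triple = "'u set \<times> 'u \<times> ('u \<Rightarrow> 'u)"

definition triples :: "'u endo \<Rightarrow> 'u set \<Rightarrow> 'u triple set" where
  "triples A X = {(m, a, f). m \<in> fincards \<and> a \<in> FOb A m \<and> f \<in> m \<rightarrow>\<^sub>E X}"

definition coend_gen :: "'u endo \<Rightarrow> 'u set \<Rightarrow> ('u triple \<times> 'u triple) set" where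
  "coend_gen A X =
     {((m, a, compose m f' u), (m', FArr A m m' u a, f')) | m m' u a f'.
        m \<in> fincards \<and> m' \<in> fincards \<and> u \<in> m \<rightarrow>\<^sub>E m' \<and> a \<in> FOb A m \<and> f' \<in> m' \<rightarrow>\<^sub>E X}"

definition coend_rel :: "'u endo \<Rightarrow> 'u set \<Rightarrow> ('u triple \<times> 'u triple) set" where
  "coend_rel A X = (coend_gen A X \<union> (coend_gen A X)\<inverse>)\<^sup>*"

text \<open>The quotient is transported to a subset of \<open>'u\<close> by a chosen injection, which exists
  because \<open>'u\<close> is infinite.\<close>

definition code :: "'x set \<Rightarrow> 'x \<Rightarrow> 'u" where
  "code Q = (SOME e. inj_on e Q)"

definition cls :: "'u endo \<Rightarrow> 'u set \<Rightarrow> 'u triple \<Rightarrow> 'u" where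
  "cls A X p = code (triples A X // coend_rel A X) (coend_rel A X `` {p})"

definition coend :: "'u endo \<Rightarrow> 'u set \<Rightarrow> 'u set" where
  "coend A X = cls A X ` triples A X"

text \<open>The map out of the coend induced by a family \<open>\<phi>\<close>, to be used for families that
  respect the relation.\<close>

definition coend_lift :: "'u endo \<Rightarrow> 'u set \<Rightarrow> ('u triple \<Rightarrow> 'v) \<Rightarrow> 'u \<Rightarrow> 'v" where
  "coend_lift A X \<phi> = (\<lambda>t\<in>coend A X. \<phi> (SOME p. p \<in> triples A X \<and> cls A X p = t))"

definition tens_ob :: "'u endo \<Rightarrow> 'u endo \<Rightarrow> 'u endo" where
  "tens_ob A B =
     \<lparr>FOb = (\<lambda>n\<in>fincards. coend A (FOb B n)),
      FArr = (\<lambda>n\<in>fincards. \<lambda>n'\<in>fincards. \<lambda>v\<in>n \<rightarrow>\<^sub>E n'.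
        coend_lift A (FOb B n) (\<lambda>(m, a, f). cls A (FOb B n') (m, a, compose m (FArr B n n' v) f)))\<rparr>"

definition tens_arr ::
  "'u endo \<Rightarrow> 'u endo \<Rightarrow> 'u endo \<Rightarrow> 'u endo \<Rightarrow>
   ('u set \<Rightarrow> 'u \<Rightarrow> 'u) \<Rightarrow> ('u set \<Rightarrow> 'u \<Rightarrow> 'u) \<Rightarrow> 'u set \<Rightarrow> 'u \<Rightarrow> 'u" where
  "tens_arr A A' B B' \<alpha> \<beta> =
     (\<lambda>n\<in>fincards. coend_lift A (FOb B n)
        (\<lambda>(m, a, f). cls A' (FOb B' n) (m, \<alpha> m a, compose m (\<beta> n) f)))"

definition incl :: "'u endo" where
  "incl = \<lparr>FOb = (\<lambda>n\<in>fincards. n),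
           FArr = (\<lambda>n\<in>fincards. \<lambda>n'\<in>fincards. \<lambda>v\<in>n \<rightarrow>\<^sub>E n'. v)\<rparr>"

text \<open>Writing \<open>[m, a, f]\<close> for classes, the constraints are
  \<open>[m, [k, a, g], h] \<mapsto> [k, a, i \<mapsto> [m, g i, h]]\<close>, \<open>[m, i, f] \<mapsto> f i\<close> and \<open>[m, a, f] \<mapsto> A f a\<close>.  When
  \<open>A\<close> is extended to all sets by \<open>X \<mapsto> coend A X\<close> (left Kan extension along the inclusion), so
  that \<open>tens_ob A B\<close> is the restriction of the composite of the extensions of \<open>A\<close> and \<open>B\<close>, these
  are the constraints transported from composition of endofunctors.\<close>

definition tens_assoc :: "'u endo \<Rightarrow> 'u endo \<Rightarrow> 'u endo \<Rightarrow> 'u set \<Rightarrow> 'u \<Rightarrow> 'u" where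
  "tens_assoc A B C =
     (\<lambda>n\<in>fincards. coend_lift (tens_ob A B) (FOb C n)
        (\<lambda>(m, t, h). coend_lift A (FOb B m)
           (\<lambda>(k, a, g). cls A (coend B (FOb C n)) (k, a, \<lambda>i\<in>k. cls B (FOb C n) (m, g i, h))) t))"

definition tens_lunit :: "'u endo \<Rightarrow> 'u set \<Rightarrow> 'u \<Rightarrow> 'u" where
  "tens_lunit A = (\<lambda>n\<in>fincards. coend_lift incl (FOb A n) (\<lambda>(m, i, f). f i))"

definition tens_runit :: "'u endo \<Rightarrow> 'u set \<Rightarrow> 'u \<Rightarrow> 'u" where
  "tens_runit A = (\<lambda>n\<in>fincards. coend_lift A n (\<lambda>(m, a, f). FArr A m n f a))"

definition FSET :: "'u set set \<Rightarrow> ('u endo, 'u set \<Rightarrow> 'u \<Rightarrow> 'u) moncat" where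
  "FSET U =
     \<lparr>Base = ftor_cat (FIN U) (SET U),
      TOb = tens_ob,
      TArr = tens_arr,
      TUnit = incl,
      Assoc = tens_assoc,
      LUnit = tens_lunit,
      RUnit = tens_runit\<rparr>"

end

theory Submission
  imports Defs
begin

text \<open>Restriction to finite cardinals turns a finitary monad \<open>T\<close> into a monoid for the substitution
  tensor product, with multiplication \<open>[m, a, f] \<mapsto> \<mu> (T f a)\<close>; this functor is shown to be fully
  faithful and essentially surjective.  Every set is the filtered colimit of its finite subsets, so a
  finitary \<open>T\<close> is the left Kan extension \<open>X \<mapsto> \<integral>\<^sup>m T m \<times> X\<^sup>m\<close> of its restriction; hence
  natural transformations out of \<open>T\<close> are determined by, and extend uniquely from, their components at
  finite cardinals, which gives full faithfulness.  Conversely, a monoid \<open>A\<close> has a finitary Kan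
  extension \<open>T\<close>, isomorphic to \<open>A\<close> on finite cardinals.  As \<open>T \<circ> T\<close> is finitary too, the unit and
  the multiplication of \<open>A\<close>, transported along this isomorphism, extend to \<open>T\<close>, and by naturality the
  monad laws need only be checked at finite cardinals.\<close>

section \<open>Categories and functors\<close>

text \<open>Three obstacles shape the proof. The value of a finitary functor at a finite cardinal
  may be infinite, so even at finite \<open>n\<close> a component such as \<mu> at
  \<open>T n\<close> has no explicit formula; it is reached by presenting its argument through a map
  from a finite cardinal and moving along that map by naturality. Universes are not assumed closed
  under power sets, so smallness of coends and of the diagram of finite subsets rests on finite
  powers and countable unions. Preservation of filtered colimits is a statement about universal
  properties; it is made usable by an elementwise criterion for colimits of sets: joint
  surjectivity, and identification at some later stage. Laws about the tensor product are brought to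
  representatives in the same spirit.\<close>

lemma full_sub_simps [simp]:
  "Ob (full_sub C S) = Ob C \<inter> S" "Hom (full_sub C S) = Hom C"
  "Idn (full_sub C S) = Idn C" "Cmp (full_sub C S) = Cmp C"
  by (simp_all add: full_sub_def)

lemma SET_simps [simp]:
  "Ob (SET U) = U" "Hom (SET U) A B = A \<rightarrow>\<^sub>E B"
  "Idn (SET U) A = (\<lambda>x\<in>A. x)" "Cmp (SET U) A B C g f = compose A g f"
  by (simp_all add: SET_def)

lemma ftor_cat_simps [simp]:
  "Ob (ftor_cat C D) = {F. is_ftor C D F}" "Hom (ftor_cat C D) F G = {\<alpha>. is_nat C D F G \<alpha>}"
  "Idn (ftor_cat C D) F = (\<lambda>X\<in>Ob C. Idn D (FOb F X))"
  "Cmp (ftor_cat C D) F G H \<beta> \<alpha> = (\<lambda>X\<in>Ob C. Cmp D (FOb F X) (FOb G X) (FOb H X) (\<beta> X) (\<alpha> X))"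
  by (simp_all add: ftor_cat_def)

lemma id_ftor_simps [simp]:
  "FOb (id_ftor C) = (\<lambda>X\<in>Ob C. X)"
  "FArr (id_ftor C) = (\<lambda>X\<in>Ob C. \<lambda>Y\<in>Ob C. \<lambda>f\<in>Hom C X Y. f)"
  by (simp_all add: id_ftor_def)

lemma comp_ftor_simps [simp]:
  "FOb (comp_ftor C G F) = (\<lambda>X\<in>Ob C. FOb G (FOb F X))"
  "FArr (comp_ftor C G F) =
     (\<lambda>X\<in>Ob C. \<lambda>Y\<in>Ob C. \<lambda>f\<in>Hom C X Y. FArr G (FOb F X) (FOb F Y) (FArr F X Y f))"
  by (simp_all add: comp_ftor_def)

lemma ftor_eqI:
  fixes F G :: "('o, 'a, 'p, 'b) ftor"
  shows "FOb F = FOb G \<Longrightarrow> FArr F = FArr G \<Longrightarrow> F = G"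
  by (cases F; cases G) simp

lemma is_category_full_sub: "is_category C \<Longrightarrow> is_category (full_sub C S)"
  unfolding is_category_def by simp

lemma category_Cmp:
  "is_category C \<Longrightarrow> X \<in> Ob C \<Longrightarrow> Y \<in> Ob C \<Longrightarrow> Z \<in> Ob C \<Longrightarrow> f \<in> Hom C X Y \<Longrightarrow> g \<in> Hom C Y Z \<Longrightarrow>
   Cmp C X Y Z g f \<in> Hom C X Z"
  unfolding is_category_def by blast

lemma category_assoc:
  "is_category C \<Longrightarrow> W \<in> Ob C \<Longrightarrow> X \<in> Ob C \<Longrightarrow> Y \<in> Ob C \<Longrightarrow> Z \<in> Ob C \<Longrightarrow>
   f \<in> Hom C W X \<Longrightarrow> g \<in> Hom C X Y \<Longrightarrow> h \<in> Hom C Y Z \<Longrightarrow>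
   Cmp C W X Z (Cmp C X Y Z h g) f = Cmp C W Y Z h (Cmp C W X Y g f)"
  unfolding is_category_def by blast

lemma category_Idn: "is_category C \<Longrightarrow> X \<in> Ob C \<Longrightarrow> Idn C X \<in> Hom C X X"
  unfolding is_category_def by blast

lemma category_unit:
  "is_category C \<Longrightarrow> X \<in> Ob C \<Longrightarrow> Y \<in> Ob C \<Longrightarrow> f \<in> Hom C X Y \<Longrightarrow> Cmp C X X Y f (Idn C X) = f"
  "is_category C \<Longrightarrow> X \<in> Ob C \<Longrightarrow> Y \<in> Ob C \<Longrightarrow> f \<in> Hom C X Y \<Longrightarrow> Cmp C X Y Y (Idn C Y) f = f"
  unfolding is_category_def by blast+

lemma ftor_arr_mem:
  assumes "is_ftor C D F" "X \<in> Ob C" "Y \<in> Ob C" "f \<in> Hom C X Y"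
  shows "FArr F X Y f \<in> Hom D (FOb F X) (FOb F Y)"
proof -
  have "FArr F \<in> (\<Pi>\<^sub>E X\<in>Ob C. \<Pi>\<^sub>E Y\<in>Ob C. Hom C X Y \<rightarrow>\<^sub>E Hom D (FOb F X) (FOb F Y))"
    using assms(1) by (simp add: is_ftor_def)
  from PiE_mem[OF PiE_mem[OF PiE_mem[OF this assms(2)] assms(3)] assms(4)] show ?thesis .
qed

lemma PiE_extensional: "f \<in> Pi\<^sub>E A B \<Longrightarrow> f \<in> extensional A"
  by (simp add: PiE_iff)

text \<open>\<open>FArr\<close> is \<open>undefined\<close> outside its domain in each of its three
  curried arguments, so equality of functors is obtained by one extensionality step per
  argument.\<close>

lemma is_ftor_eqI:
  assumes F: "is_ftor C D F" and G: "is_ftor C D G"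
    and ob: "\<And>X. X \<in> Ob C \<Longrightarrow> FOb F X = FOb G X"
    and arr: "\<And>X Y f. X \<in> Ob C \<Longrightarrow> Y \<in> Ob C \<Longrightarrow> f \<in> Hom C X Y \<Longrightarrow> FArr F X Y f = FArr G X Y f"
  shows "F = G"
proof -
  have e: "FOb F \<in> Ob C \<rightarrow>\<^sub>E Ob D"
    "FArr F \<in> (\<Pi>\<^sub>E X\<in>Ob C. \<Pi>\<^sub>E Y\<in>Ob C. Hom C X Y \<rightarrow>\<^sub>E Hom D (FOb F X) (FOb F Y))"
    if "is_ftor C D F" for F
    using that unfolding is_ftor_def by blast+
  show ?thesis
  proof (rule ftor_eqI)
    show "FOb F = FOb G"
      by (rule PiE_ext[OF e(1)[OF F] e(1)[OF G]]) (rule ob)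
    show "FArr F = FArr G"
    proof (rule extensionalityI[OF PiE_extensional[OF e(2)[OF F]] PiE_extensional[OF e(2)[OF G]]])
      fix X assume X: "X \<in> Ob C"
      note FX = PiE_mem[OF e(2)[OF F] X] and GX = PiE_mem[OF e(2)[OF G] X]
      show "FArr F X = FArr G X"
      proof (rule extensionalityI[OF PiE_extensional[OF FX] PiE_extensional[OF GX]])
        fix Y assume Y: "Y \<in> Ob C"
        show "FArr F X Y = FArr G X Y"
          by (rule extensionalityI[OF PiE_extensional[OF PiE_mem[OF FX Y]] PiE_extensional[OF PiE_mem[OF GX Y]]])
            (rule arr[OF X Y])
      qed
    qed
  qed
qed

text \<open>Choice supplies the quasi-inverse: objects go to chosen preimages up to isomorphism, and
  an arrow goes to the unique preimage of its conjugate by the chosen isomorphisms. The restriction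
  functor is later fed to this criterion, so no functor from enriched categories to monads has to be
  exhibited.\<close>

lemma equivalent_catsI:
  assumes C: "is_category C" and D: "is_category D" and F: "is_ftor C D F"
    and bij: "\<And>X Y. X \<in> Ob C \<Longrightarrow> Y \<in> Ob C \<Longrightarrow>
      bij_betw (FArr F X Y) (Hom C X Y) (Hom D (FOb F X) (FOb F Y))"
    and surj: "\<And>Z. Z \<in> Ob D \<Longrightarrow> \<exists>X\<in>Ob C. \<exists>f. is_iso D (FOb F X) Z f"
  shows "equivalent_cats C D"
proof -
  have F_ob: "FOb F X \<in> Ob D" if "X \<in> Ob C" for X
    using F that unfolding is_ftor_def by auto
  have F_Idn: "FArr F X X (Idn C X) = Idn D (FOb F X)" if "X \<in> Ob C" for X
    using F that unfolding is_ftor_def by simp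
  have F_Cmp: "FArr F X Z (Cmp C X Y Z g f) = Cmp D (FOb F X) (FOb F Y) (FOb F Z) (FArr F Y Z g) (FArr F X Y f)"
    if "X \<in> Ob C" "Y \<in> Ob C" "Z \<in> Ob C" "f \<in> Hom C X Y" "g \<in> Hom C Y Z" for X Y Z f g
    using F that unfolding is_ftor_def by simp
  note F_arr = ftor_arr_mem[OF F]
  have F_inj: "f = g" if "X \<in> Ob C" "Y \<in> Ob C" "f \<in> Hom C X Y" "g \<in> Hom C X Y" "FArr F X Y f = FArr F X Y g" for X Y f g
    using bij[OF that(1,2)] that by (auto simp: bij_betw_def inj_on_def)
  define pre where "pre X Y = inv_into (Hom C X Y) (FArr F X Y)" for X Y
  have pre: "pre X Y h \<in> Hom C X Y" "FArr F X Y (pre X Y h) = h"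
    if "X \<in> Ob C" "Y \<in> Ob C" "h \<in> Hom D (FOb F X) (FOb F Y)" for X Y h
    using bij_betwE[OF bij_betw_inv_into[OF bij[OF that(1,2)]]] bij_betw_inv_into_right[OF bij[OF that(1,2)]]
      that(3) by (auto simp: pre_def)
  have "\<exists>X f g. X \<in> Ob C \<and> f \<in> Hom D (FOb F X) Z \<and> g \<in> Hom D Z (FOb F X) \<and>
      Cmp D (FOb F X) Z (FOb F X) g f = Idn D (FOb F X) \<and> Cmp D Z (FOb F X) Z f g = Idn D Z" if "Z \<in> Ob D" for Z
    using surj[OF that] unfolding is_iso_def by blast
  then obtain G0 e e' where "\<forall>Z. Z \<in> Ob D \<longrightarrow> G0 Z \<in> Ob C \<and> e Z \<in> Hom D (FOb F (G0 Z)) Z \<and> e' Z \<in> Hom D Z (FOb F (G0 Z)) \<and>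
      Cmp D (FOb F (G0 Z)) Z (FOb F (G0 Z)) (e' Z) (e Z) = Idn D (FOb F (G0 Z)) \<and> Cmp D Z (FOb F (G0 Z)) Z (e Z) (e' Z) = Idn D Z"
    by metis
  then have G0: "G0 Z \<in> Ob C" and e: "e Z \<in> Hom D (FOb F (G0 Z)) Z" and e': "e' Z \<in> Hom D Z (FOb F (G0 Z))"
    and e'e: "Cmp D (FOb F (G0 Z)) Z (FOb F (G0 Z)) (e' Z) (e Z) = Idn D (FOb F (G0 Z))"
    and ee': "Cmp D Z (FOb F (G0 Z)) Z (e Z) (e' Z) = Idn D Z" if "Z \<in> Ob D" for Z
    using that by blast+
  define H where "H Z = FOb F (G0 Z)" for Z
  have H: "H Z \<in> Ob D" if "Z \<in> Ob D" for Z using F_ob[OF G0[OF that]] by (simp add: H_def)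
  note e = e[folded H_def] and e' = e'[folded H_def] and e'e = e'e[folded H_def] and ee' = ee'[folded H_def]
  \<comment> \<open>\<open>k Z W h\<close> is \<open>h\<close> conjugated by the chosen isomorphisms
    \<open>e\<close>; the quasi-inverse takes \<open>h\<close> to its preimage
    \<open>G1 Z W h\<close> under \<open>F\<close>.\<close>
  define k where "k Z W h = Cmp D (H Z) W (H W) (e' W) (Cmp D (H Z) Z W h (e Z))" for Z W h
  define G1 where "G1 Z W h = pre (G0 Z) (G0 W) (k Z W h)" for Z W h
  have k_mem: "k Z W h \<in> Hom D (H Z) (H W)" if "Z \<in> Ob D" "W \<in> Ob D" "h \<in> Hom D Z W" for Z W h
    using that by (auto simp: k_def intro!: category_Cmp[OF D] H e e')
  have G1: "G1 Z W h \<in> Hom C (G0 Z) (G0 W)" "FArr F (G0 Z) (G0 W) (G1 Z W h) = k Z W h"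
    if "Z \<in> Ob D" "W \<in> Ob D" "h \<in> Hom D Z W" for Z W h
    using pre[OF G0 G0 k_mem[OF that, unfolded H_def]] that by (auto simp: G1_def)
  have e_nat: "Cmp D (H Z) (H W) W (e W) (k Z W h) = Cmp D (H Z) Z W h (e Z)"
    if "Z \<in> Ob D" "W \<in> Ob D" "h \<in> Hom D Z W" for Z W h
  proof -
    have he: "Cmp D (H Z) Z W h (e Z) \<in> Hom D (H Z) W" using that by (auto intro!: category_Cmp[OF D] H e)
    show ?thesis
      unfolding k_def
      using category_assoc[OF D H[OF that(1)] that(2) H[OF that(2)] that(2) he e'[OF that(2)] e[OF that(2)]]
        ee'[OF that(2)] category_unit(2)[OF D H[OF that(1)] that(2) he] by simp
  qed
  \<comment> \<open>\<open>e' W\<close> is a left inverse of \<open>e W\<close>, so equations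
    between arrows into \<open>H W\<close> may be tested after composing with \<open>e W\<close>.
    This reduces functoriality of \<open>k\<close> and naturality of \<open>e'\<close> to the square
    \<open>e_nat\<close> and the inverse laws.\<close>
  have e_mono: "f = g" if "Z \<in> Ob D" "W \<in> Ob D" "f \<in> Hom D Z (H W)" "g \<in> Hom D Z (H W)"
    "Cmp D Z (H W) W (e W) f = Cmp D Z (H W) W (e W) g" for Z W f g
    using category_assoc[OF D that(1) H[OF that(2)] that(2) H[OF that(2)] that(3) e[OF that(2)] e'[OF that(2)]]
      category_assoc[OF D that(1) H[OF that(2)] that(2) H[OF that(2)] that(4) e[OF that(2)] e'[OF that(2)]]
      that(5) e'e[OF that(2)] category_unit(2)[OF D that(1) H[OF that(2)]] that(3,4) by simp
  define G where "G = \<lparr>FOb = (\<lambda>Z\<in>Ob D. G0 Z), FArr = (\<lambda>Z\<in>Ob D. \<lambda>W\<in>Ob D. \<lambda>h\<in>Hom D Z W. G1 Z W h)\<rparr>"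
  have G: "is_ftor D C G"
    unfolding is_ftor_def
  proof (intro conjI ballI)
    show "FOb G \<in> Ob D \<rightarrow>\<^sub>E Ob C" using G0 by (auto simp: G_def)
    show "FArr G \<in> (\<Pi>\<^sub>E X\<in>Ob D. \<Pi>\<^sub>E Y\<in>Ob D. Hom D X Y \<rightarrow>\<^sub>E Hom C (FOb G X) (FOb G Y))"
      using G1 by (auto simp: G_def)
    fix X assume X: "X \<in> Ob D"
    note iX = category_Idn[OF D X]
    have "k X X (Idn D X) = Idn D (H X)"
      using e'e[OF X] category_unit(2)[OF D H[OF X] X e[OF X]] by (simp add: k_def)
    then have "G1 X X (Idn D X) = Idn C (G0 X)"
      using G1[OF X X iX] F_Idn[OF G0[OF X]] category_Idn[OF C G0[OF X]]
      by (intro F_inj[OF G0[OF X] G0[OF X]]) (auto simp: H_def)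
    then show "FArr G X X (Idn D X) = Idn C (FOb G X)" using X iX by (simp add: G_def)
    fix Y Z f g assume Y: "Y \<in> Ob D" "Z \<in> Ob D" "f \<in> Hom D X Y" "g \<in> Hom D Y Z"
    note gf = category_Cmp[OF D X Y]
    have kk: "Cmp D (H X) (H Y) (H Z) (k Y Z g) (k X Y f) \<in> Hom D (H X) (H Z)"
      using category_Cmp[OF D H H H k_mem k_mem] X Y by blast
    have "k X Z (Cmp D X Y Z g f) = Cmp D (H X) (H Y) (H Z) (k Y Z g) (k X Y f)"
    proof (rule e_mono[OF H[OF X] Y(2) k_mem[OF X Y(2) gf] kk])
      have "Cmp D (H X) (H Z) Z (e Z) (Cmp D (H X) (H Y) (H Z) (k Y Z g) (k X Y f)) =
        Cmp D (H X) (H Y) Z (Cmp D (H Y) (H Z) Z (e Z) (k Y Z g)) (k X Y f)"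
        using category_assoc[OF D H[OF X] H[OF Y(1)] H[OF Y(2)] Y(2) k_mem[OF X Y(1,3)] k_mem[OF Y(1,2,4)] e[OF Y(2)]] by simp
      also have "\<dots> = Cmp D (H X) (H Y) Z (Cmp D (H Y) Y Z g (e Y)) (k X Y f)"
        using e_nat[OF Y(1,2,4)] by simp
      also have "\<dots> = Cmp D (H X) Y Z g (Cmp D (H X) (H Y) Y (e Y) (k X Y f))"
        using category_assoc[OF D H[OF X] H[OF Y(1)] Y(1,2) k_mem[OF X Y(1,3)] e[OF Y(1)] Y(4)] .
      also have "\<dots> = Cmp D (H X) Y Z g (Cmp D (H X) X Y f (e X))"
        using e_nat[OF X Y(1,3)] by simp
      also have "\<dots> = Cmp D (H X) X Z (Cmp D X Y Z g f) (e X)"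
        using category_assoc[OF D H[OF X] X Y(1,2) e[OF X] Y(3,4)] by simp
      also have "\<dots> = Cmp D (H X) (H Z) Z (e Z) (k X Z (Cmp D X Y Z g f))"
        using e_nat[OF X Y(2) gf] by simp
      finally show "Cmp D (H X) (H Z) Z (e Z) (k X Z (Cmp D X Y Z g f)) =
        Cmp D (H X) (H Z) Z (e Z) (Cmp D (H X) (H Y) (H Z) (k Y Z g) (k X Y f))" by simp
    qed
    then have "G1 X Z (Cmp D X Y Z g f) = Cmp C (G0 X) (G0 Y) (G0 Z) (G1 Y Z g) (G1 X Y f)"
      using G1[OF X Y(2) gf] G1[OF X Y(1,3)] G1[OF Y(1,2,4)] G0 X Y
      by (intro F_inj[OF G0[OF X] G0[OF Y(2)]]) (auto simp: F_Cmp H_def intro!: category_Cmp[OF C])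
    then show "FArr G X Z (Cmp D X Y Z g f) = Cmp C (FOb G X) (FOb G Y) (FOb G Z) (FArr G Y Z g) (FArr G X Y f)"
      using X Y gf by (simp add: G_def)
  qed
  \<comment> \<open>The unit and its inverse are the preimages under \<open>F\<close> of
    \<open>e'\<close> and \<open>e\<close> at \<open>FOb F X\<close>; faithfulness pulls the
    equations for \<open>e\<close> and \<open>e'\<close> back to \<open>C\<close>.\<close>
  define u where "u X = pre X (G0 (FOb F X)) (e' (FOb F X))" for X
  define u' where "u' X = pre (G0 (FOb F X)) X (e (FOb F X))" for X
  have u: "u X \<in> Hom C X (G0 (FOb F X))" "FArr F X (G0 (FOb F X)) (u X) = e' (FOb F X)" if "X \<in> Ob C" for X
    using pre[OF that G0[OF F_ob[OF that]] e'[OF F_ob[OF that], unfolded H_def]] by (auto simp: u_def)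
  have u': "u' X \<in> Hom C (G0 (FOb F X)) X" "FArr F (G0 (FOb F X)) X (u' X) = e (FOb F X)" if "X \<in> Ob C" for X
    using pre[OF G0[OF F_ob[OF that]] that e[OF F_ob[OF that], unfolded H_def]] by (auto simp: u'_def)
  have e'_nat: "Cmp D Z W (H W) (e' W) h = Cmp D Z (H Z) (H W) (k Z W h) (e' Z)"
    if "Z \<in> Ob D" "W \<in> Ob D" "h \<in> Hom D Z W" for Z W h
  proof (rule e_mono[OF that(1,2)])
    show "Cmp D Z W (H W) (e' W) h \<in> Hom D Z (H W)" "Cmp D Z (H Z) (H W) (k Z W h) (e' Z) \<in> Hom D Z (H W)"
      using that by (auto intro!: category_Cmp[OF D] H e' k_mem)
    have "Cmp D Z (H W) W (e W) (Cmp D Z W (H W) (e' W) h) = h"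
      using category_assoc[OF D that(1,2) H[OF that(2)] that(2,3) e'[OF that(2)] e[OF that(2)]]
        ee'[OF that(2)] category_unit(2)[OF D that] by simp
    moreover have "Cmp D Z (H W) W (e W) (Cmp D Z (H Z) (H W) (k Z W h) (e' Z)) = Cmp D Z (H Z) W (Cmp D (H Z) Z W h (e Z)) (e' Z)"
      using category_assoc[OF D that(1) H[OF that(1)] H[OF that(2)] that(2) e'[OF that(1)] k_mem[OF that] e[OF that(2)]]
        e_nat[OF that] by simp
    moreover have "\<dots> = h"
      using category_assoc[OF D that(1) H[OF that(1)] that(1,2) e'[OF that(1)] e[OF that(1)] that(3)]
        ee'[OF that(1)] category_unit(1)[OF D that] by simp
    ultimately show "Cmp D Z (H W) W (e W) (Cmp D Z W (H W) (e' W) h) =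
      Cmp D Z (H W) W (e W) (Cmp D Z (H Z) (H W) (k Z W h) (e' Z))" by simp
  qed
  let ?GF = "comp_ftor C G F" and ?FG = "comp_ftor D F G" and ?C = "id_ftor C" and ?D = "id_ftor D"
  let ?u = "\<lambda>X\<in>Ob C. u X" and ?e = "\<lambda>Z\<in>Ob D. e Z"
  have \<eta>: "is_nat_iso C C ?C ?GF ?u"
    unfolding is_nat_iso_def is_nat_def is_iso_def
  proof (intro conjI ballI)
    show "?u \<in> (\<Pi>\<^sub>E X\<in>Ob C. Hom C (FOb ?C X) (FOb ?GF X))"
      using u F_ob by (auto simp: G_def)
  next
    fix X Y f assume X: "X \<in> Ob C" "Y \<in> Ob C" "f \<in> Hom C X Y"
    note FX = F_ob[OF X(1)] F_ob[OF X(2)] F_arr[OF X]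
    note GX = G0[OF FX(1)] G0[OF FX(2)] G1[OF FX]
    have "Cmp C X Y (G0 (FOb F Y)) (u Y) f =
      Cmp C X (G0 (FOb F X)) (G0 (FOb F Y)) (G1 (FOb F X) (FOb F Y) (FArr F X Y f)) (u X)"
    proof (rule F_inj[OF X(1) GX(2)])
      show "FArr F X (G0 (FOb F Y)) (Cmp C X Y (G0 (FOb F Y)) (u Y) f) = FArr F X (G0 (FOb F Y))
         (Cmp C X (G0 (FOb F X)) (G0 (FOb F Y)) (G1 (FOb F X) (FOb F Y) (FArr F X Y f)) (u X))"
        using e'_nat[OF FX] X GX u[OF X(1)] u[OF X(2)] by (simp add: F_Cmp H_def)
    qed (use X GX u[OF X(1)] u[OF X(2)] in \<open>auto intro!: category_Cmp[OF C]\<close>)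
    then show "Cmp C (FOb ?C X) (FOb ?C Y) (FOb ?GF Y) (?u Y) (FArr ?C X Y f) =
      Cmp C (FOb ?C X) (FOb ?GF X) (FOb ?GF Y) (FArr ?GF X Y f) (?u X)"
      using X FX by (simp add: G_def)
  next
    fix X assume X: "X \<in> Ob C"
    note FX = F_ob[OF X]
    note GX = G0[OF FX]
    have "Cmp C X (G0 (FOb F X)) X (u' X) (u X) = Idn C X"
      using X GX u[OF X] u'[OF X] ee'[OF FX] category_Idn[OF C X] F_Idn[OF X]
      by (intro F_inj[OF X X]) (auto simp: F_Cmp H_def intro!: category_Cmp[OF C])
    moreover have "Cmp C (G0 (FOb F X)) X (G0 (FOb F X)) (u X) (u' X) = Idn C (G0 (FOb F X))"
      using X GX u[OF X] u'[OF X] e'e[OF FX] category_Idn[OF C GX] F_Idn[OF GX]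
      by (intro F_inj[OF GX GX]) (auto simp: F_Cmp H_def intro!: category_Cmp[OF C])
    ultimately show "\<exists>g\<in>Hom C (FOb ?GF X) (FOb ?C X).
      Cmp C (FOb ?C X) (FOb ?GF X) (FOb ?C X) g (?u X) = Idn C (FOb ?C X) \<and>
      Cmp C (FOb ?GF X) (FOb ?C X) (FOb ?GF X) (?u X) g = Idn C (FOb ?GF X)"
      using X FX u'[OF X] by (intro bexI[of _ "u' X"]) (auto simp: G_def)
    show "?u X \<in> Hom C (FOb ?C X) (FOb ?GF X)"
      using X FX u[OF X] by (simp add: G_def)
  qed
  have \<epsilon>: "is_nat_iso D D ?FG ?D ?e"
    unfolding is_nat_iso_def is_nat_def is_iso_def
  proof (intro conjI ballI)
    show "?e \<in> (\<Pi>\<^sub>E X\<in>Ob D. Hom D (FOb ?FG X) (FOb ?D X))"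
      using e by (auto simp: G_def H_def)
  next
    fix Z W h assume Z: "Z \<in> Ob D" "W \<in> Ob D" "h \<in> Hom D Z W"
    then show "Cmp D (FOb ?FG Z) (FOb ?FG W) (FOb ?D W) (?e W) (FArr ?FG Z W h) =
      Cmp D (FOb ?FG Z) (FOb ?D Z) (FOb ?D W) (FArr ?D Z W h) (?e Z)"
      using e_nat[OF Z] G1[OF Z] by (simp add: G_def H_def)
  next
    fix Z assume Z: "Z \<in> Ob D"
    then show "\<exists>g\<in>Hom D (FOb ?D Z) (FOb ?FG Z).
      Cmp D (FOb ?FG Z) (FOb ?D Z) (FOb ?FG Z) g (?e Z) = Idn D (FOb ?FG Z) \<and>
      Cmp D (FOb ?D Z) (FOb ?FG Z) (FOb ?D Z) (?e Z) g = Idn D (FOb ?D Z)"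
      using e'[OF Z] e'e[OF Z] ee'[OF Z] by (intro bexI[of _ "e' Z"]) (auto simp: G_def H_def)
    show "?e Z \<in> Hom D (FOb ?FG Z) (FOb ?D Z)"
      using Z e by (simp add: G_def H_def)
  qed
  show ?thesis
    unfolding equivalent_cats_def using C D F G \<eta> \<epsilon> by blast
qed

section \<open>Functors into a universe of sets\<close>

lemma compose_PiE: "f \<in> A \<rightarrow>\<^sub>E B \<Longrightarrow> g \<in> B \<rightarrow>\<^sub>E C \<Longrightarrow> compose A g f \<in> A \<rightarrow>\<^sub>E C"
  by (auto simp: compose_def)

lemma compose_apply [simp]: "compose A g f x = (if x \<in> A then g (f x) else undefined)"
  by (simp add: compose_def)

lemma compose_eq_iff: "compose A g f = compose A g' f' \<longleftrightarrow> (\<forall>x\<in>A. g (f x) = g' (f' x))"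
  by (auto simp: compose_def fun_eq_iff)

lemma id_PiE: "(\<lambda>x\<in>A. x) \<in> A \<rightarrow>\<^sub>E A"
  by auto

lemma compose_eq_restrict_iff: "compose A g f = (\<lambda>x\<in>A. h x) \<longleftrightarrow> (\<forall>x\<in>A. g (f x) = h x)"
  by (auto simp: fun_eq_iff)

lemma compose_eq_PiE_iff:
  "k \<in> A \<rightarrow>\<^sub>E B \<Longrightarrow> compose A g f = k \<longleftrightarrow> (\<forall>x\<in>A. g (f x) = k x)"
  by (auto simp: fun_eq_iff PiE_arb[of k])

lemma restrict_eq_iff: "k \<in> extensional A \<Longrightarrow> (\<lambda>x\<in>A. f x) = k \<longleftrightarrow> (\<forall>x\<in>A. f x = k x)"
  by (auto intro!: extensionalityI[of _ A])

section \<open>Closure properties of a universe and codings into its element type\<close>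

locale set_universe =
  fixes U :: "'u set set"
  assumes universe: "universe U"
begin

lemma subset_in_U: "A \<in> U \<Longrightarrow> B \<subseteq> A \<Longrightarrow> B \<in> U"
  using universe unfolding universe_def by blast

lemma image_in_U: "A \<in> U \<Longrightarrow> f ` A \<in> U"
  using universe unfolding universe_def by metis

lemma UN_in_U: "I \<in> U \<Longrightarrow> (\<And>i. i \<in> I \<Longrightarrow> A i \<in> U) \<Longrightarrow> (\<Union>i\<in>I. A i) \<in> U"
  using universe unfolding universe_def by blast

text \<open>An infinite member contains a copy of the naturals, and closure under images carries
  that copy onto any countable range. The range of \<open>num\<close> later serves as index set of
  countable unions.\<close>

lemma range_in_U:
  fixes f :: "nat \<Rightarrow> 'u"
  shows "range f \<in> U"
proof -
  obtain A where A: "A \<in> U" "infinite A"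
    using universe unfolding universe_def by (elim conjE bexE)
  then obtain g :: "nat \<Rightarrow> 'u" where g: "inj g" "range g \<subseteq> A"
    using infinite_countable_subset by blast
  have "(f \<circ> inv g) ` range g = range f"
    using g(1) by (simp add: image_image)
  then show ?thesis
    using image_in_U[OF subset_in_U[OF A(1) g(2)], of "f \<circ> inv g"] by simp
qed

lemma infinite_UNIV_U: "infinite (UNIV :: 'u set)"
  using universe unfolding universe_def by (meson finite_subset subset_UNIV)

lemma inj_num: "inj (num :: nat \<Rightarrow> 'u)"
proof -
  have "\<exists>e :: nat \<Rightarrow> 'u. inj e"
    using infinite_countable_subset[OF infinite_UNIV_U] by blast
  then show ?thesis
    unfolding num_def by (rule someI_ex)
qed

lemma finite_in_U:
  assumes "finite (B :: 'u set)" shows "B \<in> U"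
proof (cases "B = {}")
  case True
  then show ?thesis using range_in_U subset_in_U by blast
next
  case False
  obtain f :: "nat \<Rightarrow> 'u" and n where f: "B = f ` {i. i < n}"
    using assms finite_imp_nat_seg_image_inj_on by metis
  then show ?thesis
    using subset_in_U[OF range_in_U[of f], of B] by blast
qed

lemma fincards_in_U: "fincards \<subseteq> U"
  by (auto simp: fincards_def intro: finite_in_U)

lemma finite_fincard: "m \<in> fincards \<Longrightarrow> finite m"
  by (auto simp: fincards_def)

lemma fincard_eq: "(m :: 'u set) \<in> fincards \<Longrightarrow> m = num ` {..<card m}"
  using inj_num by (auto simp: fincards_def card_image inj_on_subset)

lemma ex_fincard_bij:
  assumes "finite (F :: 'u set)"
  obtains m b c where "(m :: 'u set) \<in> fincards" "b \<in> m \<rightarrow>\<^sub>E F" "c \<in> F \<rightarrow>\<^sub>E m"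
    "\<forall>x\<in>m. c (b x) = x" "\<forall>y\<in>F. b (c y) = y"
proof -
  define m :: "'u set" where "m = num ` {..<card F}"
  have "card m = card F" "finite m"
    using inj_num by (auto simp: m_def card_image inj_on_subset)
  then obtain b where b: "bij_betw b m F"
    using assms finite_same_card_bij by blast
  show thesis
    by (rule that[of m "restrict b m" "restrict (inv_into m b) F"])
      (use b in \<open>auto simp: m_def fincards_def bij_betw_def inj_on_def inv_into_into f_inv_into_f\<close>)
qed

text \<open>A function space is not a subset of \<open>'u\<close>, so the statement concerns images
  under an arbitrary \<open>e\<close>. The induction splits off one coordinate and obtains a union
  over \<open>X\<close> of images for the smaller domain; \<open>e\<close> has to vary because it
  gets precomposed with the update at \<open>i\<close>.\<close>

lemma function_image_in_U:
  fixes e :: "('i \<Rightarrow> 'u) \<Rightarrow> 'u"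
  assumes "finite m" "X \<in> U"
  shows "e ` (m \<rightarrow>\<^sub>E X) \<in> U"
  using assms(1)
proof (induction m arbitrary: e)
  case empty
  then show ?case by (simp add: finite_in_U)
next
  case (insert i m)
  have "e ` (insert i m \<rightarrow>\<^sub>E X) = (\<Union>y\<in>X. (\<lambda>g. e (g(i := y))) ` (m \<rightarrow>\<^sub>E X))"
    unfolding PiE_insert_eq by (auto simp: image_iff)
  then show ?case
    using UN_in_U[OF assms(2)] insert.IH by simp
qed

text \<open>An infinite type has an injective pairing, and iterating it encodes lists of a fixed
  length. Recording the length as well separates lists of different lengths.\<close>

lemma ex_inj_list: "\<exists>e :: 'u list \<Rightarrow> 'u. inj e"
proof -
  obtain p :: "'u \<times> 'u \<Rightarrow> 'u" where p: "inj p"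
    using card_of_Times_same_infinite[OF infinite_UNIV_U]
    by (metis UNIV_Times_UNIV bij_betw_imp_inj_on card_of_ordIso)
  define e0 where "e0 = (\<lambda>xs. foldr (\<lambda>x y. p (x, y)) xs undefined)"
  have e0: "xs = ys" if "length xs = length ys" "e0 xs = e0 ys" for xs ys
    using that by (induction xs ys rule: list_induct2) (auto simp: e0_def dest: injD[OF p])
  have "inj (\<lambda>xs. p (num (length xs), e0 xs))"
    using injD[OF p] injD[OF inj_num] e0 by (intro injI) blast
  then show ?thesis by blast
qed

text \<open>A finite set is encoded through a chosen listing of its elements. This lets finite
  subsets be objects of a category whose objects are elements of \<open>'u\<close>, the kind of
  index category over which \<open>is_finitary\<close> quantifies.\<close>

lemma ex_inj_finite_sets: "\<exists>e :: 'u set \<Rightarrow> 'u. inj_on e {F. finite F}"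
proof -
  obtain e :: "'u list \<Rightarrow> 'u" where e: "inj e" using ex_inj_list by blast
  have "inj_on (\<lambda>F. e (SOME xs. set xs = F)) {F. finite F}"
  proof (rule inj_onI)
    fix F G :: "'u set"
    assume "F \<in> {F. finite F}" "G \<in> {F. finite F}"
    then have "set (SOME xs. set xs = F) = F" "set (SOME xs. set xs = G) = G"
      using finite_list by (metis (mono_tags) mem_Collect_eq someI_ex)+
    moreover assume "e (SOME xs. set xs = F) = e (SOME xs. set xs = G)"
    ultimately show "F = G" using injD[OF e] by metis
  qed
  then show ?thesis by blast
qed

text \<open>A finite cardinal is determined by its size, and an extensional function on it by the
  finite list of its values, so a triple amounts to a list over \<open>'u\<close>.\<close>

lemma ex_inj_triples: "\<exists>e :: 'u triple \<Rightarrow> 'u. inj_on e (triples A X)"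
proof -
  obtain e :: "'u list \<Rightarrow> 'u" where e: "inj e" using ex_inj_list by blast
  define E where "E = (\<lambda>(m, a, f :: 'u \<Rightarrow> 'u). e (num (card m) # a # map (\<lambda>i. f (num i)) [0..<card (m :: 'u set)]))"
  have "inj_on E (triples A X)"
  proof (rule inj_onI)
    fix p q assume p: "p \<in> triples A X" and q: "q \<in> triples A X" and eq: "E p = E q"
    obtain m a f m' a' f' where pq: "p = (m, a, f)" "q = (m', a', f')"
      by (cases p; cases q) auto
    have m: "m \<in> fincards" "m' \<in> fincards" "f \<in> m \<rightarrow>\<^sub>E X" "f' \<in> m' \<rightarrow>\<^sub>E X"
      using p q pq by (auto simp: triples_def)
    have l: "num (card m) # a # map (\<lambda>i. f (num i)) [0..<card m] =
       num (card m') # a' # map (\<lambda>i. f' (num i)) [0..<card m']"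
      using eq unfolding E_def pq prod.case by (rule injD[OF e])
    then have c: "card m = card m'" by (simp add: inj_eq[OF inj_num])
    have mm: "m = m'"
      by (rule trans[OF fincard_eq[OF m(1)]]) (simp only: c fincard_eq[OF m(2), symmetric])
    have "f x = f' x" if "x \<in> m" for x
    proof -
      obtain i where "i < card m" "x = num i"
        using \<open>x \<in> m\<close> subst[OF fincard_eq[OF m(1)], of "\<lambda>n. x \<in> n"] by blast
      then show ?thesis using l c by auto
    qed
    then have "f = f'" using m mm by (auto intro: PiE_ext)
    then show "p = q" using l mm pq by simp
  qed
  then show ?thesis by blast
qed

end

section \<open>Functors to sets and natural transformations in terms of elements\<close>

lemma FIN_simps [simp]:
  "Hom (FIN U) A B = A \<rightarrow>\<^sub>E B" "Idn (FIN U) A = (\<lambda>x\<in>A. x)" "Cmp (FIN U) A B C g f = compose A g f"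
  by (simp_all add: FIN_def)

context set_universe
begin

lemma Ob_FIN [simp]: "Ob (FIN U) = fincards"
  using fincards_in_U by (auto simp: FIN_def)

lemma ftor_ob: "is_ftor C (SET U) F \<Longrightarrow> X \<in> Ob C \<Longrightarrow> FOb F X \<in> U"
  unfolding is_ftor_def by auto

lemma ftor_arr:
  assumes "is_ftor C (SET U) F" "X \<in> Ob C" "Y \<in> Ob C" "f \<in> Hom C X Y"
  shows "FArr F X Y f \<in> FOb F X \<rightarrow>\<^sub>E FOb F Y"
  using ftor_arr_mem[OF assms] by simp

lemma ftor_mem:
  "is_ftor C (SET U) F \<Longrightarrow> X \<in> Ob C \<Longrightarrow> Y \<in> Ob C \<Longrightarrow> f \<in> Hom C X Y \<Longrightarrow> a \<in> FOb F X \<Longrightarrow>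
   FArr F X Y f a \<in> FOb F Y"
  by (rule PiE_mem[OF ftor_arr])

lemma ftor_id:
  "is_ftor C (SET U) F \<Longrightarrow> X \<in> Ob C \<Longrightarrow> a \<in> FOb F X \<Longrightarrow> FArr F X X (Idn C X) a = a"
  unfolding is_ftor_def by simp

lemma ftor_comp:
  "is_ftor C (SET U) F \<Longrightarrow> X \<in> Ob C \<Longrightarrow> Y \<in> Ob C \<Longrightarrow> Z \<in> Ob C \<Longrightarrow>
   f \<in> Hom C X Y \<Longrightarrow> g \<in> Hom C Y Z \<Longrightarrow> a \<in> FOb F X \<Longrightarrow>
   FArr F Y Z g (FArr F X Y f a) = FArr F X Z (Cmp C X Y Z g f) a"
  unfolding is_ftor_def by (simp add: compose_eq)

lemma ftor_Idn:
  "is_ftor C (SET U) F \<Longrightarrow> X \<in> Ob C \<Longrightarrow> FArr F X X (Idn C X) = (\<lambda>x\<in>FOb F X. x)"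
  unfolding is_ftor_def by simp

lemma ftor_Cmp:
  "is_ftor C (SET U) F \<Longrightarrow> X \<in> Ob C \<Longrightarrow> Y \<in> Ob C \<Longrightarrow> Z \<in> Ob C \<Longrightarrow>
   f \<in> Hom C X Y \<Longrightarrow> g \<in> Hom C Y Z \<Longrightarrow>
   FArr F X Z (Cmp C X Y Z g f) = compose (FOb F X) (FArr F Y Z g) (FArr F X Y f)"
  unfolding is_ftor_def by simp

text \<open>The functor laws are asked pointwise; their conversion into equations between
  extensional functions is done here once for all functors built below.\<close>

lemma ftorI:
  assumes "FOb F = (\<lambda>X\<in>Ob C. ob X)"
    and "FArr F = (\<lambda>X\<in>Ob C. \<lambda>Y\<in>Ob C. \<lambda>f\<in>Hom C X Y. h X Y f)"
    and cat: "is_category C"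
    and "\<And>X. X \<in> Ob C \<Longrightarrow> ob X \<in> U"
    and "\<And>X Y f. X \<in> Ob C \<Longrightarrow> Y \<in> Ob C \<Longrightarrow> f \<in> Hom C X Y \<Longrightarrow> h X Y f \<in> ob X \<rightarrow>\<^sub>E ob Y"
    and "\<And>X t. X \<in> Ob C \<Longrightarrow> t \<in> ob X \<Longrightarrow> h X X (Idn C X) t = t"
    and "\<And>X Y Z f g t. X \<in> Ob C \<Longrightarrow> Y \<in> Ob C \<Longrightarrow> Z \<in> Ob C \<Longrightarrow> f \<in> Hom C X Y \<Longrightarrow>
           g \<in> Hom C Y Z \<Longrightarrow> t \<in> ob X \<Longrightarrow> h X Z (Cmp C X Y Z g f) t = h Y Z g (h X Y f t)"
  shows "is_ftor C (SET U) F"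
proof -
  have "Idn C X \<in> Hom C X X" if "X \<in> Ob C" for X
    using cat that unfolding is_category_def by blast
  moreover have "Cmp C X Y Z g f \<in> Hom C X Z"
    if "X \<in> Ob C" "Y \<in> Ob C" "Z \<in> Ob C" "f \<in> Hom C X Y" "g \<in> Hom C Y Z" for X Y Z f g
    using cat that unfolding is_category_def by blast
  moreover have "h X X (Idn C X) = (\<lambda>t\<in>ob X. t)" if "X \<in> Ob C" for X
    using assms(5)[OF that that] assms(6)[OF that] calculation(1)[OF that]
    by (auto intro!: PiE_ext[of _ "ob X" "\<lambda>_. ob X"])
  moreover have "h X Z (Cmp C X Y Z g f) = compose (ob X) (h Y Z g) (h X Y f)"
    if "X \<in> Ob C" "Y \<in> Ob C" "Z \<in> Ob C" "f \<in> Hom C X Y" "g \<in> Hom C Y Z" for X Y Z f g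
    using assms(5)[OF that(1,3) calculation(2)[OF that]] assms(7)[OF that]
      compose_PiE[OF assms(5)[OF that(1,2,4)] assms(5)[OF that(2,3,5)]]
    by (auto intro!: PiE_ext[of _ "ob X" "\<lambda>_. ob Z"] simp: compose_eq)
  ultimately show ?thesis
    unfolding is_ftor_def SET_simps using assms(4,5)
    by (simp add: assms(1,2) restrict_PiE_iff PiE_iff[of "restrict _ _"])
qed

lemma nat_arr: "is_nat C (SET U) F G \<alpha> \<Longrightarrow> X \<in> Ob C \<Longrightarrow> \<alpha> X \<in> FOb F X \<rightarrow>\<^sub>E FOb G X"
  unfolding is_nat_def SET_simps by (elim conjE) (rule PiE_mem)

lemma nat_mem: "is_nat C (SET U) F G \<alpha> \<Longrightarrow> X \<in> Ob C \<Longrightarrow> a \<in> FOb F X \<Longrightarrow> \<alpha> X a \<in> FOb G X"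
  by (rule PiE_mem[OF nat_arr])

lemma nat_ext: "is_nat C (SET U) F G \<alpha> \<Longrightarrow> \<alpha> \<in> extensional (Ob C)"
  unfolding is_nat_def by (auto simp: PiE_iff)

lemma nat_natural:
  "is_nat C (SET U) F G \<alpha> \<Longrightarrow> X \<in> Ob C \<Longrightarrow> Y \<in> Ob C \<Longrightarrow> f \<in> Hom C X Y \<Longrightarrow> a \<in> FOb F X \<Longrightarrow>
   \<alpha> Y (FArr F X Y f a) = FArr G X Y f (\<alpha> X a)"
  unfolding is_nat_def by (simp add: compose_eq_iff)

lemma natI:
  assumes "\<alpha> \<in> extensional (Ob C)"
    and "\<And>X. X \<in> Ob C \<Longrightarrow> \<alpha> X \<in> FOb F X \<rightarrow>\<^sub>E FOb G X"
    and "\<And>X Y f a. X \<in> Ob C \<Longrightarrow> Y \<in> Ob C \<Longrightarrow> f \<in> Hom C X Y \<Longrightarrow> a \<in> FOb F X \<Longrightarrow>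
           \<alpha> Y (FArr F X Y f a) = FArr G X Y f (\<alpha> X a)"
  shows "is_nat C (SET U) F G \<alpha>"
  using assms unfolding is_nat_def by (simp add: compose_eq_iff PiE_iff)

lemma nat_eqI:
  assumes "is_nat C (SET U) F G \<alpha>" "is_nat C (SET U) F G \<beta>"
    and "\<And>X t. X \<in> Ob C \<Longrightarrow> t \<in> FOb F X \<Longrightarrow> \<alpha> X t = \<beta> X t"
  shows "\<alpha> = \<beta>"
proof (rule extensionalityI[OF nat_ext nat_ext])
  show "\<alpha> X = \<beta> X" if "X \<in> Ob C" for X
    using nat_arr[OF assms(1) that] nat_arr[OF assms(2) that] assms(3)[OF that]
    by (rule PiE_ext)
qed (use assms in auto)

abbreviation "fin_ftor \<equiv> is_ftor (FIN U) (SET U)"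
abbreviation "set_ftor \<equiv> is_ftor (SET U) (SET U)"
abbreviation "fin_nat \<equiv> is_nat (FIN U) (SET U)"
abbreviation "fin_cat \<equiv> ftor_cat (FIN U) (SET U)"
abbreviation "one_cat \<equiv> one_object_ecat_cat (FSET U)"
abbreviation "set_nat \<equiv> is_nat (SET U) (SET U)"

lemmas fin_ob = ftor_ob[of "FIN U", simplified]
lemmas fin_arr = ftor_arr[of "FIN U", simplified]
lemmas fin_mem = ftor_mem[of "FIN U", simplified]
lemmas fin_id = ftor_id[of "FIN U", simplified]
lemmas fin_nat_arr = nat_arr[of "FIN U", simplified]
lemmas fin_nat_mem = nat_mem[of "FIN U", simplified]
lemmas fin_natural = nat_natural[of "FIN U", simplified]
lemmas set_ob = ftor_ob[of "SET U", simplified]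
lemmas set_arr = ftor_arr[of "SET U", simplified]
lemmas set_mem = ftor_mem[of "SET U", simplified]
lemmas set_id = ftor_id[of "SET U", simplified]
lemmas set_comp = ftor_comp[of "SET U", simplified]
lemmas set_nat_arr = nat_arr[of "SET U", simplified]
lemmas set_nat_mem = nat_mem[of "SET U", simplified]
lemmas set_natural = nat_natural[of "SET U", simplified]

lemma is_category_SET: "is_category (SET U)"
  unfolding is_category_def
proof (intro conjI ballI; unfold SET_simps)
  fix f X Y assume "f \<in> X \<rightarrow>\<^sub>E (Y :: 'u set)"
  then show "compose X f (\<lambda>x\<in>X. x) = f" "compose X (\<lambda>x\<in>Y. x) f = f"
    by (auto simp: PiE_iff intro!: compose_Id Id_compose)
qed (auto simp: PiE_mem compose_eq_iff)

lemma is_category_FIN: "is_category (FIN U)"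
  unfolding FIN_def by (rule is_category_full_sub[OF is_category_SET])

lemma is_category_ftor_cat:
  assumes "is_category C" shows "is_category (ftor_cat C (SET U))"
proof -
  have i: "is_nat C (SET U) F F (\<lambda>X\<in>Ob C. \<lambda>x\<in>FOb F X. x)" if "is_ftor C (SET U) F" for F
    by (rule natI) (auto simp: ftor_mem[OF that])
  have c: "is_nat C (SET U) F H (\<lambda>X\<in>Ob C. compose (FOb F X) (\<beta> X) (\<alpha> X))"
    if "is_nat C (SET U) F G \<alpha>" "is_nat C (SET U) G H \<beta>" "is_ftor C (SET U) F"
    for F G H \<alpha> \<beta>
    by (rule natI)
      (auto simp: compose_eq nat_mem[OF that(1)] nat_mem[OF that(2)] ftor_mem[OF that(3)]
        nat_natural[OF that(1)] nat_natural[OF that(2)] intro!: compose_PiE[OF nat_arr[OF that(1)] nat_arr[OF that(2)]])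
  show ?thesis
    unfolding is_category_def
  proof (intro conjI ballI)
    fix F G \<alpha> assume "F \<in> Ob (ftor_cat C (SET U))" "G \<in> Ob (ftor_cat C (SET U))"
      and "\<alpha> \<in> Hom (ftor_cat C (SET U)) F G"
    then have F: "is_ftor C (SET U) F" and G: "is_ftor C (SET U) G" and \<alpha>: "is_nat C (SET U) F G \<alpha>"
      by auto
    show "Cmp (ftor_cat C (SET U)) F F G \<alpha> (Idn (ftor_cat C (SET U)) F) = \<alpha>"
      using nat_eqI[OF c[OF i[OF F] \<alpha> F] \<alpha>] by (simp add: compose_eq)
    show "Cmp (ftor_cat C (SET U)) F G G (Idn (ftor_cat C (SET U)) G) \<alpha> = \<alpha>"
      using nat_eqI[OF c[OF \<alpha> i[OF G] F] \<alpha>] by (simp add: compose_eq nat_mem[OF \<alpha>])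
  next
    fix E F G H \<alpha> \<beta> \<gamma> assume "E \<in> Ob (ftor_cat C (SET U))"
      "\<alpha> \<in> Hom (ftor_cat C (SET U)) E F"
    then have \<alpha>: "is_nat C (SET U) E F \<alpha>" by auto
    show "Cmp (ftor_cat C (SET U)) E F H (Cmp (ftor_cat C (SET U)) F G H \<gamma> \<beta>) \<alpha> =
      Cmp (ftor_cat C (SET U)) E G H \<gamma> (Cmp (ftor_cat C (SET U)) E F G \<beta> \<alpha>)"
      by (auto simp: compose_eq_iff compose_eq nat_mem[OF \<alpha>] intro!: restrict_ext)
  qed (use i c in auto)
qed

lemma ftor_comp_ftor:
  assumes "is_ftor C (SET U) F" "set_ftor G" "is_category C"
  shows "is_ftor C (SET U) (comp_ftor C G F)"
  by (rule ftorI[where ob = "\<lambda>X. FOb G (FOb F X)" and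
        h = "\<lambda>X Y f. FArr G (FOb F X) (FOb F Y) (FArr F X Y f)"])
    (use assms(3) in \<open>simp_all add: ftor_ob[OF assms(1)] set_ob[OF assms(2)] ftor_Idn[OF assms(1)]
      set_id[OF assms(2)] ftor_Cmp[OF assms(1)] set_comp[OF assms(2)] ftor_arr[OF assms(1)]
      set_arr[OF assms(2)]\<close>)

end

section \<open>Coends\<close>

lemma equiv_coend_rel: "equiv UNIV (coend_rel A X)"
  unfolding coend_rel_def
  by (intro equivI refl_rtrancl trans_rtrancl sym_rtrancl sym_Un_converse) auto

text \<open>The relation is the equivalence closure of its generators. The type of
  \<open>\<phi>\<close> is left open because truth values are used as invariants as well as
  elements.\<close>

lemma coend_rel_invariant:
  assumes "\<And>p q. (p, q) \<in> coend_gen A X \<Longrightarrow> \<phi> p = \<phi> q" "(p, q) \<in> coend_rel A X"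
  shows "\<phi> p = \<phi> q"
  using assms(2) unfolding coend_rel_def
  by (induction rule: rtrancl_induct) (auto dest: assms(1))

context set_universe
begin

lemma triples_iff: "(m, a, f) \<in> triples A X \<longleftrightarrow> m \<in> fincards \<and> a \<in> FOb A m \<and> f \<in> m \<rightarrow>\<^sub>E X"
  by (simp add: triples_def)

text \<open>Validity of a triple is itself an invariant of the generators, by the action of
  \<open>A\<close> on arrows and composition of functions; a class that meets
  \<open>triples A X\<close> therefore lies inside it.\<close>

lemma coend_rel_triples:
  assumes "fin_ftor A" "(p, q) \<in> coend_rel A X"
  shows "p \<in> triples A X \<longleftrightarrow> q \<in> triples A X"
  using _ assms(2)
proof (rule coend_rel_invariant)
  fix p q assume "(p, q) \<in> coend_gen A X"
  then show "(p \<in> triples A X) = (q \<in> triples A X)"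
    using fin_mem[OF assms(1)] compose_PiE unfolding coend_gen_def triples_def by fastforce
qed

text \<open>\<open>code\<close> is injective as soon as some injection of the quotient into
  \<open>'u\<close> exists; a chosen representative of each class followed by an injection of
  triples is one.\<close>

lemma cls_eq_iff:
  assumes "fin_ftor A" "p \<in> triples A X" "q \<in> triples A X"
  shows "cls A X p = cls A X q \<longleftrightarrow> (p, q) \<in> coend_rel A X"
proof -
  let ?Q = "triples A X // coend_rel A X"
  obtain e :: "'u triple \<Rightarrow> 'u" where e: "inj_on e (triples A X)" using ex_inj_triples by blast
  have r: "(SOME p. p \<in> c) \<in> triples A X \<and> c = coend_rel A X `` {SOME p. p \<in> c}" if c: "c \<in> ?Q" for c
  proof -
    obtain p where p: "p \<in> triples A X" "c = coend_rel A X `` {p}"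
      using c by (rule quotientE)
    have "p \<in> c" using p(2) by (simp add: coend_rel_def)
    then have "(SOME p. p \<in> c) \<in> c" by (rule someI)
    then have "(p, SOME p. p \<in> c) \<in> coend_rel A X" unfolding p(2) by simp
    then show ?thesis
      using coend_rel_triples[OF assms(1)] p equiv_class_eq[OF equiv_coend_rel] by metis
  qed
  have "inj_on (\<lambda>c. e (SOME p. p \<in> c)) ?Q"
    using r by (intro inj_onI) (metis inj_onD[OF e])
  then have "inj_on (code ?Q :: _ \<Rightarrow> 'u) ?Q"
    unfolding code_def by (rule someI[where P = "\<lambda>e. inj_on e ?Q"])
  then have "cls A X p = cls A X q \<longleftrightarrow> coend_rel A X `` {p} = coend_rel A X `` {q}"
    unfolding cls_def using assms(2,3) by (intro inj_on_eq_iff) (auto intro: quotientI)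
  then show ?thesis
    using eq_equiv_class_iff[OF equiv_coend_rel, of p q] by simp
qed

lemma cls_in_coend: "m \<in> fincards \<Longrightarrow> a \<in> FOb A m \<Longrightarrow> f \<in> m \<rightarrow>\<^sub>E X \<Longrightarrow> cls A X (m, a, f) \<in> coend A X"
  by (simp add: coend_def triples_iff)

lemma coendE:
  assumes "t \<in> coend A X"
  obtains m a f where "m \<in> fincards" "a \<in> FOb A m" "f \<in> m \<rightarrow>\<^sub>E X" "t = cls A X (m, a, f)"
  using assms by (auto simp: coend_def triples_def)

text \<open>The generating identification of the coend: a map \<open>u\<close> of cardinals acts
  either on the labelling, by precomposition, or on the element, by the functor.\<close>

lemma cls_slide:
  assumes "fin_ftor A" "m \<in> fincards" "m' \<in> fincards" "u \<in> m \<rightarrow>\<^sub>E m'"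
    "a \<in> FOb A m" "f \<in> m' \<rightarrow>\<^sub>E X"
  shows "cls A X (m, a, compose m f u) = cls A X (m', FArr A m m' u a, f)"
proof (subst cls_eq_iff[OF assms(1)])
  show "((m, a, compose m f u), m', FArr A m m' u a, f) \<in> coend_rel A X"
    unfolding coend_rel_def coend_gen_def using assms(2-) by blast
qed (simp_all only: triples_iff assms fin_mem[OF assms(1-5)] compose_PiE[OF assms(4,6)] simp_thms)

lemma cls_invariant:
  assumes "fin_ftor A" "p \<in> triples A X" "q \<in> triples A X" "cls A X p = cls A X q"
    and "\<And>m m' u a f. m \<in> fincards \<Longrightarrow> m' \<in> fincards \<Longrightarrow> u \<in> m \<rightarrow>\<^sub>E m' \<Longrightarrow> a \<in> FOb A m \<Longrightarrow>
      f \<in> m' \<rightarrow>\<^sub>E X \<Longrightarrow> \<phi> (m, a, compose m f u) = \<phi> (m', FArr A m m' u a, f)"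
  shows "\<phi> p = \<phi> q"
proof (rule coend_rel_invariant)
  show "(p, q) \<in> coend_rel A X"
    using assms(4) by (subst (asm) cls_eq_iff[OF assms(1-3)])
qed (use assms(5) in \<open>auto simp: coend_gen_def\<close>)

text \<open>\<open>coend_lift\<close> evaluates \<open>\<phi>\<close> at an arbitrarily chosen
  representative; the last premise makes the value independent of that choice.\<close>

lemma coend_lift_cls:
  assumes "fin_ftor A" "m \<in> fincards" "a \<in> FOb A m" "f \<in> m \<rightarrow>\<^sub>E X"
    and "\<And>m m' u a f. m \<in> fincards \<Longrightarrow> m' \<in> fincards \<Longrightarrow> u \<in> m \<rightarrow>\<^sub>E m' \<Longrightarrow> a \<in> FOb A m \<Longrightarrow>
      f \<in> m' \<rightarrow>\<^sub>E X \<Longrightarrow> \<phi> (m, a, compose m f u) = \<phi> (m', FArr A m m' u a, f)"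
  shows "coend_lift A X \<phi> (cls A X (m, a, f)) = \<phi> (m, a, f)"
proof -
  let ?t = "cls A X (m, a, f)"
  let ?q = "SOME p. p \<in> triples A X \<and> cls A X p = ?t"
  have "(m, a, f) \<in> triples A X \<and> cls A X (m, a, f) = ?t"
    using assms(2-4) by (simp add: triples_iff)
  then have "?q \<in> triples A X \<and> cls A X ?q = ?t" by (rule someI)
  then have "\<phi> ?q = \<phi> (m, a, f)"
    using assms(2-4) by (intro cls_invariant[OF assms(1) _ _ _ assms(5)]) (auto simp: triples_iff)
  then show ?thesis
    by (simp add: coend_lift_def cls_in_coend assms(2-4))
qed

lemma coend_lift_ext: "coend_lift A X \<phi> \<in> extensional (coend A X)"
  by (simp add: coend_lift_def)

lemma coend_lift_PiE:
  assumes "\<And>m a f. m \<in> fincards \<Longrightarrow> a \<in> FOb A m \<Longrightarrow> f \<in> m \<rightarrow>\<^sub>E X \<Longrightarrow> \<phi> (m, a, f) \<in> Y"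
  shows "coend_lift A X \<phi> \<in> coend A X \<rightarrow>\<^sub>E Y"
proof -
  have "\<phi> (SOME p. p \<in> triples A X \<and> cls A X p = t) \<in> Y" if "t \<in> coend A X" for t
  proof -
    have "\<exists>p. p \<in> triples A X \<and> cls A X p = t" using that by (auto simp: coend_def)
    then have "(SOME p. p \<in> triples A X \<and> cls A X p = t) \<in> triples A X"
      by (rule someI2_ex) auto
    then show ?thesis
      using assms by (auto simp: triples_def)
  qed
  then show ?thesis by (auto simp: coend_lift_def)
qed

text \<open>There are countably many finite cardinals, each \<open>FOb A m\<close> is small, and
  only finite powers of \<open>X\<close> occur, so closure under small unions suffices. Indexing by
  \<open>num n\<close> keeps the index set inside \<open>'u\<close>, and \<open>inv num\<close>
  recovers \<open>n\<close>.\<close>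

lemma coend_in_U:
  assumes "fin_ftor A" "X \<in> U"
  shows "coend A X \<in> U"
proof -
  have "coend A X = (\<Union>i\<in>range (num :: nat \<Rightarrow> 'u).
     \<Union>a\<in>FOb A (num ` {..<inv num i}). (\<lambda>f. cls A X (num ` {..<inv num i}, a, f)) ` (num ` {..<inv num i} \<rightarrow>\<^sub>E X))"
    unfolding coend_def triples_def fincards_def by (auto simp: inv_f_f[OF inj_num] image_iff)
  also have "\<dots> \<in> U"
    by (intro UN_in_U range_in_U fin_ob[OF assms(1)] function_image_in_U finite_imageI assms(2) finite_lessThan)
      (simp add: fincards_def)
  finally show ?thesis .
qed

text \<open>The action on maps of the left Kan extension along the inclusion. The arrow part of
  \<open>tens_ob A B\<close> is this map at \<open>FArr B n n' v\<close>, so the laws proved for it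
  serve both constructions.\<close>

definition lan_map :: "'u endo \<Rightarrow> 'u set \<Rightarrow> 'u set \<Rightarrow> ('u \<Rightarrow> 'u) \<Rightarrow> 'u \<Rightarrow> 'u" where
  "lan_map A X Y v = coend_lift A X (\<lambda>(m, a, f). cls A Y (m, a, compose m v f))"

lemma lan_map_PiE: "v \<in> X \<rightarrow>\<^sub>E Y \<Longrightarrow> lan_map A X Y v \<in> coend A X \<rightarrow>\<^sub>E coend A Y"
  unfolding lan_map_def by (rule coend_lift_PiE) (auto intro!: cls_in_coend)

lemma compose_assoc_PiE: "f \<in> m \<rightarrow>\<^sub>E X \<Longrightarrow> compose m h (compose m g f) = compose m (compose X h g) f"
  by (rule compose_assoc) auto

lemma lan_map_cls:
  assumes "fin_ftor A" "m \<in> fincards" "a \<in> FOb A m" "f \<in> m \<rightarrow>\<^sub>E X" "v \<in> X \<rightarrow>\<^sub>E Y"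
  shows "lan_map A X Y v (cls A X (m, a, f)) = cls A Y (m, a, compose m v f)"
  unfolding lan_map_def
proof (subst coend_lift_cls[OF assms(1-4)])
  fix m m' :: "'u set" and u a f
  assume u: "m \<in> fincards" "m' \<in> fincards" "u \<in> m \<rightarrow>\<^sub>E m'" "a \<in> FOb A m" "f \<in> m' \<rightarrow>\<^sub>E X"
  show "(\<lambda>(m, a, f). cls A Y (m, a, compose m v f)) (m, a, compose m f u) =
    (\<lambda>(m, a, f). cls A Y (m, a, compose m v f)) (m', FArr A m m' u a, f)"
    using cls_slide[OF assms(1) u(1-4) compose_PiE[OF u(5) assms(5)]]
    by (simp add: compose_assoc_PiE[OF u(3)])
qed simp

lemma lan_map_id:
  assumes "fin_ftor A" "t \<in> coend A X"
  shows "lan_map A X X (\<lambda>x\<in>X. x) t = t"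
  using assms(2)
proof (rule coendE)
  fix m a f assume t: "m \<in> fincards" "a \<in> FOb A m" "f \<in> m \<rightarrow>\<^sub>E X" "t = cls A X (m, a, f)"
  have "compose m (\<lambda>x\<in>X. x) f = f" using t(3) by (auto intro!: Id_compose simp: PiE_iff)
  then show ?thesis using lan_map_cls[OF assms(1) t(1-3) id_PiE] t(4) by simp
qed

lemma lan_map_comp:
  assumes "fin_ftor A" "t \<in> coend A X" "f \<in> X \<rightarrow>\<^sub>E Y" "g \<in> Y \<rightarrow>\<^sub>E Z"
  shows "lan_map A X Z (compose X g f) t = lan_map A Y Z g (lan_map A X Y f t)"
  using assms(2)
proof (rule coendE)
  fix m a h assume t: "m \<in> fincards" "a \<in> FOb A m" "h \<in> m \<rightarrow>\<^sub>E X" "t = cls A X (m, a, h)"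
  show ?thesis
    unfolding t(4) lan_map_cls[OF assms(1) t(1-3) compose_PiE[OF assms(3,4)]]
      lan_map_cls[OF assms(1) t(1-3) assms(3)]
      lan_map_cls[OF assms(1) t(1-2) compose_PiE[OF t(3) assms(3)] assms(4)]
    by (simp add: compose_assoc_PiE[OF t(3)])
qed

text \<open>The left Kan extension of \<open>A\<close> along the inclusion of the finite cardinals
  into \<open>U\<close>.\<close>

definition lan :: "'u endo \<Rightarrow> 'u endo" where
  "lan A = \<lparr>FOb = (\<lambda>X\<in>U. coend A X), FArr = (\<lambda>X\<in>U. \<lambda>Y\<in>U. \<lambda>v\<in>X \<rightarrow>\<^sub>E Y. lan_map A X Y v)\<rparr>"

lemma lan_simps [simp]:
  "X \<in> U \<Longrightarrow> FOb (lan A) X = coend A X"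
  "X \<in> U \<Longrightarrow> Y \<in> U \<Longrightarrow> v \<in> X \<rightarrow>\<^sub>E Y \<Longrightarrow> FArr (lan A) X Y v = lan_map A X Y v"
  by (simp_all add: lan_def)

lemma ftor_lan: "fin_ftor A \<Longrightarrow> set_ftor (lan A)"
  by (rule ftorI[where ob = "coend A" and h = "lan_map A"])
    (simp_all add: lan_def is_category_SET coend_in_U lan_map_PiE lan_map_id lan_map_comp)

section \<open>The substitution tensor product and its constraints on representatives\<close>

lemma tens_ob_simps [simp]:
  "n \<in> fincards \<Longrightarrow> FOb (tens_ob A B) n = coend A (FOb B n)"
  "n \<in> fincards \<Longrightarrow> n' \<in> fincards \<Longrightarrow> v \<in> n \<rightarrow>\<^sub>E n' \<Longrightarrow>
   FArr (tens_ob A B) n n' v = lan_map A (FOb B n) (FOb B n') (FArr B n n' v)"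
  by (simp_all add: tens_ob_def lan_map_def)

lemma fin_Idn: "fin_ftor B \<Longrightarrow> n \<in> fincards \<Longrightarrow> FArr B n n (\<lambda>x\<in>n. x) = (\<lambda>x\<in>FOb B n. x)"
  using ftor_Idn[of "FIN U"] by simp

lemma fin_Cmp:
  "fin_ftor B \<Longrightarrow> X \<in> fincards \<Longrightarrow> Y \<in> fincards \<Longrightarrow> Z \<in> fincards \<Longrightarrow>
   f \<in> X \<rightarrow>\<^sub>E Y \<Longrightarrow> g \<in> Y \<rightarrow>\<^sub>E Z \<Longrightarrow>
   FArr B X Z (compose X g f) = compose (FOb B X) (FArr B Y Z g) (FArr B X Y f)"
  using ftor_Cmp[of "FIN U"] by simp

lemma ftor_tens_ob:
  assumes "fin_ftor A" "fin_ftor B"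
  shows "fin_ftor (tens_ob A B)"
  by (rule ftorI[where ob = "\<lambda>n. coend A (FOb B n)" and
        h = "\<lambda>n n' v. lan_map A (FOb B n) (FOb B n') (FArr B n n' v)"])
    (use fin_arr[OF assms(2)] lan_map_comp[OF assms(1)] in
     \<open>simp_all add: tens_ob_def lan_map_def[symmetric] is_category_FIN coend_in_U[OF assms(1)] fin_ob[OF assms(2)]
      lan_map_PiE fin_Idn[OF assms(2)] fin_Cmp[OF assms(2)] lan_map_id[OF assms(1)]\<close>)

lemma incl_simps [simp]:
  "n \<in> fincards \<Longrightarrow> FOb incl n = n"
  "n \<in> fincards \<Longrightarrow> n' \<in> fincards \<Longrightarrow> v \<in> n \<rightarrow>\<^sub>E n' \<Longrightarrow> FArr incl n n' v = v"
  by (simp_all add: incl_def)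

lemma ftor_incl: "fin_ftor incl"
  by (rule ftorI[where ob = "\<lambda>n. n" and h = "\<lambda>n n' v. v"])
    (use fincards_in_U in \<open>auto simp: incl_def is_category_FIN\<close>)

text \<open>The formula respects the generators because \<open>\<alpha>\<close> commutes with the
  action of \<open>u\<close>, while postcomposition with \<open>\<beta> n\<close> commutes with
  precomposition by \<open>u\<close>.\<close>

lemma tens_arr_cls:
  assumes A: "fin_ftor A" "fin_ftor A'"
    and n: "fin_nat A A' \<alpha>" "fin_nat B B' \<beta>" "n \<in> fincards"
    and t: "m \<in> fincards" "a \<in> FOb A m" "f \<in> m \<rightarrow>\<^sub>E FOb B n"
  shows "tens_arr A A' B B' \<alpha> \<beta> n (cls A (FOb B n) (m, a, f)) =
    cls A' (FOb B' n) (m, \<alpha> m a, compose m (\<beta> n) f)"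
proof -
  have "coend_lift A (FOb B n) (\<lambda>(m, a, f). cls A' (FOb B' n) (m, \<alpha> m a, compose m (\<beta> n) f))
    (cls A (FOb B n) (m, a, f)) = (\<lambda>(m, a, f). cls A' (FOb B' n) (m, \<alpha> m a, compose m (\<beta> n) f)) (m, a, f)"
  proof (rule coend_lift_cls[OF A(1) t])
    fix m m' :: "'u set" and u a f
    assume u: "m \<in> fincards" "m' \<in> fincards" "u \<in> m \<rightarrow>\<^sub>E m'" "a \<in> FOb A m" "f \<in> m' \<rightarrow>\<^sub>E FOb B n"
    show "(\<lambda>(m, a, f). cls A' (FOb B' n) (m, \<alpha> m a, compose m (\<beta> n) f)) (m, a, compose m f u) =
      (\<lambda>(m, a, f). cls A' (FOb B' n) (m, \<alpha> m a, compose m (\<beta> n) f)) (m', FArr A m m' u a, f)"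
      using cls_slide[OF A(2) u(1-3) fin_nat_mem[OF n(1) u(1,4)] compose_PiE[OF u(5) fin_nat_arr[OF n(2,3)]]]
        fin_natural[OF n(1) u(1-4)]
      by (simp add: compose_assoc_PiE[OF u(3)])
  qed
  then show ?thesis by (simp add: tens_arr_def n(3))
qed

text \<open>Two nested lifts call for two checks. In the inner one, a reindexing of \<open>k\<close>
  is a slide in \<open>A\<close>. In the outer one, a reindexing of \<open>m\<close> is absorbed
  separately by each of the \<open>B\<close>-classes that form the new labelling.\<close>

lemma tens_assoc_cls:
  assumes F: "fin_ftor A" "fin_ftor B" "fin_ftor C"
    and n: "n \<in> fincards" "m \<in> fincards" "h \<in> m \<rightarrow>\<^sub>E FOb C n"
    and t: "k \<in> fincards" "a \<in> FOb A k" "g \<in> k \<rightarrow>\<^sub>E FOb B m"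
  shows "tens_assoc A B C n (cls (tens_ob A B) (FOb C n) (m, cls A (FOb B m) (k, a, g), h)) =
    cls A (coend B (FOb C n)) (k, a, \<lambda>i\<in>k. cls B (FOb C n) (m, g i, h))"
proof -
  let ?\<psi> = "\<lambda>m h (k, a, g). cls A (coend B (FOb C n)) (k, a, \<lambda>i\<in>k. cls B (FOb C n) (m, g i, h))"
  let ?\<phi> = "\<lambda>(m, t, h). coend_lift A (FOb B m) (?\<psi> m h) t"
  have inner: "coend_lift A (FOb B m) (?\<psi> m h) (cls A (FOb B m) (k, a, g)) = ?\<psi> m h (k, a, g)"
    if m: "m \<in> fincards" "h \<in> m \<rightarrow>\<^sub>E FOb C n"
      and "k \<in> fincards" "a \<in> FOb A k" "g \<in> k \<rightarrow>\<^sub>E FOb B m" for m h k a g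
  proof (rule coend_lift_cls[OF F(1) that(3-5)])
    fix k k' :: "'u set" and u a f
    assume u: "k \<in> fincards" "k' \<in> fincards" "u \<in> k \<rightarrow>\<^sub>E k'" "a \<in> FOb A k" "f \<in> k' \<rightarrow>\<^sub>E FOb B m"
    have v: "(\<lambda>i\<in>k'. cls B (FOb C n) (m, f i, h)) \<in> k' \<rightarrow>\<^sub>E coend B (FOb C n)"
      using u m by (auto intro!: cls_in_coend)
    have e: "compose k (\<lambda>i\<in>k'. cls B (FOb C n) (m, f i, h)) u =
      (\<lambda>i\<in>k. cls B (FOb C n) (m, compose k f u i, h))"
      using u(3) by (auto simp: fun_eq_iff)
    show "?\<psi> m h (k, a, compose k f u) = ?\<psi> m h (k', FArr A k k' u a, f)"
      using cls_slide[OF F(1) u(1-4) v] unfolding e prod.case .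
  qed
  have "coend_lift (tens_ob A B) (FOb C n) ?\<phi>
     (cls (tens_ob A B) (FOb C n) (m, cls A (FOb B m) (k, a, g), h)) =
     ?\<phi> (m, cls A (FOb B m) (k, a, g), h)"
  proof (rule coend_lift_cls[OF ftor_tens_ob[OF F(1,2)] n(2) _ n(3)])
    show "cls A (FOb B m) (k, a, g) \<in> FOb (tens_ob A B) m"
      using n t by (simp add: cls_in_coend)
    fix m m' :: "'u set" and u t h
    assume u: "m \<in> fincards" "m' \<in> fincards" "u \<in> m \<rightarrow>\<^sub>E m'" "t \<in> FOb (tens_ob A B) m"
      "h \<in> m' \<rightarrow>\<^sub>E FOb C n"
    then have "t \<in> coend A (FOb B m)" by simp
    then show "?\<phi> (m, t, compose m h u) = ?\<phi> (m', FArr (tens_ob A B) m m' u t, h)"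
    proof (rule coendE)
      fix k a g
      assume t: "k \<in> fincards" "a \<in> FOb A k" "g \<in> k \<rightarrow>\<^sub>E FOb B m" "t = cls A (FOb B m) (k, a, g)"
      have g: "compose k (FArr B m m' u) g \<in> k \<rightarrow>\<^sub>E FOb B m'"
        using compose_PiE[OF t(3) fin_arr[OF F(2) u(1-3)]] .
      have "(\<lambda>i\<in>k. cls B (FOb C n) (m, g i, compose m h u)) =
        (\<lambda>i\<in>k. cls B (FOb C n) (m', compose k (FArr B m m' u) g i, h))"
        using cls_slide[OF F(2) u(1-3) _ u(5)] t(3) by (auto simp: fun_eq_iff)
      then show ?thesis
        using u inner[OF u(1) compose_PiE[OF u(3,5)] t(1-3)] inner[OF u(2,5) t(1,2) g]
          lan_map_cls[OF F(1) t(1-3) fin_arr[OF F(2) u(1-3)]]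
        by (simp add: t(4))
    qed
  qed
  then show ?thesis
    using inner[OF n(2,3) t] by (simp add: tens_assoc_def n(1))
qed

lemma tens_lunit_cls:
  assumes "(n :: 'u set) \<in> fincards" "m \<in> fincards" "i \<in> m" "f \<in> m \<rightarrow>\<^sub>E FOb A n"
  shows "tens_lunit A n (cls incl (FOb A n) (m, i, f)) = f i"
proof -
  have "coend_lift incl (FOb A n) (\<lambda>(m, i, f). f i) (cls incl (FOb A n) (m, i, f)) = (\<lambda>(m, i, f). f i) (m, i, f)"
    by (rule coend_lift_cls[OF ftor_incl assms(2)]) (use assms in auto)
  then show ?thesis by (simp add: tens_lunit_def assms(1))
qed

lemma tens_runit_cls:
  assumes A: "fin_ftor A"
    and n: "n \<in> fincards" "m \<in> fincards" "a \<in> FOb A m" "f \<in> m \<rightarrow>\<^sub>E n"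
  shows "tens_runit A n (cls A n (m, a, f)) = FArr A m n f a"
proof -
  have "coend_lift A n (\<lambda>(m, a, f). FArr A m n f a) (cls A n (m, a, f)) = (\<lambda>(m, a, f). FArr A m n f a) (m, a, f)"
    by (rule coend_lift_cls[OF A n(2-4)]) (use n fin_Cmp[OF A] in auto)
  then show ?thesis by (simp add: tens_runit_def n(1))
qed

end

section \<open>Finitary functors\<close>

lemma is_colimit_cong:
  assumes "\<And>i. i \<in> Ob J \<Longrightarrow> \<gamma> i = \<gamma>' i"
  shows "is_colimit J C D L \<gamma> \<longleftrightarrow> is_colimit J C D L \<gamma>'"
  unfolding is_colimit_def is_cocone_def by (simp add: assms cong: conj_cong)

lemma filtered_common:
  assumes "is_filtered J" "i \<in> Ob J" "j \<in> Ob J"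
  obtains k u v where "k \<in> Ob J" "u \<in> Hom J i k" "v \<in> Hom J j k"
  using assms unfolding is_filtered_def by blast

lemma filtered_coequalize:
  assumes "is_filtered J" "i \<in> Ob J" "j \<in> Ob J" "u \<in> Hom J i j" "v \<in> Hom J i j"
  obtains k w where "k \<in> Ob J" "w \<in> Hom J j k" "Cmp J i j k w u = Cmp J i j k w v"
  using assms unfolding is_filtered_def by blast

lemma filtered_category: "is_filtered J \<Longrightarrow> is_category J"
  unfolding is_filtered_def by blast

text \<open>Completing a span to a square combines both filteredness axioms: the two composites into
  a common upper bound are parallel, hence are coequalised further on.\<close>

lemma filtered_span:
  assumes J: "is_filtered J" and "l \<in> Ob J" "i \<in> Ob J" "j \<in> Ob J" "u \<in> Hom J l i" "v \<in> Hom J l j"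
  obtains k p q where "k \<in> Ob J" "p \<in> Hom J i k" "q \<in> Hom J j k" "Cmp J l i k p u = Cmp J l j k q v"
proof -
  note cat = filtered_category[OF J]
  obtain k' p' q' where k': "k' \<in> Ob J" "p' \<in> Hom J i k'" "q' \<in> Hom J j k'"
    using filtered_common[OF J assms(3,4)] .
  obtain k w where k: "k \<in> Ob J" "w \<in> Hom J k' k"
    "Cmp J l k' k w (Cmp J l i k' p' u) = Cmp J l k' k w (Cmp J l j k' q' v)"
    using filtered_coequalize[OF J assms(2) k'(1)] category_Cmp[OF cat] assms k' by metis
  show thesis
    by (rule that[of k "Cmp J i k' k w p'" "Cmp J j k' k w q'"])
      (use assms k k' in \<open>simp_all add: category_Cmp[OF cat] category_assoc[OF cat]\<close>)
qed

text \<open>The explicit description of equality in a filtered colimit of sets: the two elements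
  have a common image at some later stage.\<close>

definition merged :: "('j, 'k) cat \<Rightarrow> ('j, 'k, 'u set, 'u \<Rightarrow> 'u) ftor \<Rightarrow> 'j \<Rightarrow> 'u \<Rightarrow> 'j \<Rightarrow> 'u \<Rightarrow> bool" where
  "merged J D i x j y \<longleftrightarrow>
     (\<exists>k\<in>Ob J. \<exists>u\<in>Hom J i k. \<exists>v\<in>Hom J j k. FArr D i k u x = FArr D j k v y)"

lemma mergedE:
  assumes "merged J D i x j y"
  obtains k u v where "k \<in> Ob J" "u \<in> Hom J i k" "v \<in> Hom J j k" "FArr D i k u x = FArr D j k v y"
  using assms unfolding merged_def by blast

context set_universe
begin

text \<open>A witness for \<open>x\<close> is transported to one for its image by completing a span
  out of \<open>i\<close>. So being merged with a fixed element is constant along the arrows of the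
  diagram and defines a cocone into a two-point set.\<close>

lemma merged_push:
  assumes J: "is_filtered J" and D: "is_ftor J (SET U) D"
    and i: "i \<in> Ob J" "j \<in> Ob J" "l \<in> Ob J" "w \<in> Hom J i j" "x \<in> FOb D i" "y \<in> FOb D l"
  shows "merged J D j (FArr D i j w x) l y \<longleftrightarrow> merged J D i x l y"
proof
  note cat = filtered_category[OF J]
  {
    assume "merged J D j (FArr D i j w x) l y"
    then obtain k u v where k: "k \<in> Ob J" "u \<in> Hom J j k" "v \<in> Hom J l k"
      "FArr D j k u (FArr D i j w x) = FArr D l k v y" by (rule mergedE)
    then have "FArr D i k (Cmp J i j k u w) x = FArr D l k v y"
      using ftor_comp[OF D i(1,2) k(1) i(4) k(2) i(5)] by simp
    then show "merged J D i x l y"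
      unfolding merged_def using category_Cmp[OF cat i(1,2) k(1) i(4) k(2)] k by blast
  next
    assume "merged J D i x l y"
    then obtain k u v where k: "k \<in> Ob J" "u \<in> Hom J i k" "v \<in> Hom J l k"
      "FArr D i k u x = FArr D l k v y" by (rule mergedE)
    obtain z p q where z: "z \<in> Ob J" "p \<in> Hom J j z" "q \<in> Hom J k z" "Cmp J i j z p w = Cmp J i k z q u"
      using filtered_span[OF J i(1,2) k(1) i(4) k(2)] .
    have "FArr D j z p (FArr D i j w x) = FArr D l z (Cmp J l k z q v) y"
      using ftor_comp[OF D i(1,2) z(1) i(4) z(2) i(5)] ftor_comp[OF D i(1) k(1) z(1) k(2) z(3) i(5)]
        ftor_comp[OF D i(3) k(1) z(1) k(3) z(3) i(6)] k(4) z(4) by simp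
    then show "merged J D j (FArr D i j w x) l y"
      unfolding merged_def using category_Cmp[OF cat i(3) k(1) z(1) k(3) z(3)] z by blast
  }
qed

lemma merged_refl:
  assumes "is_filtered J" "is_ftor J (SET U) D" "i \<in> Ob J"
  shows "merged J D i x i x"
  unfolding merged_def using category_Idn[OF filtered_category[OF assms(1)] assms(3)] assms(3) by blast

lemma cocone_iff:
  assumes "is_ftor J (SET U) D"
  shows "is_cocone J (SET U) D L \<gamma> \<longleftrightarrow>
     L \<in> U \<and> (\<forall>i\<in>Ob J. \<gamma> i \<in> FOb D i \<rightarrow>\<^sub>E L) \<and>
     (\<forall>i\<in>Ob J. \<forall>j\<in>Ob J. \<forall>u\<in>Hom J i j. \<forall>x\<in>FOb D i. \<gamma> j (FArr D i j u x) = \<gamma> i x)"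
proof -
  have "compose (FOb D i) (\<gamma> j) (FArr D i j u) = \<gamma> i \<longleftrightarrow> (\<forall>x\<in>FOb D i. \<gamma> j (FArr D i j u x) = \<gamma> i x)"
    if "\<gamma> i \<in> FOb D i \<rightarrow>\<^sub>E L" for i j u
    using that PiE_arb[OF that] by (auto simp: fun_eq_iff)
  then show ?thesis unfolding is_cocone_def SET_simps by blast
qed

text \<open>From left to right the universal property is only tested against a two-point set, which
  separates missed points and unmerged elements; this avoids constructing the colimit as a quotient.
  From right to left the mediating map is defined on preimages.\<close>

lemma filtered_colimit_iff:
  assumes J: "is_filtered J" and D: "is_ftor J (SET U) D"
  shows "is_colimit J (SET U) D L \<gamma> \<longleftrightarrow>
     is_cocone J (SET U) D L \<gamma> \<and> (\<forall>y\<in>L. \<exists>i\<in>Ob J. \<exists>x\<in>FOb D i. y = \<gamma> i x) \<and>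
     (\<forall>i\<in>Ob J. \<forall>j\<in>Ob J. \<forall>x\<in>FOb D i. \<forall>y\<in>FOb D j. \<gamma> i x = \<gamma> j y \<longrightarrow> merged J D i x j y)"
    (is "?C \<longleftrightarrow> ?K \<and> ?S \<and> ?M")
proof
  assume C: ?C
  then have K: ?K unfolding is_colimit_def by blast
  note k = K[unfolded cocone_iff[OF D]]
  define a b :: 'u where "a = num 0" and "b = num 1"
  have ab: "a \<noteq> b" unfolding a_def b_def by (simp add: inj_eq[OF inj_num])
  have B: "{a, b} \<in> U" by (simp add: finite_in_U)
  have uniq: "\<exists>!h. h \<in> L \<rightarrow>\<^sub>E {a, b} \<and> (\<forall>i\<in>Ob J. compose (FOb D i) h (\<gamma> i) = \<delta> i)"
    if "is_cocone J (SET U) D {a, b} \<delta>" for \<delta>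
    using C that unfolding is_colimit_def by simp
  have ?S
  proof (rule ccontr)
    assume "\<not> ?S"
    then obtain y where y: "y \<in> L" "\<And>i x. i \<in> Ob J \<Longrightarrow> x \<in> FOb D i \<Longrightarrow> y \<noteq> \<gamma> i x" by blast
    \<comment> \<open>If \<open>y\<close> is missed by all legs, this constant cocone has two
      factorisations: the constant map, and the same map changed to \<open>b\<close> at
      \<open>y\<close>.\<close>
    define \<delta> where "\<delta> = (\<lambda>i. \<lambda>x\<in>FOb D i. a)"
    have "is_cocone J (SET U) D {a, b} \<delta>"
      unfolding cocone_iff[OF D] using B by (auto simp: \<delta>_def ftor_mem[OF D])
    from uniq[OF this] obtain h where
      "\<forall>g. g \<in> L \<rightarrow>\<^sub>E {a, b} \<and> (\<forall>i\<in>Ob J. compose (FOb D i) g (\<gamma> i) = \<delta> i) \<longrightarrow> g = h"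
      by (elim ex1E) (rule that)
    then have h: "g = h" if "g \<in> L \<rightarrow>\<^sub>E {a, b}"
      and "\<And>i. i \<in> Ob J \<Longrightarrow> compose (FOb D i) g (\<gamma> i) = \<delta> i" for g
      using that by simp
    have mem: "\<gamma> i x \<in> L" if "i \<in> Ob J" "x \<in> FOb D i" for i x
      using k that by blast
    have "(\<lambda>z\<in>L. a) = h"
      by (rule h) (auto simp: \<delta>_def fun_eq_iff mem)
    moreover have "(\<lambda>z\<in>L. if z = y then b else a) = h"
      by (rule h) (auto simp: \<delta>_def fun_eq_iff mem dest: y(2))
    ultimately have "(\<lambda>z\<in>L. a) y = (\<lambda>z\<in>L. if z = y then b else a) y" by simp
    then show False using y(1) ab by simp
  qed
  moreover have ?M
  proof (intro ballI impI)
    fix i j x y assume i: "i \<in> Ob J" "j \<in> Ob J" "x \<in> FOb D i" "y \<in> FOb D j" and eq: "\<gamma> i x = \<gamma> j y"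
    \<comment> \<open>The indicator of being merged with \<open>y\<close> factors through
      \<open>L\<close>, so it agrees at \<open>x\<close> and at \<open>y\<close>; at
      \<open>y\<close> it takes the value \<open>a\<close> by reflexivity.\<close>
    define \<delta> where "\<delta> = (\<lambda>l. \<lambda>z\<in>FOb D l. if merged J D l z j y then a else b)"
    have "is_cocone J (SET U) D {a, b} \<delta>"
      unfolding cocone_iff[OF D] using B merged_push[OF J D _ _ i(2) _ _ i(4)]
      by (auto simp: \<delta>_def ftor_mem[OF D])
    from ex1_implies_ex[OF uniq[OF this]] obtain h
      where h: "\<And>i. i \<in> Ob J \<Longrightarrow> compose (FOb D i) h (\<gamma> i) = \<delta> i" by blast
    have "h (\<gamma> i x) = \<delta> i x" "h (\<gamma> j y) = \<delta> j y"
      using fun_cong[OF h[OF i(1)], of x] fun_cong[OF h[OF i(2)], of y] i by simp_all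
    then show "merged J D i x j y"
      using eq i ab merged_refl[OF J D i(2), of y] by (simp add: \<delta>_def split: if_splits)
  qed
  ultimately show "?K \<and> ?S \<and> ?M" using K by blast
next
  assume "?K \<and> ?S \<and> ?M"
  then have K: ?K and S: ?S and M: ?M by blast+
  note k = K[unfolded cocone_iff[OF D]]
  show ?C
    unfolding is_colimit_def
  proof (intro conjI allI impI K)
    fix N \<delta> assume "is_cocone J (SET U) D N \<delta>"
    note n = this[unfolded cocone_iff[OF D]]
    \<comment> \<open>Chosen preimages define the mediating map. The choice does not matter: equal
      images in \<open>L\<close> mean merged preimages, on which any cocone agrees.\<close>
    obtain I X where IX: "\<And>y. y \<in> L \<Longrightarrow> I y \<in> Ob J" "\<And>y. y \<in> L \<Longrightarrow> X y \<in> FOb D (I y)"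
      "\<And>y. y \<in> L \<Longrightarrow> y = \<gamma> (I y) (X y)"
      using S by metis
    define h where "h = (\<lambda>y\<in>L. \<delta> (I y) (X y))"
    have h: "h (\<gamma> i x) = \<delta> i x" if i: "i \<in> Ob J" "x \<in> FOb D i" for i x
    proof -
      have y: "\<gamma> i x \<in> L" using k i by blast
      let ?y = "\<gamma> i x"
      have "merged J D (I ?y) (X ?y) i x" using M IX[OF y] i by metis
      then obtain z u v where z: "z \<in> Ob J" "u \<in> Hom J (I ?y) z" "v \<in> Hom J i z"
        "FArr D (I ?y) z u (X ?y) = FArr D i z v x" by (rule mergedE)
      then have "\<delta> (I ?y) (X ?y) = \<delta> i x" using n i IX[OF y] by metis
      then show ?thesis using y by (simp add: h_def)
    qed
    show "\<exists>!h. h \<in> Hom (SET U) L N \<and> (\<forall>i\<in>Ob J. Cmp (SET U) (FOb D i) L N h (\<gamma> i) = \<delta> i)"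
    proof (rule ex1I[of _ h])
      have "compose (FOb D i) h (\<gamma> i) = \<delta> i" if "i \<in> Ob J" for i
        using h[OF that] n that PiE_arb[of "\<delta> i"] by (auto simp: fun_eq_iff)
      moreover have "\<delta> (I y) (X y) \<in> N" if "y \<in> L" for y
        using PiE_mem n IX[OF that] by blast
      then have "h \<in> L \<rightarrow>\<^sub>E N" by (simp add: h_def)
      ultimately show "h \<in> Hom (SET U) L N \<and> (\<forall>i\<in>Ob J. Cmp (SET U) (FOb D i) L N h (\<gamma> i) = \<delta> i)" by simp
    next
      fix h' assume h': "h' \<in> Hom (SET U) L N \<and> (\<forall>i\<in>Ob J. Cmp (SET U) (FOb D i) L N h' (\<gamma> i) = \<delta> i)"
      have "h' (\<gamma> i x) = \<delta> i x" if "i \<in> Ob J" "x \<in> FOb D i" for i x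
      proof -
        have "compose (FOb D i) h' (\<gamma> i) = \<delta> i" using h' that by simp
        from fun_cong[OF this, of x] show ?thesis using that by simp
      qed
      then have "h' y = h y" if "y \<in> L" for y using IX[OF that] h by metis
      moreover have "h \<in> extensional L" "h' \<in> extensional L" using h' by (auto simp: h_def PiE_iff)
      ultimately show "h' = h" by (intro extensionalityI)
    qed
  qed
qed

lemma cocone_map:
  assumes D: "is_ftor J (SET U) D" and T: "set_ftor T" and J: "is_category J"
    and "is_cocone J (SET U) D L \<gamma>"
  shows "is_cocone J (SET U) (comp_ftor J T D) (FOb T L) (\<lambda>i. FArr T (FOb D i) L (\<gamma> i))"
proof -
  note k = assms(4)[unfolded cocone_iff[OF D]]
  have "compose (FOb D i) (\<gamma> j) (FArr D i j u) = \<gamma> i" if "i \<in> Ob J" "j \<in> Ob J" "u \<in> Hom J i j" for i j u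
    using assms(4) that unfolding is_cocone_def SET_simps by blast
  then show ?thesis
    unfolding cocone_iff[OF ftor_comp_ftor[OF D T J]]
    using k by (simp add: set_arr[OF T] set_ob[OF T] ftor_ob[OF D] set_comp[OF T] ftor_arr[OF D])
qed

section \<open>Restriction to finite cardinals, and sets as colimits of their finite subsets\<close>

definition res :: "'u endo \<Rightarrow> 'u endo" where
  "res T = \<lparr>FOb = (\<lambda>n\<in>fincards. FOb T n),
            FArr = (\<lambda>n\<in>fincards. \<lambda>n'\<in>fincards. \<lambda>v\<in>n \<rightarrow>\<^sub>E n'. FArr T n n' v)\<rparr>"

lemma res_simps [simp]:
  "n \<in> fincards \<Longrightarrow> FOb (res T) n = FOb T n"
  "n \<in> fincards \<Longrightarrow> n' \<in> fincards \<Longrightarrow> v \<in> n \<rightarrow>\<^sub>E n' \<Longrightarrow> FArr (res T) n n' v = FArr T n n' v"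
  by (simp_all add: res_def)

lemma fincard_in_U [simp]: "n \<in> fincards \<Longrightarrow> n \<in> U"
  using fincards_in_U by blast

lemma ftor_res:
  assumes "set_ftor T" shows "fin_ftor (res T)"
  by (rule ftorI[where ob = "FOb T" and h = "FArr T"])
    (simp_all add: res_def is_category_FIN set_ob[OF assms] set_arr[OF assms] set_id[OF assms] set_comp[OF assms])

lemma cocone_inclusions:
  assumes "is_ftor J (SET U) D" "X \<in> U" "\<And>i. i \<in> Ob J \<Longrightarrow> FOb D i \<subseteq> X"
    and "\<And>i j u x. i \<in> Ob J \<Longrightarrow> j \<in> Ob J \<Longrightarrow> u \<in> Hom J i j \<Longrightarrow> x \<in> FOb D i \<Longrightarrow> FArr D i j u x = x"
  shows "is_cocone J (SET U) D X (\<lambda>i. \<lambda>x\<in>FOb D i. x)"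
  unfolding cocone_iff[OF assms(1)] using assms(2-4) ftor_mem[OF assms(1)] by fastforce

text \<open>The directed poset of finite subsets is presented as a category inside
  \<open>'u\<close>: objects are codes of finite subsets and the only arrow that can occur is
  \<open>undefined\<close>. The last three conclusions expose the subsets and inclusions behind the
  codes.\<close>

lemma finite_subsets_colimit:
  assumes "X \<in> U"
  obtains J :: "('u, 'u) cat" and D and e where
    "is_filtered J" "is_small U J" "is_ftor J (SET U) D"
    "is_colimit J (SET U) D X (\<lambda>i. \<lambda>x\<in>FOb D i. x)"
    "\<forall>F. finite F \<and> F \<subseteq> X \<longrightarrow> e F \<in> Ob J \<and> FOb D (e F) = F"
    "\<forall>i\<in>Ob J. finite (FOb D i) \<and> FOb D i \<subseteq> X"
    "\<forall>i\<in>Ob J. \<forall>j\<in>Ob J. \<forall>u\<in>Hom J i j. FOb D i \<subseteq> FOb D j \<and> FArr D i j u = (\<lambda>x\<in>FOb D i. x)"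
proof -
  obtain e :: "'u set \<Rightarrow> 'u" where e: "inj_on e {F. finite F}" using ex_inj_finite_sets by blast
  define dec where "dec = inv_into {F. finite F} e"
  have dec: "dec (e F) = F" if "finite F" for F using inv_into_f_f[OF e] that by (simp add: dec_def)
  define J :: "('u, 'u) cat" where
    "J = \<lparr>Ob = e ` {F. finite F \<and> F \<subseteq> X}, Hom = (\<lambda>i j. if dec i \<subseteq> dec j then {undefined} else {}),
      Idn = (\<lambda>_. undefined), Cmp = (\<lambda>_ _ _ _ _. undefined)\<rparr>"
  define D :: "('u, 'u, 'u set, 'u \<Rightarrow> 'u) ftor" where
    "D = \<lparr>FOb = (\<lambda>i\<in>Ob J. dec i), FArr = (\<lambda>i\<in>Ob J. \<lambda>j\<in>Ob J. \<lambda>u\<in>Hom J i j. \<lambda>x\<in>dec i. x)\<rparr>"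
  have eJ: "e F \<in> Ob J" if "finite F" "F \<subseteq> X" for F using that by (simp add: J_def)
  have J_ob: "finite (dec i) \<and> dec i \<subseteq> X" if "i \<in> Ob J" for i
    using that dec by (auto simp: J_def)
  have J_hom: "u \<in> Hom J i j \<longleftrightarrow> u = undefined \<and> dec i \<subseteq> dec j" for i j u
    by (simp add: J_def)
  have J_ne: "Hom J i j \<noteq> {} \<longleftrightarrow> dec i \<subseteq> dec j" for i j
    by (simp add: J_def)
  have cat: "is_category J"
    unfolding is_category_def by (auto simp: J_def)
  have ub: "\<exists>k\<in>Ob J. dec i \<subseteq> dec k \<and> dec j \<subseteq> dec k" if "i \<in> Ob J" "j \<in> Ob J" for i j
    using J_ob[OF that(1)] J_ob[OF that(2)] by (intro bexI[OF _ eJ[of "dec i \<union> dec j"]]) (auto simp: dec)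
  have filt: "is_filtered J"
    unfolding is_filtered_def
  proof (intro conjI ballI cat)
    show "Ob J \<noteq> {}" using eJ[of "{}"] by auto
    fix i j assume ij: "i \<in> Ob J" "j \<in> Ob J"
    show "\<exists>k\<in>Ob J. Hom J i k \<noteq> {} \<and> Hom J j k \<noteq> {}" using ub[OF ij] by (auto simp: J_ne)
    fix u v assume "u \<in> Hom J i j" "v \<in> Hom J i j"
    then have "u = v" by (simp add: J_hom)
    then show "\<exists>k\<in>Ob J. \<exists>w\<in>Hom J j k. Cmp J i j k w u = Cmp J i j k w v"
      using ij(2) category_Idn[OF cat] by blast
  qed
  \<comment> \<open>Smallness without power sets: a finite subset of \<open>X\<close> is the image
    of a map from a finite cardinal, so its code lies in a countable union of images of finite
    powers of \<open>X\<close>.\<close>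
  let ?W = "\<Union>i\<in>range (num :: nat \<Rightarrow> 'u).
      (\<lambda>f :: 'u \<Rightarrow> 'u. e (f ` num ` {..<inv num i})) ` (num ` {..<inv num i} \<rightarrow>\<^sub>E X)"
  have "Ob J \<subseteq> ?W"
  proof
    fix i assume "i \<in> Ob J"
    then obtain F where F: "i = e F" "finite F" "F \<subseteq> X" by (auto simp: J_def)
    from F(2) obtain m :: "'u set" and b c where m: "m \<in> fincards" "b \<in> m \<rightarrow>\<^sub>E F" "c \<in> F \<rightarrow>\<^sub>E m"
      "\<forall>x\<in>m. c (b x) = x" "\<forall>y\<in>F. b (c y) = y" by (rule ex_fincard_bij)
    have "y \<in> b ` m" if "y \<in> F" for y
      using m(5) that PiE_mem[OF m(3) that] by (metis imageI)
    then have "b ` m = F" using m(2) by auto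
    moreover have "b \<in> m \<rightarrow>\<^sub>E X" using m(2) F(3) by auto
    moreover obtain n where "m = num ` {..<n}" using m(1) by (auto simp: fincards_def)
    ultimately show "i \<in> ?W"
      using F(1) by (intro UN_I[of "num n"]) (auto simp: inv_f_f[OF inj_num] intro!: image_eqI[of _ _ b])
  qed
  moreover have "?W \<in> U"
    by (intro UN_in_U range_in_U function_image_in_U assms) simp
  ultimately have "Ob J \<in> U" using subset_in_U by blast
  then have small: "is_small U J"
    by (simp add: is_small_def J_def finite_in_U)
  have D: "is_ftor J (SET U) D"
    by (rule ftorI[where ob = dec and h = "\<lambda>i j u. \<lambda>x\<in>dec i. x"])
      (use J_ob J_hom in \<open>auto simp: D_def cat finite_in_U\<close>)
  have "is_colimit J (SET U) D X (\<lambda>i. \<lambda>x\<in>FOb D i. x)"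
    unfolding filtered_colimit_iff[OF filt D]
  proof (intro conjI ballI impI)
    show "is_cocone J (SET U) D X (\<lambda>i. \<lambda>x\<in>FOb D i. x)"
      by (rule cocone_inclusions[OF D assms]) (use J_ob in \<open>auto simp: D_def\<close>)
    show "\<exists>i\<in>Ob J. \<exists>x\<in>FOb D i. y = (\<lambda>x\<in>FOb D i. x) x" if "y \<in> X" for y
      using that eJ[of "{y}"] by (intro bexI[OF _ eJ[of "{y}"]]) (auto simp: D_def dec)
    fix i j x y assume i: "i \<in> Ob J" "j \<in> Ob J" "x \<in> FOb D i" "y \<in> FOb D j"
      "(\<lambda>x\<in>FOb D i. x) x = (\<lambda>x\<in>FOb D j. x) y"
    then have xy: "x = y" "x \<in> dec i" "x \<in> dec j" by (auto simp: D_def)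
    obtain k where k: "k \<in> Ob J" "dec i \<subseteq> dec k" "dec j \<subseteq> dec k" using ub[OF i(1,2)] by blast
    show "merged J D i x j y"
      unfolding merged_def
      by (intro bexI[of _ k] bexI[of _ undefined]) (use k i xy in \<open>auto simp: D_def J_hom\<close>)
  qed
  from that[OF filt small D this, of e] show thesis
    using eJ J_ob J_hom by (simp add: D_def dec)
qed

context
  fixes T :: "'u endo"
  assumes T: "set_ftor T" and fin: "is_finitary U T"
begin

text \<open>Preservation of the colimit of finite subsets puts \<open>t\<close> in the image of
  \<open>T F\<close> for a finite \<open>F\<close>, and a bijection replaces \<open>F\<close> by a
  finite cardinal. Together with \<open>finitary_inj\<close> this identifies \<open>T X\<close> with
  the coend of \<open>res T\<close> at \<open>X\<close>.\<close>

lemma finitary_surj: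
  assumes X: "X \<in> U" and t: "t \<in> FOb T X"
  obtains m a f where "m \<in> fincards" "a \<in> FOb T m" "f \<in> m \<rightarrow>\<^sub>E X" "t = FArr T m X f a"
proof -
  obtain J :: "('u, 'u) cat" and D and e :: "'u set \<Rightarrow> 'u" where J: "is_filtered J" "is_small U J" "is_ftor J (SET U) D"
    "is_colimit J (SET U) D X (\<lambda>i. \<lambda>x\<in>FOb D i. x)"
    and e: "\<forall>F. finite F \<and> F \<subseteq> X \<longrightarrow> e F \<in> Ob J \<and> FOb D (e F) = F"
    and sub: "\<forall>i\<in>Ob J. finite (FOb D i) \<and> FOb D i \<subseteq> X"
    and arr: "\<forall>i\<in>Ob J. \<forall>j\<in>Ob J. \<forall>u\<in>Hom J i j.
      FOb D i \<subseteq> FOb D j \<and> FArr D i j u = (\<lambda>x\<in>FOb D i. x)"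
    by (rule finite_subsets_colimit[OF X])
  have "is_colimit J (SET U) (comp_ftor J T D) (FOb T X) (\<lambda>i. FArr T (FOb D i) X (\<lambda>x\<in>FOb D i. x))"
    using fin J unfolding is_finitary_def by blast
  then obtain i s where i: "i \<in> Ob J" "s \<in> FOb T (FOb D i)" "t = FArr T (FOb D i) X (\<lambda>x\<in>FOb D i. x) s"
    using t unfolding filtered_colimit_iff[OF J(1) ftor_comp_ftor[OF J(3) T filtered_category[OF J(1)]]]
    by (metis (no_types, lifting) comp_ftor_simps(1) restrict_apply')
  let ?F = "FOb D i"
  have "finite ?F" using sub i(1) by blast
  then obtain m :: "'u set" and b c where m: "m \<in> fincards" "b \<in> m \<rightarrow>\<^sub>E ?F" "c \<in> ?F \<rightarrow>\<^sub>E m"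
    "\<forall>x\<in>m. c (b x) = x" "\<forall>y\<in>?F. b (c y) = y"
    by (rule ex_fincard_bij)
  have F: "?F \<in> U" "?F \<subseteq> X" using bspec[OF sub i(1)] finite_in_U by auto
  have b: "b \<in> m \<rightarrow>\<^sub>E X" using m(2) F(2) by auto
  have "compose ?F b c = (\<lambda>x\<in>?F. x)" using m by (auto simp: fun_eq_iff)
  then have "t = FArr T m X b (FArr T ?F m c s)"
    using set_comp[OF T F(1) _ X m(3) b i(2)] m(1) i(3) by simp
  then show thesis
    using that[OF m(1) _ b] set_mem[OF T F(1) _ m(3) i(2)] m(1) by simp
qed

text \<open>The equality in \<open>T X\<close> already holds at some finite \<open>G\<close> that
  contains both images. A bijection of \<open>G\<close> with a finite cardinal \<open>l\<close> then
  lets both triples slide to one and the same triple over \<open>l\<close>.\<close>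

lemma finitary_inj:
  assumes X: "X \<in> U"
    and m: "m \<in> fincards" "a \<in> FOb T m" "f \<in> m \<rightarrow>\<^sub>E X"
    and m': "m' \<in> fincards" "a' \<in> FOb T m'" "f' \<in> m' \<rightarrow>\<^sub>E X"
    and eq: "FArr T m X f a = FArr T m' X f' a'"
  shows "cls (res T) X (m, a, f) = cls (res T) X (m', a', f')"
proof -
  obtain J :: "('u, 'u) cat" and D and e :: "'u set \<Rightarrow> 'u" where J: "is_filtered J" "is_small U J" "is_ftor J (SET U) D"
    "is_colimit J (SET U) D X (\<lambda>i. \<lambda>x\<in>FOb D i. x)"
    and e: "\<forall>F. finite F \<and> F \<subseteq> X \<longrightarrow> e F \<in> Ob J \<and> FOb D (e F) = F"
    and sub: "\<forall>i\<in>Ob J. finite (FOb D i) \<and> FOb D i \<subseteq> X"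
    and arr: "\<forall>i\<in>Ob J. \<forall>j\<in>Ob J. \<forall>u\<in>Hom J i j.
      FOb D i \<subseteq> FOb D j \<and> FArr D i j u = (\<lambda>x\<in>FOb D i. x)"
    by (rule finite_subsets_colimit[OF X])
  have col: "is_colimit J (SET U) (comp_ftor J T D) (FOb T X) (\<lambda>i. FArr T (FOb D i) X (\<lambda>x\<in>FOb D i. x))"
    using fin J unfolding is_finitary_def by blast
  \<comment> \<open>Both labellings factor through this finite set, so the two elements can be
    compared from a single stage of the diagram.\<close>
  define F where "F = f ` m \<union> f' ` m'"
  have F: "finite F" "F \<subseteq> X"
    using m m' finite_fincard by (auto simp: F_def)
  define i where "i = e F"
  have i: "i \<in> Ob J" "FOb D i = F" using e F by (auto simp: i_def)
  have FU: "F \<in> U" using F finite_in_U by blast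
  have f: "f \<in> m \<rightarrow>\<^sub>E F" "f' \<in> m' \<rightarrow>\<^sub>E F" using m m' by (auto simp: F_def)
  have incl: "(\<lambda>x\<in>F. x) \<in> F \<rightarrow>\<^sub>E X" using F by auto
  have cf: "compose m (\<lambda>x\<in>F. x) f = f" "compose m' (\<lambda>x\<in>F. x) f' = f'"
    using f by (auto intro!: Id_compose simp: PiE_iff)
  have s: "FArr T m F f a \<in> FOb T F" "FArr T m' F f' a' \<in> FOb T F"
    using set_mem[OF T _ FU f(1) m(2)] set_mem[OF T _ FU f(2) m'(2)] m m' by auto
  have "FArr T F X (\<lambda>x\<in>F. x) (FArr T m F f a) = FArr T F X (\<lambda>x\<in>F. x) (FArr T m' F f' a')"
    using set_comp[OF T _ FU X f(1) incl m(2)] set_comp[OF T _ FU X f(2) incl m'(2)] m m' cf eq by simp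
  then have "merged J (comp_ftor J T D) i (FArr T m F f a) i (FArr T m' F f' a')"
    using col s i unfolding filtered_colimit_iff[OF J(1) ftor_comp_ftor[OF J(3) T filtered_category[OF J(1)]]]
    by simp
  then obtain k u v where k: "k \<in> Ob J" "u \<in> Hom J i k" "v \<in> Hom J i k"
    and keq: "FArr (comp_ftor J T D) i k u (FArr T m F f a) = FArr (comp_ftor J T D) i k v (FArr T m' F f' a')"
    by (rule mergedE)
  define G where "G = FOb D k"
  have G: "finite G" "G \<subseteq> X" "F \<subseteq> G" "G \<in> U" and uv: "FArr D i k u = (\<lambda>x\<in>F. x)" "FArr D i k v = (\<lambda>x\<in>F. x)"
    using bspec[OF sub k(1)] bspec[OF bspec[OF bspec[OF arr i(1)] k(1)] k(2)]
      bspec[OF bspec[OF bspec[OF arr i(1)] k(1)] k(3)] finite_in_U i(2) by (auto simp: G_def)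
  obtain l :: "'u set" and b c where l: "l \<in> fincards" "b \<in> l \<rightarrow>\<^sub>E G" "c \<in> G \<rightarrow>\<^sub>E l"
    "\<forall>x\<in>l. c (b x) = x" "\<forall>y\<in>G. b (c y) = y"
    using G(1) by (rule ex_fincard_bij)
  have iFG: "(\<lambda>x\<in>F. x) \<in> F \<rightarrow>\<^sub>E G" using G by auto
  have b: "b \<in> l \<rightarrow>\<^sub>E X" using l(2) G(2) by auto
  have g: "f \<in> m \<rightarrow>\<^sub>E G" "f' \<in> m' \<rightarrow>\<^sub>E G" using f G(3) by auto
  have "FArr T F G (\<lambda>x\<in>F. x) (FArr T m F f a) = FArr T F G (\<lambda>x\<in>F. x) (FArr T m' F f' a')"
    using keq i k uv by (simp add: G_def)
  then have "FArr T m G f a = FArr T m' G f' a'"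
    using set_comp[OF T _ FU G(4) f(1) iFG m(2)] set_comp[OF T _ FU G(4) f(2) iFG m'(2)] m m' cf by simp
  then have lc: "FArr T m l (compose m c f) a = FArr T m' l (compose m' c f') a'"
    using set_comp[OF T _ G(4) _ g(1) l(3) m(2)] set_comp[OF T _ G(4) _ g(2) l(3) m'(2)] m m' l(1) by simp
  \<comment> \<open>Hence each labelling is \<open>b\<close> after its composite with
    \<open>c\<close>, the form in which \<open>cls_slide\<close> moves that composite onto the
    element.\<close>
  have "compose G b c = (\<lambda>x\<in>G. x)" using l(5) by (auto simp: fun_eq_iff)
  then have "compose k b (compose k c h) = h" if "h \<in> k \<rightarrow>\<^sub>E G" for k :: "'u set" and h
    using that by (auto simp: compose_assoc_PiE[OF that] PiE_iff intro!: Id_compose)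
  note bc = this[OF g(1)] this[OF g(2)]
  have "cls (res T) X (m, a, f) = cls (res T) X (l, FArr T m l (compose m c f) a, b)"
    using cls_slide[OF ftor_res[OF T] m(1) l(1) compose_PiE[OF g(1) l(3)] _ b, of a] m l(1) compose_PiE[OF g(1) l(3)]
    unfolding bc by simp
  moreover have "cls (res T) X (m', a', f') = cls (res T) X (l, FArr T m' l (compose m' c f') a', b)"
    using cls_slide[OF ftor_res[OF T] m'(1) l(1) compose_PiE[OF g(2) l(3)] _ b, of a'] m' l(1) compose_PiE[OF g(2) l(3)]
    unfolding bc by simp
  ultimately show ?thesis using lc by simp
qed

end


section \<open>Composites of finitary functors and extension of natural transformations\<close>

lemma ftor_id_ftor: "is_category C \<Longrightarrow> is_ftor C C (id_ftor C)"
  unfolding is_ftor_def by (simp add: category_Cmp category_Idn)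

text \<open>Makes \<open>nat_extend\<close> applicable to units of monads, whose source is the
  identity functor.\<close>

lemma finitary_id: "is_finitary U (id_ftor (SET U))"
  unfolding is_finitary_def
proof (intro allI impI, elim conjE)
  fix J :: "('u, 'u) cat" and D L \<gamma>
  assume J: "is_filtered J" and D: "is_ftor J (SET U) D" and col: "is_colimit J (SET U) D L \<gamma>"
  let ?I = "id_ftor (SET U)"
  have "comp_ftor J ?I D = D"
    by (rule is_ftor_eqI[OF ftor_comp_ftor[OF D ftor_id_ftor[OF is_category_SET] filtered_category[OF J]] D])
      (simp_all add: ftor_ob[OF D] ftor_arr[OF D])
  moreover have "is_cocone J (SET U) D L \<gamma>" using col unfolding is_colimit_def by blast
  then have g: "FArr ?I (FOb D i) L (\<gamma> i) = \<gamma> i" if "i \<in> Ob J" for i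
    using that ftor_ob[OF D that] unfolding cocone_iff[OF D] by simp
  moreover have "FOb ?I L = L"
    using col unfolding is_colimit_def is_cocone_def by simp
  ultimately show "is_colimit J (SET U) (comp_ftor J ?I D) (FOb ?I L)
    (\<lambda>i. FArr ?I (FOb D i) L (\<gamma> i))"
    using iffD2[OF is_colimit_cong, OF g col] by (simp only:)
qed

text \<open>Preservation is applied to \<open>S\<close> and then to \<open>T\<close>. Iterates of
  one functor thereby fall under \<open>finitary_surj\<close> and \<open>nat_extend\<close>: the
  twofold one for the multiplication, the threefold one for associativity.\<close>

lemma finitary_comp:
  assumes S: "set_ftor S" "is_finitary U S"
    and T: "set_ftor T" "is_finitary U T"
  shows "is_finitary U (comp_ftor (SET U) T S)"
  unfolding is_finitary_def
proof (intro allI impI, elim conjE)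
  fix J :: "('u, 'u) cat" and D L \<gamma>
  assume J: "is_filtered J" "is_small U J" and D: "is_ftor J (SET U) D" and col: "is_colimit J (SET U) D L \<gamma>"
  note cat = filtered_category[OF J(1)]
  have "comp_ftor J T (comp_ftor J S D) = comp_ftor J (comp_ftor (SET U) T S) D"
    by (rule is_ftor_eqI[OF ftor_comp_ftor[OF ftor_comp_ftor[OF D S(1) cat] T(1) cat]
          ftor_comp_ftor[OF D ftor_comp_ftor[OF S(1) T(1) is_category_SET] cat]])
      (simp_all add: ftor_ob[OF D] ftor_arr[OF D])
  moreover have K: "is_cocone J (SET U) D L \<gamma>" using col unfolding is_colimit_def by blast
  have g: "FArr (comp_ftor (SET U) T S) (FOb D i) L (\<gamma> i) =
      FArr T (FOb (comp_ftor J S D) i) (FOb S L) (FArr S (FOb D i) L (\<gamma> i))" if "i \<in> Ob J" for i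
    using that ftor_ob[OF D that] K unfolding cocone_iff[OF D] by simp
  moreover have "FOb (comp_ftor (SET U) T S) L = FOb T (FOb S L)"
    using K unfolding cocone_iff[OF D] by simp
  moreover have "is_colimit J (SET U) (comp_ftor J S D) (FOb S L) (\<lambda>i. FArr S (FOb D i) L (\<gamma> i))"
    using S(2) J D col unfolding is_finitary_def by blast
  then have c: "is_colimit J (SET U) (comp_ftor J T (comp_ftor J S D)) (FOb T (FOb S L))
     (\<lambda>i. FArr T (FOb (comp_ftor J S D) i) (FOb S L) (FArr S (FOb D i) L (\<gamma> i)))"
    using T(2) J ftor_comp_ftor[OF D S(1) filtered_category[OF J(1)]] unfolding is_finitary_def by blast
  ultimately show "is_colimit J (SET U) (comp_ftor J (comp_ftor (SET U) T S) D) (FOb (comp_ftor (SET U) T S) L)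
    (\<lambda>i. FArr (comp_ftor (SET U) T S) (FOb D i) L (\<gamma> i))"
    using iffD2[OF is_colimit_cong, OF g c] by (simp only:)
qed

text \<open>Every element of \<open>S X\<close> has the form \<open>S f a\<close> with
  \<open>a\<close> over a finite cardinal, and naturality determines the component at
  \<open>X\<close> from the one there.\<close>

lemma nat_eq_finitary:
  assumes S: "set_ftor S" "is_finitary U S"
    and n: "set_nat S T \<alpha>" "set_nat S T \<beta>"
    and eq: "\<And>n a. n \<in> fincards \<Longrightarrow> a \<in> FOb S n \<Longrightarrow> \<alpha> n a = \<beta> n a"
  shows "\<alpha> = \<beta>"
proof (rule nat_eqI[OF n])
  fix X t assume X: "X \<in> Ob (SET U)" "t \<in> FOb S X"
  then obtain m a f where m: "m \<in> fincards" "a \<in> FOb S m" "f \<in> m \<rightarrow>\<^sub>E X" "t = FArr S m X f a"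
    using finitary_surj[OF S] by (metis SET_simps(1))
  then show "\<alpha> X t = \<beta> X t"
    using set_natural[OF n(1) _ _ m(3,2)] set_natural[OF n(2) _ _ m(3,2)] X eq[OF m(1,2)] by simp
qed

text \<open>Naturality forces the value \<open>T f (\<sigma> a)\<close> at \<open>S f a\<close>. It
  is well defined: by \<open>finitary_inj\<close> two presentations of an element represent one
  class of the coend, and the forced value is invariant under the generators because
  \<open>\<sigma>\<close> is natural.\<close>

lemma nat_extend:
  assumes S: "set_ftor S" "is_finitary U S" and T: "set_ftor T"
    and \<sigma>: "fin_nat (res S) (res T) \<sigma>"
  obtains \<tau> where "set_nat S T \<tau>" "restrict \<tau> fincards = \<sigma>"
proof -
  define \<phi> where "\<phi> X = (\<lambda>(m, a, f). FArr T m X f (\<sigma> m a))" for X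
  define \<tau> where "\<tau> = (\<lambda>X\<in>U. \<lambda>t\<in>FOb S X. \<phi> X (SOME (m, a, f). m \<in> fincards \<and> a \<in> FOb S m \<and>
    f \<in> m \<rightarrow>\<^sub>E X \<and> t = FArr S m X f a))"
  have \<sigma>m: "\<sigma> m a \<in> FOb T m" if "m \<in> fincards" "a \<in> FOb S m" for m a
    using fin_nat_mem[OF \<sigma> that(1)] that by simp
  have \<tau>: "\<tau> X (FArr S m X f a) = FArr T m X f (\<sigma> m a)"
    if X: "X \<in> U" and m: "m \<in> fincards" "a \<in> FOb S m" "f \<in> m \<rightarrow>\<^sub>E X" for X m a f
  proof -
    let ?P = "\<lambda>(m', a', f'). m' \<in> fincards \<and> a' \<in> FOb S m' \<and> f' \<in> m' \<rightarrow>\<^sub>E X \<and> FArr S m X f a = FArr S m' X f' a'"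
    obtain m' a' f' where p: "(SOME p. ?P p) = (m', a', f')" by (cases "SOME p. ?P p") auto
    have "?P (SOME p. ?P p)"
      by (rule someI[of ?P "(m, a, f)"]) (use m in simp)
    then have m': "m' \<in> fincards" "a' \<in> FOb S m'" "f' \<in> m' \<rightarrow>\<^sub>E X" "FArr S m X f a = FArr S m' X f' a'"
      unfolding p by auto
    have "\<phi> X (m, a, f) = \<phi> X (m', a', f')"
    proof (rule cls_invariant[OF ftor_res[OF S(1)]])
      show "cls (res S) X (m, a, f) = cls (res S) X (m', a', f')"
        using finitary_inj[OF S X m m'] .
      fix k k' :: "'u set" and u b g
      assume k: "k \<in> fincards" "k' \<in> fincards" "u \<in> k \<rightarrow>\<^sub>E k'" "b \<in> FOb (res S) k" "g \<in> k' \<rightarrow>\<^sub>E X"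
      then have b: "b \<in> FOb S k" by simp
      show "\<phi> X (k, b, compose k g u) = \<phi> X (k', FArr (res S) k k' u b, g)"
        using fin_natural[OF \<sigma> k(1-4)] set_comp[OF T _ _ X k(3,5) \<sigma>m[OF k(1) b]] k by (simp add: \<phi>_def)
    qed (use m m' in \<open>simp_all add: triples_iff\<close>)
    moreover have "FArr S m X f a \<in> FOb S X"
      using set_mem[OF S(1) _ X m(3,2)] m(1) by simp
    ultimately show ?thesis
      using X p by (simp add: \<tau>_def \<phi>_def)
  qed
  have surj: "\<exists>m a f. m \<in> fincards \<and> a \<in> FOb S m \<and> f \<in> m \<rightarrow>\<^sub>E X \<and> t = FArr S m X f a"
    if "X \<in> U" "t \<in> FOb S X" for X t
    by (rule finitary_surj[OF S that]) blast
  have nat: "set_nat S T \<tau>"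
  proof (rule natI; unfold SET_simps)
    show "\<tau> \<in> extensional U" by (simp add: \<tau>_def)
    fix X assume X: "X \<in> U"
    have "\<tau> X t \<in> FOb T X" if t: "t \<in> FOb S X" for t
    proof -
      obtain m a f where m: "m \<in> fincards" "a \<in> FOb S m" "f \<in> m \<rightarrow>\<^sub>E X" "t = FArr S m X f a"
        using surj[OF X t] by blast
      then show ?thesis using \<tau>[OF X m(1-3)] set_mem[OF T _ X m(3) \<sigma>m] by simp
    qed
    moreover have "\<tau> X \<in> extensional (FOb S X)" using X by (simp add: \<tau>_def)
    ultimately show "\<tau> X \<in> FOb S X \<rightarrow>\<^sub>E FOb T X" by (auto simp: PiE_iff)
    fix Y f a assume Y: "Y \<in> U" "f \<in> X \<rightarrow>\<^sub>E Y" "a \<in> FOb S X"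
    obtain m b g where m: "m \<in> fincards" "b \<in> FOb S m" "g \<in> m \<rightarrow>\<^sub>E X" "a = FArr S m X g b"
      using surj[OF X Y(3)] by blast
    then show "\<tau> Y (FArr S X Y f a) = FArr T X Y f (\<tau> X a)"
      using \<tau>[OF X m(1-3)] \<tau>[OF Y(1) m(1,2) compose_PiE[OF m(3) Y(2)]]
        set_comp[OF S(1) _ X Y(1) m(3) Y(2) m(2)] set_comp[OF T _ X Y(1) m(3) Y(2) \<sigma>m[OF m(1,2)]]
      by simp
  qed
  have "restrict \<tau> fincards = \<sigma>"
  proof (rule extensionalityI[of _ fincards])
    show "\<sigma> \<in> extensional fincards" using nat_ext[OF \<sigma>] by simp
    fix n :: "'u set" assume n: "n \<in> fincards"
    \<comment> \<open>Presenting \<open>a\<close> with the identity as labelling gives back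
      \<open>\<sigma> n a\<close>.\<close>
    have "\<tau> n a = \<sigma> n a" if a: "a \<in> FOb S n" for a
      using \<tau>[OF _ n a id_PiE] n set_id[OF S(1) _ a] set_id[OF T _ \<sigma>m[OF n a]] by simp
    moreover have "\<tau> n \<in> extensional (FOb S n)" "\<sigma> n \<in> extensional (FOb S n)"
      using fin_nat_arr[OF \<sigma> n] n by (simp_all add: \<tau>_def PiE_iff)
    ultimately show "restrict \<tau> fincards n = \<sigma> n" using n by (auto intro: extensionalityI)
  qed simp
  with nat show thesis by (rule that)
qed

section \<open>Finitariness of the Kan extension\<close>

lemma finite_lift:
  assumes J: "is_filtered J" and D: "is_ftor J (SET U) D" and K: "is_cocone J (SET U) D L \<gamma>"
    and S: "\<forall>y\<in>L. \<exists>i\<in>Ob J. \<exists>x\<in>FOb D i. y = \<gamma> i x"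
    and "finite m" "\<And>x. x \<in> m \<Longrightarrow> f x \<in> L"
  shows "\<exists>i\<in>Ob J. \<exists>g\<in>m \<rightarrow>\<^sub>E FOb D i. \<forall>x\<in>m. f x = \<gamma> i (g x)"
  using assms(5,6)
proof (induction m)
  case empty
  then show ?case using J unfolding is_filtered_def by auto
next
  case (insert z m)
  note k = K[unfolded cocone_iff[OF D]]
  obtain i g where i: "i \<in> Ob J" "g \<in> m \<rightarrow>\<^sub>E FOb D i" "\<forall>x\<in>m. f x = \<gamma> i (g x)"
    using insert by auto
  obtain j y where j: "j \<in> Ob J" "y \<in> FOb D j" "f z = \<gamma> j y" using S insert.prems by blast
  obtain l u v where l: "l \<in> Ob J" "u \<in> Hom J i l" "v \<in> Hom J j l" using filtered_common[OF J i(1) j(1)] .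
  define h where "h = (\<lambda>x\<in>insert z m. if x = z then FArr D j l v y else FArr D i l u (g x))"
  have "h \<in> insert z m \<rightarrow>\<^sub>E FOb D l"
    using PiE_mem[OF i(2)] ftor_mem[OF D j(1) l(1,3) j(2)] ftor_mem[OF D i(1) l(1,2)]
    by (auto simp: h_def)
  moreover have "\<forall>x\<in>insert z m. f x = \<gamma> l (h x)"
    using k i j l PiE_mem[OF i(2)] by (auto simp: h_def)
  ultimately show ?case using l(1) by blast
qed

text \<open>Each point of \<open>m\<close> comes with its own pair of arrows; finitely many such
  pairs can be dominated by a single pair that realises all identifications at once.\<close>

lemma finite_merge:
  assumes J: "is_filtered J" and D: "is_ftor J (SET U) D" and i: "i \<in> Ob J" "j \<in> Ob J"
    and "finite m"
    and "\<And>x. x \<in> m \<Longrightarrow> g x \<in> FOb D i \<and> g' x \<in> FOb D j \<and> merged J D i (g x) j (g' x)"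
  shows "\<exists>k\<in>Ob J. \<exists>u\<in>Hom J i k. \<exists>v\<in>Hom J j k. \<forall>x\<in>m. FArr D i k u (g x) = FArr D j k v (g' x)"
  using assms(5,6)
proof (induction m)
  case empty
  obtain k u v where "k \<in> Ob J" "u \<in> Hom J i k" "v \<in> Hom J j k"
    using filtered_common[OF J i] .
  then show ?case by auto
next
  case (insert z m)
  note cat = filtered_category[OF J]
  obtain k u v where k: "k \<in> Ob J" "u \<in> Hom J i k" "v \<in> Hom J j k"
    "\<forall>x\<in>m. FArr D i k u (g x) = FArr D j k v (g' x)"
    using insert by auto
  have "merged J D i (g z) j (g' z)" using insert.prems by blast
  then obtain l p q where l: "l \<in> Ob J" "p \<in> Hom J i l" "q \<in> Hom J j l"
    "FArr D i l p (g z) = FArr D j l q (g' z)" by (rule mergedE)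
  \<comment> \<open>Completing the span makes the arrows out of \<open>i\<close> agree. Those out of
    \<open>j\<close> are then parallel arrows into \<open>r\<close>, and \<open>w\<close>
    coequalises them without disturbing the former.\<close>
  obtain r s t where r: "r \<in> Ob J" "s \<in> Hom J k r" "t \<in> Hom J l r" "Cmp J i k r s u = Cmp J i l r t p"
    using filtered_span[OF J i(1) k(1) l(1) k(2) l(2)] .
  obtain r' w where r': "r' \<in> Ob J" "w \<in> Hom J r r'"
    "Cmp J j r r' w (Cmp J j k r s v) = Cmp J j r r' w (Cmp J j l r t q)"
    using filtered_coequalize[OF J i(2) r(1) category_Cmp[OF cat i(2) k(1) r(1) k(3) r(2)]
        category_Cmp[OF cat i(2) l(1) r(1) l(3) r(3)]] .
  define u' where "u' = Cmp J i r r' w (Cmp J i k r s u)"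
  define v' where "v' = Cmp J j r r' w (Cmp J j k r s v)"
  have v'2: "v' = Cmp J j r r' w (Cmp J j l r t q)"
    by (simp add: v'_def r'(3))
  note H = i k(1-3) l(1-3) r(1-3) r'(1,2)
  have u': "u' \<in> Hom J i r'" and v': "v' \<in> Hom J j r'"
    using H by (simp_all add: u'_def v'_def category_Cmp[OF cat, of _ r] category_Cmp[OF cat, of _ k])
  have Du: "FArr D i r' u' x = FArr D r r' w (FArr D k r s (FArr D i k u x))"
    "FArr D i r' u' x = FArr D r r' w (FArr D l r t (FArr D i l p x))" if "x \<in> FOb D i" for x
    unfolding u'_def
    using ftor_comp[OF D i(1) r(1) r'(1) category_Cmp[OF cat i(1) k(1) r(1) k(2) r(2)] r'(2) that]
      ftor_comp[OF D i(1) k(1) r(1) k(2) r(2) that] ftor_comp[OF D i(1) l(1) r(1) l(2) r(3) that] r(4)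
    by simp_all
  have Dv: "FArr D j r' v' x = FArr D r r' w (FArr D k r s (FArr D j k v x))"
    "FArr D j r' v' x = FArr D r r' w (FArr D l r t (FArr D j l q x))" if "x \<in> FOb D j" for x
    using ftor_comp[OF D i(2) r(1) r'(1) category_Cmp[OF cat i(2) k(1) r(1) k(3) r(2)] r'(2) that]
      ftor_comp[OF D i(2) r(1) r'(1) category_Cmp[OF cat i(2) l(1) r(1) l(3) r(3)] r'(2) that]
      ftor_comp[OF D i(2) k(1) r(1) k(3) r(2) that] ftor_comp[OF D i(2) l(1) r(1) l(3) r(3) that]
      v'_def v'2
    by simp_all
  have "FArr D i r' u' (g x) = FArr D j r' v' (g' x)" if x: "x \<in> insert z m" for x
  proof (cases "x = z")
    case True
    then show ?thesis using insert.prems[OF x] Du(2) Dv(2) l(4) by simp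
  next
    case False
    then show ?thesis using insert.prems[OF x] Du(1) Dv(1) k(4) x by simp
  qed
  then show ?case using r'(1) u' v' by blast
qed

text \<open>Labellings have finite domains, so they lift to a single stage of the diagram: filtered
  colimits commute with finite powers. The coend is then handled by an invariant, as its
  identifications over \<open>L\<close> form chains of generators rather than single steps.\<close>

lemma finitary_lan:
  assumes A: "fin_ftor A"
  shows "is_finitary U (lan A)"
  unfolding is_finitary_def
proof (intro allI impI, elim conjE)
  fix J :: "('u, 'u) cat" and D L \<gamma>
  assume J: "is_filtered J" and D: "is_ftor J (SET U) D" and col: "is_colimit J (SET U) D L \<gamma>"
  note cat = filtered_category[OF J]
  let ?E = "comp_ftor J (lan A) D"
  have E: "is_ftor J (SET U) ?E" by (rule ftor_comp_ftor[OF D ftor_lan[OF A] cat])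
  have K: "is_cocone J (SET U) D L \<gamma>" and S: "\<forall>y\<in>L. \<exists>i\<in>Ob J. \<exists>x\<in>FOb D i. y = \<gamma> i x"
    and M: "\<And>i j x y. i \<in> Ob J \<Longrightarrow> j \<in> Ob J \<Longrightarrow> x \<in> FOb D i \<Longrightarrow> y \<in> FOb D j \<Longrightarrow> \<gamma> i x = \<gamma> j y \<Longrightarrow>
      merged J D i x j y"
    using col unfolding filtered_colimit_iff[OF J D] by blast+
  have L: "L \<in> U" and \<gamma>: "\<And>i. i \<in> Ob J \<Longrightarrow> \<gamma> i \<in> FOb D i \<rightarrow>\<^sub>E L"
    using K unfolding cocone_iff[OF D] by blast+
  have E_ob: "FOb ?E i = coend A (FOb D i)" if "i \<in> Ob J" for i
    using that by (simp add: ftor_ob[OF D])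
  have E_arr: "FArr ?E i j u (cls A (FOb D i) (m, a, g)) = cls A (FOb D j) (m, a, compose m (FArr D i j u) g)"
    if "i \<in> Ob J" "j \<in> Ob J" "u \<in> Hom J i j" "m \<in> fincards" "a \<in> FOb A m" "g \<in> m \<rightarrow>\<^sub>E FOb D i" for i j u m a g
    using that by (simp add: ftor_ob[OF D] ftor_arr[OF D] lan_map_cls[OF A])
  have \<gamma>_cls: "FArr (lan A) (FOb D i) L (\<gamma> i) (cls A (FOb D i) (m, a, g)) = cls A L (m, a, compose m (\<gamma> i) g)"
    if "i \<in> Ob J" "m \<in> fincards" "a \<in> FOb A m" "g \<in> m \<rightarrow>\<^sub>E FOb D i" for i m a g
    using that L \<gamma> by (simp add: ftor_ob[OF D] lan_map_cls[OF A])
  have lift: "\<exists>i\<in>Ob J. \<exists>g\<in>m \<rightarrow>\<^sub>E FOb D i. f = compose m (\<gamma> i) g" if m: "m \<in> fincards" and f: "f \<in> m \<rightarrow>\<^sub>E L" for m f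
  proof -
    obtain i g where "i \<in> Ob J" "g \<in> m \<rightarrow>\<^sub>E FOb D i" "\<forall>x\<in>m. f x = \<gamma> i (g x)"
      using finite_lift[OF J D K S finite_fincard[OF m], of f] f by blast
    moreover from this(3) have "f = compose m (\<gamma> i) g" by (auto simp: fun_eq_iff PiE_arb[OF f])
    ultimately show ?thesis by blast
  qed
  \<comment> \<open>Two lifts of one labelling become equal at a later stage by
    \<open>finite_merge\<close>, so their classes are merged with the same elements.\<close>
  have lift_unique: "merged J ?E i (cls A (FOb D i) (m, a, g)) l y \<longleftrightarrow> merged J ?E j (cls A (FOb D j) (m, a, g')) l y"
    if i: "i \<in> Ob J" "j \<in> Ob J" "l \<in> Ob J" "y \<in> FOb ?E l"
      and m: "m \<in> fincards" "a \<in> FOb A m" "g \<in> m \<rightarrow>\<^sub>E FOb D i" "g' \<in> m \<rightarrow>\<^sub>E FOb D j"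
      and eq: "compose m (\<gamma> i) g = compose m (\<gamma> j) g'" for i j l y m a g g'
  proof -
    have "\<exists>k\<in>Ob J. \<exists>u\<in>Hom J i k. \<exists>v\<in>Hom J j k. \<forall>x\<in>m. FArr D i k u (g x) = FArr D j k v (g' x)"
      by (rule finite_merge[OF J D i(1,2) finite_fincard[OF m(1)]])
        (use M[OF i(1,2) PiE_mem[OF m(3)] PiE_mem[OF m(4)]] m eq in \<open>auto simp: compose_eq_iff\<close>)
    then obtain k u v where k: "k \<in> Ob J" "u \<in> Hom J i k" "v \<in> Hom J j k"
      "\<forall>x\<in>m. FArr D i k u (g x) = FArr D j k v (g' x)" by blast
    have c: "compose m (FArr D i k u) g = compose m (FArr D j k v) g'" using k(4) by (simp add: compose_eq_iff)
    have "cls A (FOb D i) (m, a, g) \<in> FOb ?E i" "cls A (FOb D j) (m, a, g') \<in> FOb ?E j"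
      unfolding E_ob[OF i(1)] E_ob[OF i(2)] using m by (auto intro: cls_in_coend)
    then show ?thesis
      using merged_push[OF J E i(1) k(1) i(3) k(2) _ i(4)] merged_push[OF J E i(2) k(1) i(3) k(3) _ i(4)]
        E_arr[OF i(1) k(1,2) m(1-3)] E_arr[OF i(2) k(1,3) m(1,2,4)] c by metis
  qed
  show "is_colimit J (SET U) ?E (FOb (lan A) L) (\<lambda>i. FArr (lan A) (FOb D i) L (\<gamma> i))"
    unfolding filtered_colimit_iff[OF J E]
  proof (intro conjI ballI impI)
    show "is_cocone J (SET U) ?E (FOb (lan A) L) (\<lambda>i. FArr (lan A) (FOb D i) L (\<gamma> i))"
      by (rule cocone_map[OF D ftor_lan[OF A] cat K])
  next
    fix t assume "t \<in> FOb (lan A) L"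
    then have "t \<in> coend A L" using L by simp
    then obtain m a f where m: "m \<in> fincards" "a \<in> FOb A m" "f \<in> m \<rightarrow>\<^sub>E L" "t = cls A L (m, a, f)"
      by (rule coendE)
    obtain i g where i: "i \<in> Ob J" "g \<in> m \<rightarrow>\<^sub>E FOb D i" "f = compose m (\<gamma> i) g" using lift[OF m(1,3)] by blast
    show "\<exists>i\<in>Ob J. \<exists>x\<in>FOb ?E i. t = FArr (lan A) (FOb D i) L (\<gamma> i) x"
      using i m \<gamma>_cls[OF i(1) m(1,2) i(2)] E_ob[OF i(1)]
      by (intro bexI[OF _ i(1)] bexI[of _ "cls A (FOb D i) (m, a, g)"]) (auto intro: cls_in_coend)
  next
    fix i j s t assume i: "i \<in> Ob J" "j \<in> Ob J" "s \<in> FOb ?E i" "t \<in> FOb ?E j"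
      and eq: "FArr (lan A) (FOb D i) L (\<gamma> i) s = FArr (lan A) (FOb D j) L (\<gamma> j) t"
    obtain m a f where m: "m \<in> fincards" "a \<in> FOb A m" "f \<in> m \<rightarrow>\<^sub>E FOb D i" "s = cls A (FOb D i) (m, a, f)"
      using i(3) unfolding E_ob[OF i(1)] by (rule coendE)
    obtain m' a' f' where m': "m' \<in> fincards" "a' \<in> FOb A m'" "f' \<in> m' \<rightarrow>\<^sub>E FOb D j" "t = cls A (FOb D j) (m', a', f')"
      using i(4) unfolding E_ob[OF i(2)] by (rule coendE)
    \<comment> \<open>Whether \<open>t\<close> gets merged with a representative of \<open>(m, a, f)\<close> at some stage of the diagram is
      an invariant of the relation defining the coend over \<open>L\<close>.\<close>
    define \<phi> where "\<phi> = (\<lambda>(m, a, f). \<forall>l\<in>Ob J. \<forall>g\<in>m \<rightarrow>\<^sub>E FOb D l. f = compose m (\<gamma> l) g \<longrightarrow>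
      merged J ?E l (cls A (FOb D l) (m, a, g)) j t)"
    have \<phi>: "\<phi> (m, a, compose m (\<gamma> l) g) \<longleftrightarrow> merged J ?E l (cls A (FOb D l) (m, a, g)) j t"
      if "l \<in> Ob J" "m \<in> fincards" "a \<in> FOb A m" "g \<in> m \<rightarrow>\<^sub>E FOb D l" for l m a g
      using lift_unique[OF that(1) _ i(2,4) that(2-4)] that unfolding \<phi>_def by blast
    have "\<phi> (m, a, compose m (\<gamma> i) f) = \<phi> (m', a', compose m' (\<gamma> j) f')"
    proof (rule cls_invariant[OF A])
      show "cls A L (m, a, compose m (\<gamma> i) f) = cls A L (m', a', compose m' (\<gamma> j) f')"
        using eq \<gamma>_cls[OF i(1) m(1-3)] \<gamma>_cls[OF i(2) m'(1-3)] m(4) m'(4) by simp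
      fix k k' :: "'u set" and u b h
      assume k: "k \<in> fincards" "k' \<in> fincards" "u \<in> k \<rightarrow>\<^sub>E k'" "b \<in> FOb A k" "h \<in> k' \<rightarrow>\<^sub>E L"
      \<comment> \<open>A lift \<open>g\<close> of \<open>h\<close> yields the lift
        \<open>compose k g u\<close> of \<open>compose k h u\<close> at the same stage, and there
        the two classes coincide by a slide.\<close>
      obtain l g where l: "l \<in> Ob J" "g \<in> k' \<rightarrow>\<^sub>E FOb D l" "h = compose k' (\<gamma> l) g" using lift[OF k(2,5)] by blast
      show "\<phi> (k, b, compose k h u) = \<phi> (k', FArr A k k' u b, h)"
        unfolding l(3) compose_assoc_PiE[OF k(3), symmetric]
        using \<phi>[OF l(1) k(1,4) compose_PiE[OF k(3) l(2)]] \<phi>[OF l(1) k(2) fin_mem[OF A k(1-4)] l(2)]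
          cls_slide[OF A k(1-4) l(2)] by simp
    qed (use m m' compose_PiE[OF m(3) \<gamma>[OF i(1)]] compose_PiE[OF m'(3) \<gamma>[OF i(2)]] in \<open>simp_all add: triples_iff\<close>)
    then show "merged J ?E i s j t"
      using \<phi>[OF i(1) m(1-3)] \<phi>[OF i(2) m'(1-3)] merged_refl[OF J E i(2)] m(4) m'(4) by simp
  qed
qed

end

section \<open>Monads and one-object enriched categories\<close>

lemma FSET_simps [simp]:
  "Base (FSET U) = ftor_cat (FIN U) (SET U)" "TOb (FSET U) = tens_ob" "TArr (FSET U) = tens_arr"
  "TUnit (FSET U) = incl" "Assoc (FSET U) = tens_assoc" "LUnit (FSET U) = tens_lunit"
  "RUnit (FSET U) = tens_runit"
  by (simp_all add: FSET_def)

context set_universe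
begin

subsection \<open>Monads, elementwise\<close>

lemma is_monad_iff:
  "is_monad (SET U) M \<longleftrightarrow> set_ftor (Fun M) \<and>
     set_nat (id_ftor (SET U)) (Fun M) (Unit M) \<and>
     set_nat (comp_ftor (SET U) (Fun M) (Fun M)) (Fun M) (Mult M) \<and>
     (\<forall>X\<in>U. \<forall>t\<in>FOb (Fun M) X. Mult M X (Unit M (FOb (Fun M) X) t) = t) \<and>
     (\<forall>X\<in>U. \<forall>t\<in>FOb (Fun M) X. Mult M X (FArr (Fun M) X (FOb (Fun M) X) (Unit M X) t) = t) \<and>
     (\<forall>X\<in>U. \<forall>t\<in>FOb (Fun M) (FOb (Fun M) (FOb (Fun M) X)).
        Mult M X (Mult M (FOb (Fun M) X) t) =
        Mult M X (FArr (Fun M) (FOb (Fun M) (FOb (Fun M) X)) (FOb (Fun M) X) (Mult M X) t))"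
  unfolding is_monad_def Let_def SET_simps compose_eq_restrict_iff compose_eq_iff by blast

text \<open>The hypothesis on \<open>N\<close> makes \<open>Unit N X\<close>
  \<open>undefined\<close> off \<open>X\<close>, so that the unit equation between functions becomes
  a pointwise one.\<close>

lemma is_monad_mor_iff:
  assumes "is_monad (SET U) N"
  shows "is_monad_mor (SET U) M N \<tau> \<longleftrightarrow> set_nat (Fun M) (Fun N) \<tau> \<and>
     (\<forall>X\<in>U. \<forall>x\<in>X. \<tau> X (Unit M X x) = Unit N X x) \<and>
     (\<forall>X\<in>U. \<forall>t\<in>FOb (Fun M) (FOb (Fun M) X). \<tau> X (Mult M X t) =
        Mult N X (\<tau> (FOb (Fun N) X) (FArr (Fun M) (FOb (Fun M) X) (FOb (Fun N) X) (\<tau> X) t)))"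
proof -
  have "set_nat (id_ftor (SET U)) (Fun N) (Unit N)"
    using assms unfolding is_monad_iff by blast
  from set_nat_arr[OF this] have "Unit N X \<in> X \<rightarrow>\<^sub>E FOb (Fun N) X" if "X \<in> U" for X using that by simp
  note compose_eq_PiE_iff[OF this]
  then show ?thesis
    unfolding is_monad_mor_def Let_def SET_simps by (auto simp: compose_eq_iff)
qed

lemma monad_cat_simps [simp]:
  "Ob (monad_cat C) = {M. is_monad C M}" "Hom (monad_cat C) M N = {\<tau>. is_monad_mor C M N \<tau>}"
  "Idn (monad_cat C) M = Idn (ftor_cat C C) (Fun M)"
  "Cmp (monad_cat C) L M N = Cmp (ftor_cat C C) (Fun L) (Fun M) (Fun N)"
  by (simp_all add: monad_cat_def)

lemma is_category_monad_cat: "is_category (monad_cat (SET U))" (is "is_category ?C")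
proof -
  note F = is_category_ftor_cat[OF is_category_SET]
  have ftor: "Fun M \<in> Ob (ftor_cat (SET U) (SET U))" if "M \<in> Ob ?C" for M
    using that by (simp add: is_monad_iff)
  have nat: "\<tau> \<in> Hom (ftor_cat (SET U) (SET U)) (Fun M) (Fun N)" if "\<tau> \<in> Hom ?C M N"
    "N \<in> Ob ?C" for M N \<tau>
    using that by (simp add: is_monad_mor_iff)
  show ?thesis
    unfolding is_category_def
  proof (intro conjI ballI)
    fix M assume M: "M \<in> Ob ?C"
    then have m: "is_monad (SET U) M" by simp
    then have T: "set_ftor (Fun M)"
      and \<eta>: "set_nat (id_ftor (SET U)) (Fun M) (Unit M)"
      and \<mu>: "set_nat (comp_ftor (SET U) (Fun M) (Fun M)) (Fun M) (Mult M)"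
      by (auto simp: is_monad_iff)
    show "Idn ?C M \<in> Hom ?C M M"
      using category_Idn[OF F ftor[OF M]] set_nat_mem[OF \<eta>] set_nat_mem[OF \<mu>] set_id[OF T]
      by (simp add: is_monad_mor_iff[OF m] set_ob[OF T])
  next
    fix L M N \<sigma> \<tau> assume ob: "L \<in> Ob ?C" "M \<in> Ob ?C" "N \<in> Ob ?C"
      and \<sigma>: "\<sigma> \<in> Hom ?C L M" and \<tau>: "\<tau> \<in> Hom ?C M N"
    have m: "is_monad (SET U) M" "is_monad (SET U) N" "is_monad (SET U) L" using ob by auto
    note s = \<sigma>[simplified, unfolded is_monad_mor_iff[OF m(1)]] and t = \<tau>[simplified, unfolded is_monad_mor_iff[OF m(2)]]
    have nats: "set_nat (Fun L) (Fun M) \<sigma>" "set_nat (Fun M) (Fun N) \<tau>"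
      using s t by blast+
    have L: "set_ftor (Fun L)" and M: "set_ftor (Fun M)" and N: "set_ftor (Fun N)"
      and \<eta>: "set_nat (id_ftor (SET U)) (Fun L) (Unit L)"
      and \<mu>: "set_nat (comp_ftor (SET U) (Fun L) (Fun L)) (Fun L) (Mult L)"
      using m by (auto simp: is_monad_iff)
    have "set_nat (Fun L) (Fun N) (\<lambda>X\<in>U. compose (FOb (Fun L) X) (\<tau> X) (\<sigma> X))"
      using category_Cmp[OF F ftor[OF ob(1)] ftor[OF ob(2)] ftor[OF ob(3)] nat[OF \<sigma> ob(2)] nat[OF \<tau> ob(3)]] by simp
    moreover have "\<tau> X (\<sigma> X (Mult L X x)) = Mult N X (compose (FOb (Fun L) (FOb (Fun N) X)) (\<tau> (FOb (Fun N) X)) (\<sigma> (FOb (Fun N) X))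
        (FArr (Fun L) (FOb (Fun L) X) (FOb (Fun N) X) (compose (FOb (Fun L) X) (\<tau> X) (\<sigma> X)) x))"
      if X: "X \<in> U" and x: "x \<in> FOb (Fun L) (FOb (Fun L) X)" for X x
    proof -
      note ob = set_ob[OF L X] set_ob[OF M X] set_ob[OF N X]
      let ?y = "FArr (Fun L) (FOb (Fun L) X) (FOb (Fun M) X) (\<sigma> X) x"
      have y: "?y \<in> FOb (Fun L) (FOb (Fun M) X)"
        using set_mem[OF L ob(1,2) set_nat_arr[OF nats(1) X] x] .
      have e: "FArr (Fun L) (FOb (Fun L) X) (FOb (Fun N) X) (compose (FOb (Fun L) X) (\<tau> X) (\<sigma> X)) x =
        FArr (Fun L) (FOb (Fun M) X) (FOb (Fun N) X) (\<tau> X) ?y"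
        using set_comp[OF L ob(1-3) set_nat_arr[OF nats(1) X] set_nat_arr[OF nats(2) X] x] by simp
      have "\<tau> X (\<sigma> X (Mult L X x)) = \<tau> X (Mult M X (\<sigma> (FOb (Fun M) X) ?y))" using s X x by simp
      also have "\<dots> = Mult N X (\<tau> (FOb (Fun N) X) (FArr (Fun M) (FOb (Fun M) X) (FOb (Fun N) X) (\<tau> X) (\<sigma> (FOb (Fun M) X) ?y)))"
        using t X set_nat_mem[OF nats(1) ob(2) y] by simp
      also have "\<dots> = Mult N X (\<tau> (FOb (Fun N) X) (\<sigma> (FOb (Fun N) X) (FArr (Fun L) (FOb (Fun M) X) (FOb (Fun N) X) (\<tau> X) ?y)))"
        using set_natural[OF nats(1) ob(2,3) set_nat_arr[OF nats(2) X] y] by simp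
      finally show ?thesis
        using set_mem[OF L ob(2,3) set_nat_arr[OF nats(2) X] y] by (simp add: e)
    qed
    moreover have "\<tau> X (\<sigma> X (Unit L X x)) = Unit N X x" if "X \<in> U" "x \<in> X" for X x
      using s t that by simp
    ultimately show "Cmp ?C L M N \<tau> \<sigma> \<in> Hom ?C L N"
      using set_nat_mem[OF \<eta>] set_nat_mem[OF \<mu>]
      by (simp add: is_monad_mor_iff[OF m(2)] set_ob[OF N] set_ob[OF L])
  next
    fix M N \<tau> assume ob: "M \<in> Ob ?C" "N \<in> Ob ?C"
      and \<tau>: "\<tau> \<in> Hom ?C M N"
    note n = category_unit[OF F ftor[OF ob(1)] ftor[OF ob(2)] nat[OF \<tau> ob(2)]]
    show "Cmp ?C M M N \<tau> (Idn ?C M) = \<tau>"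
      "Cmp ?C M N N (Idn ?C N) \<tau> = \<tau>"
      using n by simp_all
  next
    fix K L M N \<rho> \<sigma> \<tau> assume ob: "K \<in> Ob ?C" "L \<in> Ob ?C"
        "M \<in> Ob ?C" "N \<in> Ob ?C"
      and h: "\<rho> \<in> Hom ?C K L" "\<sigma> \<in> Hom ?C L M" "\<tau> \<in> Hom ?C M N"
    show "Cmp ?C K L N (Cmp ?C L M N \<tau> \<sigma>) \<rho> =
      Cmp ?C K M N \<tau> (Cmp ?C K L M \<sigma> \<rho>)"
      using category_assoc[OF F ob(1-4)[THEN ftor] nat[OF h(1) ob(2)] nat[OF h(2) ob(3)] nat[OF h(3) ob(4)]] by simp
  qed
qed

subsection \<open>One-object enriched categories, elementwise\<close>

text \<open>A clone is a monoid for the substitution tensor product, with the monoid laws spelled out on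
  representatives \<open>[m, a, f]\<close> of the elements of the coends.\<close>

definition is_clone :: "'u endo \<Rightarrow> ('u set \<Rightarrow> 'u \<Rightarrow> 'u) \<Rightarrow> ('u set \<Rightarrow> 'u \<Rightarrow> 'u) \<Rightarrow> bool" where
  "is_clone A j c \<longleftrightarrow> fin_ftor A \<and> fin_nat incl A j \<and>
     fin_nat (tens_ob A A) A c \<and>
     (\<forall>n\<in>fincards. \<forall>m\<in>fincards. \<forall>i\<in>m. \<forall>f\<in>m \<rightarrow>\<^sub>E FOb A n. c n (cls A (FOb A n) (m, j m i, f)) = f i) \<and>
     (\<forall>n\<in>fincards. \<forall>m\<in>fincards. \<forall>a\<in>FOb A m. \<forall>f\<in>m \<rightarrow>\<^sub>E n.
        c n (cls A (FOb A n) (m, a, compose m (j n) f)) = FArr A m n f a) \<and>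
     (\<forall>n\<in>fincards. \<forall>m\<in>fincards. \<forall>k\<in>fincards. \<forall>a\<in>FOb A k. \<forall>g\<in>k \<rightarrow>\<^sub>E FOb A m. \<forall>h\<in>m \<rightarrow>\<^sub>E FOb A n.
        c n (cls A (FOb A n) (m, c m (cls A (FOb A m) (k, a, g)), h)) =
        c n (cls A (FOb A n) (k, a, \<lambda>i\<in>k. c n (cls A (FOb A n) (m, g i, h)))))"

definition is_clone_mor where
  "is_clone_mor A j c B k d \<sigma> \<longleftrightarrow> fin_nat A B \<sigma> \<and>
     (\<forall>n\<in>fincards. \<forall>i\<in>n. \<sigma> n (j n i) = k n i) \<and>
     (\<forall>n\<in>fincards. \<forall>m\<in>fincards. \<forall>a\<in>FOb A m. \<forall>f\<in>m \<rightarrow>\<^sub>E FOb A n.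
        \<sigma> n (c n (cls A (FOb A n) (m, a, f))) = d n (cls B (FOb B n) (m, \<sigma> m a, compose m (\<sigma> n) f)))"

text \<open>Normal form of a one-object enriched category: with all components
  \<open>undefined\<close> off \<open>x\<close>, it amounts to a hom-object, a unit and a
  composition. The object \<open>x\<close> remains a parameter, because the same clone on different
  objects gives isomorphic but unequal categories.\<close>

definition mk_ecat :: "'x \<Rightarrow> 'u endo \<Rightarrow> ('u set \<Rightarrow> 'u \<Rightarrow> 'u) \<Rightarrow> ('u set \<Rightarrow> 'u \<Rightarrow> 'u) \<Rightarrow>
    ('x, 'u endo, 'u set \<Rightarrow> 'u \<Rightarrow> 'u) ecat" where
  "mk_ecat x A j c = \<lparr>EOb = {x}, EHom = (\<lambda>X\<in>{x}. \<lambda>Y\<in>{x}. A), EId = (\<lambda>X\<in>{x}. j),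
     ECmp = (\<lambda>X\<in>{x}. \<lambda>Y\<in>{x}. \<lambda>Z\<in>{x}. c)\<rparr>"

definition mk_efun :: "'x \<Rightarrow> 'x \<Rightarrow> ('u set \<Rightarrow> 'u \<Rightarrow> 'u) \<Rightarrow> ('x, 'u set \<Rightarrow> 'u \<Rightarrow> 'u) efun" where
  "mk_efun x y \<sigma> = \<lparr>EFOb = (\<lambda>X\<in>{x}. y), EFArr = (\<lambda>X\<in>{x}. \<lambda>Y\<in>{x}. \<sigma>)\<rparr>"

lemma mk_ecat_simps [simp]:
  "EOb (mk_ecat x A j c) = {x}" "EHom (mk_ecat x A j c) x x = A" "EId (mk_ecat x A j c) x = j"
  "ECmp (mk_ecat x A j c) x x x = c"
  by (simp_all add: mk_ecat_def)

lemma mk_efun_simps [simp]: "EFOb (mk_efun x y \<sigma>) x = y" "EFArr (mk_efun x y \<sigma>) x x = \<sigma>"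
  by (simp_all add: mk_efun_def)

lemma extensional_singleton: "f \<in> extensional {x} \<Longrightarrow> f = (\<lambda>X\<in>{x}. f x)"
  by (auto simp: extensional_def fun_eq_iff)

lemma ecat_eq_mk_ecat:
  assumes "is_ecat V M" "EOb M = {x}"
  shows "M = mk_ecat x (EHom M x x) (EId M x) (ECmp M x x x)"
proof -
  have "EHom M \<in> {x} \<rightarrow>\<^sub>E {x} \<rightarrow>\<^sub>E Ob (Base V)" "EId M \<in> extensional {x}"
    and c: "ECmp M \<in> (\<Pi>\<^sub>E X\<in>{x}. \<Pi>\<^sub>E Y\<in>{x}. \<Pi>\<^sub>E Z\<in>{x}. Hom (Base V) (TOb V (EHom M Y Z) (EHom M X Y)) (EHom M X Z))"
    using assms unfolding is_ecat_def Let_def by (auto simp: PiE_iff)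
  then have h: "EHom M \<in> extensional {x}" "EHom M x \<in> extensional {x}" "EId M \<in> extensional {x}"
    by (auto simp: PiE_iff)
  have "ECmp M \<in> extensional {x}" "ECmp M x \<in> extensional {x}" "ECmp M x x \<in> extensional {x}"
    using c PiE_mem[OF c, of x] PiE_mem[OF PiE_mem[OF c, of x], of x] by (auto intro: PiE_extensional)
  then have "ECmp M = (\<lambda>X\<in>{x}. \<lambda>Y\<in>{x}. \<lambda>Z\<in>{x}. ECmp M x x x)"
    by (auto simp: extensional_def fun_eq_iff)
  moreover have "EHom M = (\<lambda>X\<in>{x}. \<lambda>Y\<in>{x}. EHom M x x)"
    using h(1,2) by (auto simp: extensional_def fun_eq_iff)
  ultimately show ?thesis
    using assms(2) extensional_singleton[OF h(3)]
    unfolding mk_ecat_def by (intro ecat.equality) (simp_all only: ecat.select_convs, rule unit_eq)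
qed

lemma efun_eq_mk_efun:
  assumes "is_efun V (mk_ecat x A j c) (mk_ecat y B k d) P"
  shows "P = mk_efun x y (EFArr P x x)"
proof -
  have p: "EFOb P \<in> {x} \<rightarrow>\<^sub>E {y}"
    and q: "EFArr P \<in> (\<Pi>\<^sub>E X\<in>{x}. \<Pi>\<^sub>E Y\<in>{x}. Hom (Base V) (EHom (mk_ecat x A j c) X Y) (EHom (mk_ecat y B k d) (EFOb P X) (EFOb P Y)))"
    using assms unfolding is_efun_def Let_def mk_ecat_simps(1) by blast+
  have "EFOb P \<in> extensional {x}" "EFArr P \<in> extensional {x}" "EFArr P x \<in> extensional {x}"
    using p q PiE_mem[OF q, of x] by (auto intro: PiE_extensional)
  moreover have "EFOb P x = y" using PiE_mem[OF p, of x] by simp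
  ultimately show ?thesis
    unfolding mk_efun_def
    by (cases P) (simp, metis extensional_singleton)
qed

text \<open>The bridge from diagrams in the functor category to laws on representatives: families of
  extensional maps out of coends are determined by their values on classes.\<close>

lemma coend_nat_eq_iff:
  assumes "\<alpha> \<in> extensional fincards" "\<beta> \<in> extensional fincards"
    and "\<And>n. n \<in> fincards \<Longrightarrow> \<alpha> n \<in> extensional (coend A (X n))"
    and "\<And>n. n \<in> fincards \<Longrightarrow> \<beta> n \<in> extensional (coend A (X n))"
  shows "\<alpha> = \<beta> \<longleftrightarrow> (\<forall>n\<in>fincards. \<forall>m\<in>fincards. \<forall>a\<in>FOb A m. \<forall>f\<in>m \<rightarrow>\<^sub>E X n.
    \<alpha> n (cls A (X n) (m, a, f)) = \<beta> n (cls A (X n) (m, a, f)))"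
proof
  assume eq: "\<forall>n\<in>fincards. \<forall>m\<in>fincards. \<forall>a\<in>FOb A m. \<forall>f\<in>m \<rightarrow>\<^sub>E X n.
    \<alpha> n (cls A (X n) (m, a, f)) = \<beta> n (cls A (X n) (m, a, f))"
  show "\<alpha> = \<beta>"
  proof (rule extensionalityI[OF assms(1,2)], rule extensionalityI[OF assms(3,4)])
    fix n t assume "n \<in> fincards" "t \<in> coend A (X n)"
    then show "\<alpha> n t = \<beta> n t" using eq by (auto elim!: coendE)
  qed
qed simp

lemma is_nat_Idn: "fin_ftor A \<Longrightarrow> fin_nat A A (\<lambda>n\<in>fincards. \<lambda>x\<in>FOb A n. x)"
  using category_Idn[OF is_category_ftor_cat[OF is_category_FIN], of A] by simp

lemma Id_compose_PiE: "f \<in> m \<rightarrow>\<^sub>E X \<Longrightarrow> compose m (\<lambda>x\<in>X. x) f = f"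
  by (auto simp: PiE_iff intro!: Id_compose)

lemma compose_Id_PiE: "f \<in> m \<rightarrow>\<^sub>E X \<Longrightarrow> compose m f (\<lambda>x\<in>m. x) = f"
  by (simp add: compose_eq_PiE_iff)

lemma tens_unit_ext:
  "tens_lunit A \<in> extensional fincards" "tens_runit A \<in> extensional fincards"
  "n \<in> fincards \<Longrightarrow> tens_lunit A n \<in> extensional (coend incl (FOb A n))"
  "n \<in> fincards \<Longrightarrow> tens_runit A n \<in> extensional (coend A n)"
  by (simp_all add: tens_lunit_def tens_runit_def coend_lift_ext)

text \<open>Each axiom is an equation between families of maps out of a coend, hence can be read off
  on classes, where the tensor of arrows and the three constraints have explicit values.\<close>

lemma is_ecat_iff: "is_ecat (FSET U) (mk_ecat x A j c) \<longleftrightarrow> is_clone A j c"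
proof (cases "fin_ftor A \<and> fin_nat incl A j \<and> fin_nat (tens_ob A A) A c")
  case True
  then have A: "fin_ftor A" and j: "fin_nat incl A j"
    and c: "fin_nat (tens_ob A A) A c" by auto
  note AA = ftor_tens_ob[OF A A]
  let ?i = "\<lambda>n\<in>fincards. \<lambda>x\<in>FOb A n. x"
  note i = is_nat_Idn[OF A]
  have l: "(\<lambda>n\<in>fincards. compose (FOb (tens_ob incl A) n) (c n) (tens_arr incl A A A j ?i n)) = tens_lunit A \<longleftrightarrow>
    (\<forall>n\<in>fincards. \<forall>m\<in>fincards. \<forall>i\<in>m. \<forall>f\<in>m \<rightarrow>\<^sub>E FOb A n. c n (cls A (FOb A n) (m, j m i, f)) = f i)"
    by (subst coend_nat_eq_iff[of _ _ incl "FOb A"])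
      (simp_all add: tens_unit_ext cls_in_coend tens_arr_cls[OF ftor_incl A j i] tens_lunit_cls Id_compose_PiE)
  have r: "(\<lambda>n\<in>fincards. compose (FOb (tens_ob A incl) n) (c n) (tens_arr A A incl A ?i j n)) = tens_runit A \<longleftrightarrow>
    (\<forall>n\<in>fincards. \<forall>m\<in>fincards. \<forall>a\<in>FOb A m. \<forall>f\<in>m \<rightarrow>\<^sub>E n.
        c n (cls A (FOb A n) (m, a, compose m (j n) f)) = FArr A m n f a)"
    using tens_arr_cls[OF A A i j]
    by (subst coend_nat_eq_iff[of _ _ A "\<lambda>n. n"])
      (simp_all add: tens_unit_ext cls_in_coend tens_runit_cls[OF A])
  \<comment> \<open>An element of the threefold tensor is a class whose middle entry is again a
    class, so both sides are evaluated on \<open>[m, [k, a, g], h]\<close>, with the inner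
    representative supplied by \<open>coendE\<close>.\<close>
  have a: "(\<lambda>n\<in>fincards. compose (FOb (tens_ob (tens_ob A A) A) n) (c n) (tens_arr (tens_ob A A) A A A c ?i n)) =
     (\<lambda>n\<in>fincards. compose (FOb (tens_ob (tens_ob A A) A) n) (c n)
       ((\<lambda>n\<in>fincards. compose (FOb (tens_ob (tens_ob A A) A) n) (tens_arr A A (tens_ob A A) A ?i c n) (tens_assoc A A A n)) n)) \<longleftrightarrow>
     (\<forall>n\<in>fincards. \<forall>m\<in>fincards. \<forall>k\<in>fincards. \<forall>a\<in>FOb A k. \<forall>g\<in>k \<rightarrow>\<^sub>E FOb A m. \<forall>h\<in>m \<rightarrow>\<^sub>E FOb A n.
        c n (cls A (FOb A n) (m, c m (cls A (FOb A m) (k, a, g)), h)) =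
        c n (cls A (FOb A n) (k, a, \<lambda>i\<in>k. c n (cls A (FOb A n) (m, g i, h)))))" (is "?L = ?R \<longleftrightarrow> ?A")
  proof -
    have L: "?L n (cls (tens_ob A A) (FOb A n) (m, cls A (FOb A m) (k, a, g), h)) =
        c n (cls A (FOb A n) (m, c m (cls A (FOb A m) (k, a, g)), h))"
      and R: "?R n (cls (tens_ob A A) (FOb A n) (m, cls A (FOb A m) (k, a, g), h)) =
        c n (cls A (FOb A n) (k, a, \<lambda>i\<in>k. c n (cls A (FOb A n) (m, g i, h))))"
      if t: "n \<in> fincards" "m \<in> fincards" "k \<in> fincards" "a \<in> FOb A k" "g \<in> k \<rightarrow>\<^sub>E FOb A m" "h \<in> m \<rightarrow>\<^sub>E FOb A n"
      for n m k a g h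
    proof -
      let ?s = "cls A (FOb A m) (k, a, g)"
      let ?v = "\<lambda>i\<in>k. cls A (FOb A n) (m, g i, h)"
      have s: "?s \<in> FOb (tens_ob A A) m" using t by (simp add: cls_in_coend)
      have t': "cls (tens_ob A A) (FOb A n) (m, ?s, h) \<in> coend (tens_ob A A) (FOb A n)"
        using cls_in_coend[OF t(2) s t(6)] .
      have v: "?v \<in> k \<rightarrow>\<^sub>E coend A (FOb A n)"
        using t by (auto intro!: cls_in_coend)
      show "?L n (cls (tens_ob A A) (FOb A n) (m, ?s, h)) = c n (cls A (FOb A n) (m, c m ?s, h))"
        using t(1) t' tens_arr_cls[OF AA A c i t(1,2) s t(6)] Id_compose_PiE[OF t(6)] by simp
      have "compose k (c n) ?v = (\<lambda>i\<in>k. c n (cls A (FOb A n) (m, g i, h)))"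
        by (auto simp: fun_eq_iff)
      then show "?R n (cls (tens_ob A A) (FOb A n) (m, ?s, h)) =
        c n (cls A (FOb A n) (k, a, \<lambda>i\<in>k. c n (cls A (FOb A n) (m, g i, h))))"
        using t(1,3,4) t' tens_assoc_cls[OF A A A t(1,2,6,3,4,5)] v tens_arr_cls[OF A A i c t(1,3,4), of ?v] by simp
    qed
    have "?L = ?R \<longleftrightarrow> (\<forall>n\<in>fincards. \<forall>m\<in>fincards. \<forall>s\<in>FOb (tens_ob A A) m. \<forall>h\<in>m \<rightarrow>\<^sub>E FOb A n.
        ?L n (cls (tens_ob A A) (FOb A n) (m, s, h)) = ?R n (cls (tens_ob A A) (FOb A n) (m, s, h)))"
      (is "_ \<longleftrightarrow> ?B") by (rule coend_nat_eq_iff) auto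
    also have "\<dots> \<longleftrightarrow> ?A"
    proof (intro iffI ballI)
      fix n m k :: "'u set" and a g h
      assume *: ?B and t: "n \<in> fincards" "m \<in> fincards" "k \<in> fincards" "a \<in> FOb A k" "g \<in> k \<rightarrow>\<^sub>E FOb A m" "h \<in> m \<rightarrow>\<^sub>E FOb A n"
      have s: "cls A (FOb A m) (k, a, g) \<in> FOb (tens_ob A A) m" using t by (simp add: cls_in_coend)
      show "c n (cls A (FOb A n) (m, c m (cls A (FOb A m) (k, a, g)), h)) =
        c n (cls A (FOb A n) (k, a, \<lambda>i\<in>k. c n (cls A (FOb A n) (m, g i, h))))"
        unfolding L[OF t, symmetric] R[OF t, symmetric] using * t(1,2,6) s by blast
    next
      fix n m :: "'u set" and s h
      assume *: ?A and t: "n \<in> fincards" "m \<in> fincards" "s \<in> FOb (tens_ob A A) m" "h \<in> m \<rightarrow>\<^sub>E FOb A n"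
      have "s \<in> coend A (FOb A m)" using t(2,3) by simp
      then obtain k a g where k: "k \<in> fincards" "a \<in> FOb A k" "g \<in> k \<rightarrow>\<^sub>E FOb A m" "s = cls A (FOb A m) (k, a, g)"
        by (rule coendE)
      show "?L n (cls (tens_ob A A) (FOb A n) (m, s, h)) = ?R n (cls (tens_ob A A) (FOb A n) (m, s, h))"
        unfolding k(4) L[OF t(1,2) k(1-3) t(4)] R[OF t(1,2) k(1-3) t(4)] using * t k by blast
    qed
    finally show ?thesis .
  qed
  show ?thesis
    using A j c unfolding is_ecat_def is_clone_def Let_def
    by (simp add: mk_ecat_def l[simplified] r[simplified] a[simplified])
next
  case False
  then show ?thesis
    unfolding is_ecat_def is_clone_def Let_def by (auto simp: mk_ecat_def)
qed

lemma is_efun_iff: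
  assumes M: "is_clone A j c" and N: "is_clone B k d"
  shows "is_efun (FSET U) (mk_ecat x A j c) (mk_ecat y B k d) (mk_efun x y \<sigma>) \<longleftrightarrow> is_clone_mor A j c B k d \<sigma>"
proof (cases "fin_nat A B \<sigma>")
  case True
  have A: "fin_ftor A" and B: "fin_ftor B"
    and k: "fin_nat incl B k"
    using M N by (auto simp: is_clone_def)
  have "compose n (\<sigma> n) (j n) = k n \<longleftrightarrow> (\<forall>i\<in>n. \<sigma> n (j n i) = k n i)" if "n \<in> fincards" for n
    using compose_eq_PiE_iff[OF fin_nat_arr[OF k that]] that by simp
  moreover have "k \<in> extensional fincards" using nat_ext[OF k] by simp
  ultimately have u: "(\<lambda>n\<in>fincards. compose (FOb incl n) (\<sigma> n) (j n)) = k \<longleftrightarrow> (\<forall>n\<in>fincards. \<forall>i\<in>n. \<sigma> n (j n i) = k n i)"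
    by (simp add: restrict_eq_iff)
  have m: "(\<lambda>n\<in>fincards. compose (FOb (tens_ob A A) n) (\<sigma> n) (c n)) =
      (\<lambda>n\<in>fincards. compose (FOb (tens_ob A A) n) (d n) (tens_arr A B A B \<sigma> \<sigma> n)) \<longleftrightarrow>
     (\<forall>n\<in>fincards. \<forall>m\<in>fincards. \<forall>a\<in>FOb A m. \<forall>f\<in>m \<rightarrow>\<^sub>E FOb A n.
        \<sigma> n (c n (cls A (FOb A n) (m, a, f))) = d n (cls B (FOb B n) (m, \<sigma> m a, compose m (\<sigma> n) f)))"
    by (subst coend_nat_eq_iff[of _ _ A "FOb A"]) (auto simp: cls_in_coend tens_arr_cls[OF A B True True])
  show ?thesis
    using True unfolding is_efun_def is_clone_mor_def Let_def
    by (simp add: mk_ecat_def mk_efun_def u[simplified] m[simplified])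
next
  case False
  then show ?thesis
    unfolding is_efun_def is_clone_mor_def Let_def by (auto simp: mk_ecat_def mk_efun_def)
qed

subsection \<open>The category of one-object enriched categories\<close>

lemma one_object_simps:
  "Ob (one_object_ecat_cat V) = {M. is_ecat V M} \<inter> {M. \<exists>x. EOb M = {x}}"
  "Hom (one_object_ecat_cat V) M N = {P. is_efun V M N P}"
  by (simp_all add: one_object_ecat_cat_def ecat_cat_def)

lemma mk_ecat_in_one_object: "is_clone A j c \<Longrightarrow> mk_ecat x A j c \<in> Ob one_cat"
  by (simp add: one_object_simps is_ecat_iff)

lemma one_object_obE:
  assumes "M \<in> Ob one_cat"
  obtains x A j c where "M = mk_ecat x A j c" "is_clone A j c"
proof -
  from assms obtain x where M: "is_ecat (FSET U) M" "EOb M = {x}" by (auto simp: one_object_simps)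
  note e = ecat_eq_mk_ecat[OF M]
  have "is_clone (EHom M x x) (EId M x) (ECmp M x x x)"
    using M(1) by (subst (asm) e) (simp add: is_ecat_iff)
  with e show thesis by (rule that)
qed

lemma mk_efun_in_Hom:
  assumes "is_clone A j c" "is_clone B k d"
  shows "mk_efun x y \<sigma> \<in> Hom one_cat (mk_ecat x A j c) (mk_ecat y B k d) \<longleftrightarrow>
    is_clone_mor A j c B k d \<sigma>"
  by (simp add: one_object_simps is_efun_iff[OF assms])

lemma one_object_homE:
  assumes "P \<in> Hom one_cat (mk_ecat x A j c) (mk_ecat y B k d)"
    and M: "is_clone A j c" and N: "is_clone B k d"
  obtains \<sigma> where "P = mk_efun x y \<sigma>" "is_clone_mor A j c B k d \<sigma>"
proof -
  have P: "is_efun (FSET U) (mk_ecat x A j c) (mk_ecat y B k d) P" using assms(1) by (simp add: one_object_simps)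
  note e = efun_eq_mk_efun[OF P]
  have "is_clone_mor A j c B k d (EFArr P x x)"
    using P by (subst (asm) e) (simp add: is_efun_iff[OF M N])
  with e show thesis by (rule that)
qed

lemma one_object_Idn:
  "Idn one_cat (mk_ecat x A j c) = mk_efun x x (Idn fin_cat A)"
  by (simp add: one_object_ecat_cat_def ecat_cat_def mk_efun_def mk_ecat_def cong: restrict_cong)

lemma one_object_Cmp:
  "Cmp one_cat (mk_ecat x A j c) (mk_ecat y B k d) (mk_ecat z C l e) (mk_efun y z \<tau>) (mk_efun x y \<sigma>) =
   mk_efun x z (Cmp fin_cat A B C \<tau> \<sigma>)"
  by (simp add: one_object_ecat_cat_def ecat_cat_def mk_efun_def mk_ecat_def cong: restrict_cong)

lemma clone_mor_Idn:
  assumes "is_clone A j c"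
  shows "is_clone_mor A j c A j c (Idn fin_cat A)"
proof -
  have A: "fin_ftor A" and j: "fin_nat incl A j"
    and c: "fin_nat (tens_ob A A) A c" using assms unfolding is_clone_def by blast+
  have "j n i \<in> FOb A n" if "n \<in> fincards" "i \<in> n" for n i
    using fin_nat_mem[OF j that(1)] that by simp
  moreover have "c n (cls A (FOb A n) (m, a, f)) \<in> FOb A n"
    if "n \<in> fincards" "m \<in> fincards" "a \<in> FOb A m" "f \<in> m \<rightarrow>\<^sub>E FOb A n" for n m a f
    using fin_nat_mem[OF c that(1)] cls_in_coend[OF that(2-4)] that(1) by simp
  ultimately show ?thesis
    using is_nat_Idn[OF A] by (simp add: is_clone_mor_def Id_compose_PiE)
qed

lemma clone_mor_Cmp:
  assumes A: "is_clone A j c" and B: "is_clone B k d" and C: "is_clone C l e"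
    and \<sigma>: "is_clone_mor A j c B k d \<sigma>" and \<tau>: "is_clone_mor B k d C l e \<tau>"
  shows "is_clone_mor A j c C l e (Cmp fin_cat A B C \<tau> \<sigma>)"
proof -
  have F: "fin_ftor A" "fin_ftor B" "fin_ftor C"
    and j: "fin_nat incl A j" and c: "fin_nat (tens_ob A A) A c"
    using A B C unfolding is_clone_def by blast+
  have n: "fin_nat A B \<sigma>" "fin_nat B C \<tau>"
    using \<sigma> \<tau> unfolding is_clone_mor_def by blast+
  have nat: "fin_nat A C (Cmp fin_cat A B C \<tau> \<sigma>)"
    using category_Cmp[OF is_category_ftor_cat[OF is_category_FIN], of A B C \<sigma> \<tau>] F n by simp
  show ?thesis
    unfolding is_clone_mor_def
  proof (intro conjI ballI nat)
    fix n :: "'u set" and i assume n: "n \<in> fincards" and i: "i \<in> n"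
    show "Cmp fin_cat A B C \<tau> \<sigma> n (j n i) = l n i"
      using \<sigma> \<tau> i n fin_nat_mem[OF j n] by (simp add: is_clone_mor_def)
  next
    fix n m :: "'u set" and a f
    assume t: "n \<in> fincards" "m \<in> fincards" "a \<in> FOb A m" "f \<in> m \<rightarrow>\<^sub>E FOb A n"
    have s: "\<sigma> m a \<in> FOb B m" "compose m (\<sigma> n) f \<in> m \<rightarrow>\<^sub>E FOb B n"
      using fin_nat_mem[OF n(1) t(2,3)] compose_PiE[OF t(4) fin_nat_arr[OF n(1) t(1)]] .
    have r: "c n (cls A (FOb A n) (m, a, f)) \<in> FOb A n"
      using fin_nat_mem[OF c t(1)] cls_in_coend[OF t(2-4)] t(1) by simp
    have f: "compose m (compose (FOb A n) (\<tau> n) (\<sigma> n)) f = compose m (\<tau> n) (compose m (\<sigma> n) f)"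
      by (rule compose_assoc_PiE[OF t(4), symmetric])
    have "\<tau> n (\<sigma> n (c n (cls A (FOb A n) (m, a, f)))) = \<tau> n (d n (cls B (FOb B n) (m, \<sigma> m a, compose m (\<sigma> n) f)))"
      using \<sigma> t by (simp add: is_clone_mor_def)
    also have "\<dots> = e n (cls C (FOb C n) (m, \<tau> m (\<sigma> m a), compose m (\<tau> n) (compose m (\<sigma> n) f)))"
      using \<tau> t(1,2) s by (simp add: is_clone_mor_def)
    finally show "Cmp fin_cat A B C \<tau> \<sigma> n (c n (cls A (FOb A n) (m, a, f))) =
      e n (cls C (FOb C n) (m, Cmp fin_cat A B C \<tau> \<sigma> m a,
        compose m (Cmp fin_cat A B C \<tau> \<sigma> n) f))"
      using t(1-3) r by (simp add: f)
  qed
qed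

text \<open>Identities and composites are those of \<open>fin_cat\<close> on the hom-objects, so the
  category laws are inherited; closure of clone morphisms is what has to be added.\<close>

lemma is_category_one_object: "is_category (one_cat :: (('x, 'u endo, _) ecat, _) cat)"
  (is "is_category ?C")
proof -
  note F = is_category_ftor_cat[OF is_category_FIN]
  have ftor: "A \<in> Ob fin_cat" if "is_clone A j c" for A j c
    using that by (simp add: is_clone_def)
  have nat: "\<sigma> \<in> Hom fin_cat A B" if "is_clone_mor A j c B k d \<sigma>" for A j c B k d \<sigma>
    using that by (simp add: is_clone_mor_def)
  show ?thesis
    unfolding is_category_def
  proof (intro conjI ballI)
    fix M assume "M \<in> Ob ?C"
    then show "Idn ?C M \<in> Hom ?C M M"
      by (rule one_object_obE) (simp only: one_object_Idn mk_efun_in_Hom clone_mor_Idn)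
  next
    fix M N P assume M: "M \<in> Ob ?C" and N: "N \<in> Ob ?C" and P: "P \<in> Hom ?C M N"
    from M obtain x A j c where M: "M = mk_ecat x A j c" "is_clone A j c" by (rule one_object_obE)
    from N obtain y B k d where N: "N = mk_ecat y B k d" "is_clone B k d" by (rule one_object_obE)
    obtain \<sigma> where \<sigma>: "P = mk_efun x y \<sigma>" "is_clone_mor A j c B k d \<sigma>"
      using one_object_homE[OF P[unfolded M(1) N(1)] M(2) N(2)] .
    note u = category_unit[OF F ftor[OF M(2)] ftor[OF N(2)] nat[OF \<sigma>(2)]]
    show "Cmp ?C M M N P (Idn ?C M) = P" "Cmp ?C M N N (Idn ?C N) P = P"
      unfolding M(1) N(1) \<sigma>(1) one_object_Idn one_object_Cmp u by (rule refl)+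
  next
    fix L M N P Q assume L: "L \<in> Ob ?C" and M: "M \<in> Ob ?C" and N: "N \<in> Ob ?C" and P: "P \<in> Hom ?C L M" and Q: "Q \<in> Hom ?C M N"
    from L obtain x A j c where L: "L = mk_ecat x A j c" "is_clone A j c" by (rule one_object_obE)
    from M obtain y B k d where M: "M = mk_ecat y B k d" "is_clone B k d" by (rule one_object_obE)
    from N obtain z C l e where N: "N = mk_ecat z C l e" "is_clone C l e" by (rule one_object_obE)
    obtain \<sigma> where \<sigma>: "P = mk_efun x y \<sigma>" "is_clone_mor A j c B k d \<sigma>"
      using one_object_homE[OF P[unfolded L(1) M(1)] L(2) M(2)] .
    obtain \<tau> where \<tau>: "Q = mk_efun y z \<tau>" "is_clone_mor B k d C l e \<tau>"
      using one_object_homE[OF Q[unfolded M(1) N(1)] M(2) N(2)] .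
    show "Cmp ?C L M N Q P \<in> Hom ?C L N"
      unfolding L(1) M(1) N(1) \<sigma>(1) \<tau>(1) one_object_Cmp mk_efun_in_Hom[OF L(2) N(2)]
      using clone_mor_Cmp[OF L(2) M(2) N(2) \<sigma>(2) \<tau>(2)] .
  next
    fix K L M N P Q R assume K: "K \<in> Ob ?C" and L: "L \<in> Ob ?C" and M: "M \<in> Ob ?C" and N: "N \<in> Ob ?C"
      and P: "P \<in> Hom ?C K L" and Q: "Q \<in> Hom ?C L M" and R: "R \<in> Hom ?C M N"
    from K obtain w E i b where K: "K = mk_ecat w E i b" "is_clone E i b" by (rule one_object_obE)
    from L obtain x A j c where L: "L = mk_ecat x A j c" "is_clone A j c" by (rule one_object_obE)
    from M obtain y B k d where M: "M = mk_ecat y B k d" "is_clone B k d" by (rule one_object_obE)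
    from N obtain z C l e where N: "N = mk_ecat z C l e" "is_clone C l e" by (rule one_object_obE)
    obtain \<rho> where \<rho>: "P = mk_efun w x \<rho>" "is_clone_mor E i b A j c \<rho>"
      using one_object_homE[OF P[unfolded K(1) L(1)] K(2) L(2)] .
    obtain \<sigma> where \<sigma>: "Q = mk_efun x y \<sigma>" "is_clone_mor A j c B k d \<sigma>"
      using one_object_homE[OF Q[unfolded L(1) M(1)] L(2) M(2)] .
    obtain \<tau> where \<tau>: "R = mk_efun y z \<tau>" "is_clone_mor B k d C l e \<tau>"
      using one_object_homE[OF R[unfolded M(1) N(1)] M(2) N(2)] .
    show "Cmp ?C K L N (Cmp ?C L M N R Q) P = Cmp ?C K M N R (Cmp ?C K L M Q P)"
      unfolding K(1) L(1) M(1) N(1) \<rho>(1) \<sigma>(1) \<tau>(1) one_object_Cmp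
        category_assoc[OF F ftor[OF K(2)] ftor[OF L(2)] ftor[OF M(2)] ftor[OF N(2)] nat[OF \<rho>(2)] nat[OF \<sigma>(2)] nat[OF \<tau>(2)]]
      by (rule refl)
  qed
qed

text \<open>A pointwise inverse of a structure-preserving map preserves the structure: the equations
  for \<open>\<rho>\<close> arise from those for \<open>\<sigma>\<close> at elements of the form
  \<open>\<rho> b\<close> by cancellation.\<close>

lemma iso_mk_efun:
  assumes A: "is_clone A j c" and B: "is_clone B k d" and \<sigma>: "is_clone_mor A j c B k d \<sigma>"
    and \<rho>: "fin_nat B A \<rho>"
    and \<rho>\<sigma>: "\<And>n a. n \<in> fincards \<Longrightarrow> a \<in> FOb A n \<Longrightarrow> \<rho> n (\<sigma> n a) = a"
    and \<sigma>\<rho>: "\<And>n b. n \<in> fincards \<Longrightarrow> b \<in> FOb B n \<Longrightarrow> \<sigma> n (\<rho> n b) = b"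
  shows "is_iso one_cat (mk_ecat x A j c) (mk_ecat y B k d) (mk_efun x y \<sigma>)"
proof -
  have j: "fin_nat incl A j" and c: "fin_nat (tens_ob A A) A c"
    using A unfolding is_clone_def by blast+
  have n: "fin_nat A B \<sigma>" using \<sigma> unfolding is_clone_mor_def by blast
  have "is_clone_mor B k d A j c \<rho>"
    unfolding is_clone_mor_def
  proof (intro conjI ballI \<rho>)
    fix n :: "'u set" and i assume i: "n \<in> fincards" "i \<in> n"
    then have "\<sigma> n (j n i) = k n i" using \<sigma> by (simp add: is_clone_mor_def)
    moreover have "j n i \<in> FOb A n" using fin_nat_mem[OF j i(1)] i by simp
    ultimately show "\<rho> n (k n i) = j n i" using \<rho>\<sigma>[OF i(1)] by metis
  next
    fix n m :: "'u set" and b f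
    assume t: "n \<in> fincards" "m \<in> fincards" "b \<in> FOb B m" "f \<in> m \<rightarrow>\<^sub>E FOb B n"
    have s: "\<rho> m b \<in> FOb A m" "compose m (\<rho> n) f \<in> m \<rightarrow>\<^sub>E FOb A n"
      using fin_nat_mem[OF \<rho> t(2,3)] compose_PiE[OF t(4) fin_nat_arr[OF \<rho> t(1)]] .
    have f: "compose m (\<sigma> n) (compose m (\<rho> n) f) = f"
      using PiE_mem[OF t(4)] \<sigma>\<rho>[OF t(1)] by (simp add: compose_eq_PiE_iff[OF t(4)])
    have "d n (cls B (FOb B n) (m, b, f)) = \<sigma> n (c n (cls A (FOb A n) (m, \<rho> m b, compose m (\<rho> n) f)))"
      using \<sigma> t(1,2) s \<sigma>\<rho>[OF t(2,3)] f by (simp add: is_clone_mor_def)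
    moreover have "c n (cls A (FOb A n) (m, \<rho> m b, compose m (\<rho> n) f)) \<in> FOb A n"
      using fin_nat_mem[OF c t(1)] cls_in_coend[OF t(2) s] t(1) by simp
    ultimately show "\<rho> n (d n (cls B (FOb B n) (m, b, f))) =
      c n (cls A (FOb A n) (m, \<rho> m b, compose m (\<rho> n) f))" using \<rho>\<sigma>[OF t(1)] by simp
  qed
  moreover have "(\<lambda>n\<in>fincards. compose (FOb A n) (\<rho> n) (\<sigma> n)) = (\<lambda>n\<in>fincards. \<lambda>a\<in>FOb A n. a)"
    using \<rho>\<sigma> by (auto intro!: restrict_ext simp: compose_eq_restrict_iff)
  moreover have "(\<lambda>n\<in>fincards. compose (FOb B n) (\<sigma> n) (\<rho> n)) = (\<lambda>n\<in>fincards. \<lambda>a\<in>FOb B n. a)"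
    using \<sigma>\<rho> by (auto intro!: restrict_ext simp: compose_eq_restrict_iff)
  ultimately show ?thesis
    unfolding is_iso_def using \<sigma>
    by (intro conjI bexI[of _ "mk_efun y x \<rho>"])
      (simp_all add: mk_efun_in_Hom[OF A B] mk_efun_in_Hom[OF B A] one_object_Idn one_object_Cmp)
qed

subsection \<open>The clone of a monad\<close>

definition clone_mult :: "('u set, 'u \<Rightarrow> 'u) monad \<Rightarrow> 'u set \<Rightarrow> 'u \<Rightarrow> 'u" where
  "clone_mult M = (\<lambda>n\<in>fincards. coend_lift (res (Fun M)) (FOb (Fun M) n)
     (\<lambda>(m, a, f). Mult M n (FArr (Fun M) m (FOb (Fun M) n) f a)))"

text \<open>The name of the single object is immaterial; \<open>undefined\<close> is a fixed choice
  available in every type \<open>'x\<close>.\<close>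

definition clone_of :: "('u set, 'u \<Rightarrow> 'u) monad \<Rightarrow> ('x, 'u endo, 'u set \<Rightarrow> 'u \<Rightarrow> 'u) ecat" where
  "clone_of M = mk_ecat undefined (res (Fun M)) (restrict (Unit M) fincards) (clone_mult M)"

context
  fixes M :: "('u set, 'u \<Rightarrow> 'u) monad"
  assumes M: "is_monad (SET U) M"
begin

lemma monad_ftor: "set_ftor (Fun M)"
  and monad_Unit: "set_nat (id_ftor (SET U)) (Fun M) (Unit M)"
  and monad_Mult: "set_nat (comp_ftor (SET U) (Fun M) (Fun M)) (Fun M) (Mult M)"
  and monad_left: "X \<in> U \<Longrightarrow> t \<in> FOb (Fun M) X \<Longrightarrow> Mult M X (Unit M (FOb (Fun M) X) t) = t"
  and monad_right: "X \<in> U \<Longrightarrow> t \<in> FOb (Fun M) X \<Longrightarrow> Mult M X (FArr (Fun M) X (FOb (Fun M) X) (Unit M X) t) = t"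
  and monad_assoc: "X \<in> U \<Longrightarrow> t \<in> FOb (Fun M) (FOb (Fun M) (FOb (Fun M) X)) \<Longrightarrow>
    Mult M X (Mult M (FOb (Fun M) X) t) =
    Mult M X (FArr (Fun M) (FOb (Fun M) (FOb (Fun M) X)) (FOb (Fun M) X) (Mult M X) t)"
  using M unfolding is_monad_iff by blast+

lemma monad_ob: "X \<in> U \<Longrightarrow> FOb (Fun M) X \<in> U"
  by (rule set_ob[OF monad_ftor])

lemma Unit_arr: "X \<in> U \<Longrightarrow> Unit M X \<in> X \<rightarrow>\<^sub>E FOb (Fun M) X"
  using set_nat_arr[OF monad_Unit] by simp

lemma Mult_arr: "X \<in> U \<Longrightarrow> Mult M X \<in> FOb (Fun M) (FOb (Fun M) X) \<rightarrow>\<^sub>E FOb (Fun M) X"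
  using set_nat_arr[OF monad_Mult] by simp

lemma Unit_natural: "X \<in> U \<Longrightarrow> Y \<in> U \<Longrightarrow> f \<in> X \<rightarrow>\<^sub>E Y \<Longrightarrow> x \<in> X \<Longrightarrow>
    Unit M Y (f x) = FArr (Fun M) X Y f (Unit M X x)"
  using set_natural[OF monad_Unit, of X Y f x] by simp

lemma Mult_natural: "X \<in> U \<Longrightarrow> Y \<in> U \<Longrightarrow> f \<in> X \<rightarrow>\<^sub>E Y \<Longrightarrow> t \<in> FOb (Fun M) (FOb (Fun M) X) \<Longrightarrow>
    Mult M Y (FArr (Fun M) (FOb (Fun M) X) (FOb (Fun M) Y) (FArr (Fun M) X Y f) t) = FArr (Fun M) X Y f (Mult M X t)"
  using set_natural[OF monad_Mult, of X Y f t] by simp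

lemma clone_mult_cls:
  assumes "n \<in> fincards" "m \<in> fincards" "a \<in> FOb (Fun M) m" "f \<in> m \<rightarrow>\<^sub>E FOb (Fun M) n"
  shows "clone_mult M n (cls (res (Fun M)) (FOb (Fun M) n) (m, a, f)) = Mult M n (FArr (Fun M) m (FOb (Fun M) n) f a)"
proof -
  have "coend_lift (res (Fun M)) (FOb (Fun M) n) (\<lambda>(m, a, f). Mult M n (FArr (Fun M) m (FOb (Fun M) n) f a))
    (cls (res (Fun M)) (FOb (Fun M) n) (m, a, f)) = (\<lambda>(m, a, f). Mult M n (FArr (Fun M) m (FOb (Fun M) n) f a)) (m, a, f)"
    by (rule coend_lift_cls[OF ftor_res[OF monad_ftor]])
      (use assms in \<open>auto simp: set_comp[OF monad_ftor] monad_ob\<close>)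
  then show ?thesis using assms(1) by (simp add: clone_mult_def)
qed

lemma is_nat_clone_mult:
  "fin_nat (tens_ob (res (Fun M)) (res (Fun M))) (res (Fun M)) (clone_mult M)"
proof (rule natI)
  let ?T = "Fun M"
  note T = monad_ftor
  show "clone_mult M \<in> extensional (Ob (FIN U))" by (simp add: clone_mult_def)
  fix n assume "n \<in> Ob (FIN U)"
  then have n: "n \<in> fincards" by simp
  then have "Mult M n (FArr ?T m (FOb ?T n) f a) \<in> FOb ?T n"
    if "m \<in> fincards" "a \<in> FOb ?T m" "f \<in> m \<rightarrow>\<^sub>E FOb ?T n" for m a f
    using that by (intro PiE_mem[OF Mult_arr] set_mem[OF T]) (auto intro: monad_ob)
  then show "clone_mult M n \<in> FOb (tens_ob (res ?T) (res ?T)) n \<rightarrow>\<^sub>E FOb (res ?T) n"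
    using n coend_lift_PiE[of "res ?T" "FOb ?T n" "\<lambda>(m, a, f). Mult M n (FArr ?T m (FOb ?T n) f a)"]
    by (simp add: clone_mult_def)
  fix n' v t assume "n' \<in> Ob (FIN U)" "v \<in> Hom (FIN U) n n'" and "t \<in> FOb (tens_ob (res ?T) (res ?T)) n"
  then have v: "n' \<in> fincards" "v \<in> n \<rightarrow>\<^sub>E n'" and t: "t \<in> coend (res ?T) (FOb ?T n)" using n by simp_all
  obtain m a f where m: "m \<in> fincards" "a \<in> FOb (res ?T) m" "f \<in> m \<rightarrow>\<^sub>E FOb ?T n"
    "t = cls (res ?T) (FOb ?T n) (m, a, f)" using t by (rule coendE)
  have a: "a \<in> FOb ?T m" using m by simp
  have Tv: "FArr ?T n n' v \<in> FOb ?T n \<rightarrow>\<^sub>E FOb ?T n'" using set_arr[OF T _ _ v(2)] n v by simp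
  have "FArr (tens_ob (res ?T) (res ?T)) n n' v t = cls (res ?T) (FOb ?T n') (m, a, compose m (FArr ?T n n' v) f)"
    using n v m Tv by (simp add: lan_map_cls[OF ftor_res[OF T]])
  then have "clone_mult M n' (FArr (tens_ob (res ?T) (res ?T)) n n' v t) =
    Mult M n' (FArr ?T m (FOb ?T n') (compose m (FArr ?T n n' v) f) a)"
    using clone_mult_cls[OF v(1) m(1) a compose_PiE[OF m(3) Tv]] by simp
  also have "\<dots> = Mult M n' (FArr ?T (FOb ?T n) (FOb ?T n') (FArr ?T n n' v) (FArr ?T m (FOb ?T n) f a))"
    using set_comp[OF T _ _ _ m(3) Tv a] m(1) n v(1) by (simp add: monad_ob)
  also have "\<dots> = FArr ?T n n' v (Mult M n (FArr ?T m (FOb ?T n) f a))"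
    using n v set_mem[OF T _ _ m(3) a] m(1) by (intro Mult_natural) (simp_all add: monad_ob)
  finally show "clone_mult M n' (FArr (tens_ob (res ?T) (res ?T)) n n' v t) = FArr (res ?T) n n' v (clone_mult M n t)"
    using n v m clone_mult_cls[OF n m(1) a m(3)] by simp
qed

lemma is_nat_res_Unit: "fin_nat incl (res (Fun M)) (restrict (Unit M) fincards)"
  by (rule natI) (simp_all add: Unit_arr Unit_natural)

text \<open>Each clone law is a monad law seen through a labelling: naturality of the unit reduces
  the first to the left unit law, functoriality reduces the second to the right unit law, and
  naturality of the multiplication at \<open>h\<close> prepares associativity.\<close>

lemma is_clone_monad: "is_clone (res (Fun M)) (restrict (Unit M) fincards) (clone_mult M)"
  unfolding is_clone_def
proof (intro conjI ballI ftor_res[OF monad_ftor] is_nat_res_Unit is_nat_clone_mult)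
  let ?T = "Fun M"
  note T = monad_ftor
  {
    fix n m :: "'u set" and i f
    assume t: "n \<in> fincards" "m \<in> fincards" "i \<in> m" "f \<in> m \<rightarrow>\<^sub>E FOb (res ?T) n"
    have f: "f \<in> m \<rightarrow>\<^sub>E FOb ?T n" using t by simp
    have "clone_mult M n (cls (res ?T) (FOb ?T n) (m, Unit M m i, f)) =
       Mult M n (FArr ?T m (FOb ?T n) f (Unit M m i))"
      using clone_mult_cls[OF t(1,2) _ f] PiE_mem[OF Unit_arr t(3)] t(2) by simp
    also have "\<dots> = f i"
      using Unit_natural[OF _ _ f t(3)] monad_left[OF _ PiE_mem[OF f t(3)]] t(1,2) by (simp add: monad_ob)
    finally show "clone_mult M n (cls (res ?T) (FOb (res ?T) n) (m, restrict (Unit M) fincards m i, f)) = f i"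
      using t by simp
  next
    fix n m :: "'u set" and a f
    assume t: "n \<in> fincards" "m \<in> fincards" "a \<in> FOb (res ?T) m" "f \<in> m \<rightarrow>\<^sub>E n"
    have a: "a \<in> FOb ?T m" using t by simp
    have u: "Unit M n \<in> n \<rightarrow>\<^sub>E FOb ?T n" using t by (simp add: Unit_arr)
    have "clone_mult M n (cls (res ?T) (FOb ?T n) (m, a, compose m (Unit M n) f)) =
      Mult M n (FArr ?T m (FOb ?T n) (compose m (Unit M n) f) a)"
      by (rule clone_mult_cls[OF t(1,2) a compose_PiE[OF t(4) u]])
    also have "\<dots> = Mult M n (FArr ?T n (FOb ?T n) (Unit M n) (FArr ?T m n f a))"
      using set_comp[OF T _ _ _ t(4) u a] t(1,2) by (simp add: monad_ob)
    also have "\<dots> = FArr ?T m n f a"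
      using t set_mem[OF T _ _ t(4) a] by (intro monad_right) simp_all
    finally show "clone_mult M n (cls (res ?T) (FOb (res ?T) n) (m, a, compose m (restrict (Unit M) fincards n) f)) =
      FArr (res ?T) m n f a" using t by simp
  next
    fix n m k :: "'u set" and a g h
    assume t: "n \<in> fincards" "m \<in> fincards" "k \<in> fincards" "a \<in> FOb (res ?T) k"
      "g \<in> k \<rightarrow>\<^sub>E FOb (res ?T) m" "h \<in> m \<rightarrow>\<^sub>E FOb (res ?T) n"
    let ?n = "FOb ?T n" and ?m = "FOb ?T m"
    have a: "a \<in> FOb ?T k" and g: "g \<in> k \<rightarrow>\<^sub>E ?m" and h: "h \<in> m \<rightarrow>\<^sub>E ?n" using t by simp_all
    have obs: "n \<in> U" "m \<in> U" "k \<in> U" "?n \<in> U" "?m \<in> U" "FOb ?T ?n \<in> U" using t by (simp_all add: monad_ob)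
    have ga: "FArr ?T k ?m g a \<in> FOb ?T ?m" by (rule set_mem[OF T obs(3,5) g a])
    have Th: "FArr ?T m ?n h \<in> ?m \<rightarrow>\<^sub>E FOb ?T ?n" by (rule set_arr[OF T obs(2,4) h])
    have Tga: "FArr ?T ?m (FOb ?T ?n) (FArr ?T m ?n h) (FArr ?T k ?m g a) \<in> FOb ?T (FOb ?T ?n)"
      by (rule set_mem[OF T obs(5,6) Th ga])
    let ?r = "\<lambda>i\<in>k. clone_mult M n (cls (res ?T) ?n (m, g i, h))"
    \<comment> \<open>The labelling on the right of the associativity law is the multiplication
      after \<open>T h\<close> after \<open>g\<close>, which functoriality of \<open>T\<close> can
      split.\<close>
    have r: "?r = compose k (Mult M n) (compose k (FArr ?T m ?n h) g)"
      using clone_mult_cls[OF t(1,2) _ h] PiE_mem[OF g] by (auto simp: fun_eq_iff)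
    have Thg: "compose k (FArr ?T m ?n h) g \<in> k \<rightarrow>\<^sub>E FOb ?T ?n" by (rule compose_PiE[OF g Th])
    have r_arr: "?r \<in> k \<rightarrow>\<^sub>E ?n" unfolding r by (rule compose_PiE[OF Thg Mult_arr[OF obs(1)]])
    have "clone_mult M n (cls (res ?T) ?n (m, clone_mult M m (cls (res ?T) ?m (k, a, g)), h)) =
      Mult M n (FArr ?T m ?n h (Mult M m (FArr ?T k ?m g a)))"
      unfolding clone_mult_cls[OF t(2,3) a g]
      using clone_mult_cls[OF t(1,2) _ h] PiE_mem[OF Mult_arr[OF obs(2)] ga] by simp
    also have "\<dots> = Mult M n (Mult M ?n (FArr ?T ?m (FOb ?T ?n) (FArr ?T m ?n h) (FArr ?T k ?m g a)))"
      using Mult_natural[OF obs(2,4) h ga] by simp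
    also have "\<dots> = Mult M n (FArr ?T (FOb ?T ?n) ?n (Mult M n) (FArr ?T ?m (FOb ?T ?n) (FArr ?T m ?n h) (FArr ?T k ?m g a)))"
      by (rule monad_assoc[OF obs(1) Tga])
    also have "\<dots> = Mult M n (FArr ?T k ?n ?r a)"
      unfolding r set_comp[OF T obs(3,5,6) g Th a] set_comp[OF T obs(3,6,4) Thg Mult_arr[OF obs(1)] a] by (rule refl)
    also have "\<dots> = clone_mult M n (cls (res ?T) ?n (k, a, ?r))"
      by (rule clone_mult_cls[OF t(1,3) a r_arr, symmetric])
    finally show "clone_mult M n (cls (res ?T) (FOb (res ?T) n) (m, clone_mult M m (cls (res ?T) (FOb (res ?T) m) (k, a, g)), h)) =
      clone_mult M n (cls (res ?T) (FOb (res ?T) n) (k, a, \<lambda>i\<in>k. clone_mult M n (cls (res ?T) (FOb (res ?T) n) (m, g i, h))))"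
      using t(1,2) by simp
  }
qed

end

lemma is_nat_restrict:
  assumes "set_nat S T \<tau>"
  shows "fin_nat (res S) (res T) (restrict \<tau> fincards)"
  by (rule natI) (simp_all add: set_nat_arr[OF assms] set_natural[OF assms])

text \<open>The equations over all sets follow from those at finite cardinals: an element of
  \<open>X\<close> is the image of a point of the one-element cardinal, and an element of
  \<open>S (S X)\<close> comes from \<open>S (S n)\<close> for a finite \<open>n\<close>, since
  \<open>S\<close> after \<open>S\<close> is finitary. Naturality carries the equations
  along.\<close>

lemma clone_mor_monad_mor_iff:
  assumes M: "is_monad (SET U) M" and N: "is_monad (SET U) N" and fin: "is_finitary U (Fun M)"
    and \<tau>: "set_nat (Fun M) (Fun N) \<tau>"
  shows "is_clone_mor (res (Fun M)) (restrict (Unit M) fincards) (clone_mult M)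
      (res (Fun N)) (restrict (Unit N) fincards) (clone_mult N) (restrict \<tau> fincards) \<longleftrightarrow>
    is_monad_mor (SET U) M N \<tau>" (is "?C \<longleftrightarrow> ?M")
proof -
  let ?S = "Fun M" and ?T = "Fun N"
  note S = monad_ftor[OF M] and T = monad_ftor[OF N]
  have u: "(\<forall>n\<in>fincards. \<forall>i\<in>n. restrict \<tau> fincards n (restrict (Unit M) fincards n i) = restrict (Unit N) fincards n i) \<longleftrightarrow>
    (\<forall>X\<in>U. \<forall>x\<in>X. \<tau> X (Unit M X x) = Unit N X x)" (is "?L \<longleftrightarrow> ?R")
  proof
    assume L: ?L
    show ?R
    proof (intro ballI)
      fix X x assume X: "X \<in> U" "x \<in> X"
      \<comment> \<open>On the one-element cardinal, the constant map at \<open>x\<close> names the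
        element \<open>x\<close>.\<close>
      define o1 :: "'u set" where "o1 = num ` {..<1}"
      have o1: "o1 \<in> fincards" "num 0 \<in> o1" by (auto simp: o1_def fincards_def)
      let ?f = "\<lambda>i\<in>o1. x"
      have f: "?f \<in> o1 \<rightarrow>\<^sub>E X" "?f (num 0) = x" using X o1 by auto
      have o1U: "o1 \<in> U" using o1(1) by simp
      have e: "Unit M o1 (num 0) \<in> FOb ?S o1" by (rule PiE_mem[OF Unit_arr[OF M o1U] o1(2)])
      have "\<tau> X (Unit M X x) = \<tau> X (FArr ?S o1 X ?f (Unit M o1 (num 0)))"
        using Unit_natural[OF M o1U X(1) f(1) o1(2)] f(2) by simp
      also have "\<dots> = FArr ?T o1 X ?f (\<tau> o1 (Unit M o1 (num 0)))"
        by (rule set_natural[OF \<tau> o1U X(1) f(1) e])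
      also have "\<tau> o1 (Unit M o1 (num 0)) = Unit N o1 (num 0)"
        using L o1 by simp
      also have "FArr ?T o1 X ?f (Unit N o1 (num 0)) = Unit N X x"
        using Unit_natural[OF N o1U X(1) f(1) o1(2)] f(2) by simp
      finally show "\<tau> X (Unit M X x) = Unit N X x" .
    qed
  qed simp
  let ?eq = "\<lambda>n m a f. restrict \<tau> fincards n (clone_mult M n (cls (res ?S) (FOb (res ?S) n) (m, a, f))) =
      clone_mult N n (cls (res ?T) (FOb (res ?T) n) (m, restrict \<tau> fincards m a, compose m (restrict \<tau> fincards n) f))"
  let ?rhs = "\<lambda>X t. Mult N X (\<tau> (FOb ?T X) (FArr ?S (FOb ?S X) (FOb ?T X) (\<tau> X) t))"
  have cls: "?eq n m a f \<longleftrightarrow>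
      \<tau> n (Mult M n (FArr ?S m (FOb ?S n) f a)) = ?rhs n (FArr ?S m (FOb ?S n) f a)"
    if t: "n \<in> fincards" "m \<in> fincards" "a \<in> FOb ?S m" "f \<in> m \<rightarrow>\<^sub>E FOb ?S n" for n m a f
  proof -
    have obs: "n \<in> U" "m \<in> U" "FOb ?S n \<in> U" "FOb ?T n \<in> U" using t monad_ob[OF M] monad_ob[OF N] by simp_all
    note \<tau>n = set_nat_arr[OF \<tau> obs(1)]
    note f = compose_PiE[OF t(4) \<tau>n]
    have "clone_mult N n (cls (res ?T) (FOb ?T n) (m, \<tau> m a, compose m (\<tau> n) f)) =
      Mult N n (FArr ?T m (FOb ?T n) (compose m (\<tau> n) f) (\<tau> m a))"
      by (rule clone_mult_cls[OF N t(1,2) set_nat_mem[OF \<tau> obs(2) t(3)] f])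
    also have "\<dots> = Mult N n (\<tau> (FOb ?T n) (FArr ?S m (FOb ?T n) (compose m (\<tau> n) f) a))"
      using set_natural[OF \<tau> obs(2,4) f t(3)] by simp
    also have "\<dots> = ?rhs n (FArr ?S m (FOb ?S n) f a)"
      using set_comp[OF S obs(2,3,4) t(4) \<tau>n t(3)] by simp
    finally show ?thesis using t clone_mult_cls[OF M t] by simp
  qed
  have m: "(\<forall>n\<in>fincards. \<forall>m\<in>fincards. \<forall>a\<in>FOb (res ?S) m. \<forall>f\<in>m \<rightarrow>\<^sub>E FOb (res ?S) n. ?eq n m a f) \<longleftrightarrow>
    (\<forall>X\<in>U. \<forall>t\<in>FOb ?S (FOb ?S X). \<tau> X (Mult M X t) = ?rhs X t)" (is "?L \<longleftrightarrow> ?R")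
  proof
    assume R: ?R
    show ?L
    proof (intro ballI)
      fix n m :: "'u set" and a f
      assume t: "n \<in> fincards" "m \<in> fincards" "a \<in> FOb (res ?S) m" "f \<in> m \<rightarrow>\<^sub>E FOb (res ?S) n"
      have t': "a \<in> FOb ?S m" "f \<in> m \<rightarrow>\<^sub>E FOb ?S n" using t by simp_all
      have "FArr ?S m (FOb ?S n) f a \<in> FOb ?S (FOb ?S n)"
        using t(1,2) monad_ob[OF M] by (intro set_mem[OF S _ _ t'(2,1)]) simp_all
      then show "?eq n m a f"
        using R t(1) unfolding cls[OF t(1,2) t'] by simp
    qed
  next
    assume L: ?L
    \<comment> \<open>Even for finite \<open>n\<close> the set \<open>S n\<close> may be infinite,
      so finitariness of \<open>S\<close> is used at \<open>S n\<close> to present \<open>t\<close>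
      as \<open>S f a\<close>, the form of the elements about which the clone equation
      speaks.\<close>
    have base: "\<tau> n (Mult M n t) = ?rhs n t" if n: "n \<in> fincards" and t: "t \<in> FOb ?S (FOb ?S n)" for n t
    proof -
      have nU: "n \<in> U" using n by simp
      obtain m a f where m: "m \<in> fincards" "a \<in> FOb ?S m" "f \<in> m \<rightarrow>\<^sub>E FOb ?S n" "t = FArr ?S m (FOb ?S n) f a"
        by (rule finitary_surj[OF S fin monad_ob[OF M nU] t])
      have "a \<in> FOb (res ?S) m" "f \<in> m \<rightarrow>\<^sub>E FOb (res ?S) n" using m n by simp_all
      then show ?thesis
        using L n m(1) unfolding m(4) cls[OF n m(1-3), symmetric] by blast
    qed
    show ?R
    proof (intro ballI)
      fix X t assume X: "X \<in> U" and t: "t \<in> FOb ?S (FOb ?S X)"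
      have "t \<in> FOb (comp_ftor (SET U) ?S ?S) X" using X t by simp
      then obtain n s g where n: "n \<in> fincards" "s \<in> FOb (comp_ftor (SET U) ?S ?S) n" "g \<in> n \<rightarrow>\<^sub>E X"
          "t = FArr (comp_ftor (SET U) ?S ?S) n X g s"
        by (rule finitary_surj[OF ftor_comp_ftor[OF S S is_category_SET] finitary_comp[OF S fin S fin] X])
      have nU: "n \<in> U" using n by simp
      have obs: "FOb ?S n \<in> U" "FOb ?T n \<in> U" "FOb ?S X \<in> U" "FOb ?T X \<in> U"
        using nU X monad_ob[OF M] monad_ob[OF N] by simp_all
      have s: "s \<in> FOb ?S (FOb ?S n)" and ts: "t = FArr ?S (FOb ?S n) (FOb ?S X) (FArr ?S n X g) s"
        using n nU X by simp_all
      note Sg = set_arr[OF S nU X n(3)] and Tg = set_arr[OF T nU X n(3)]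
      note \<tau>n = set_nat_arr[OF \<tau> nU] and \<tau>X = set_nat_arr[OF \<tau> X]
      let ?s = "FArr ?S (FOb ?S n) (FOb ?T n) (\<tau> n) s"
      have s': "?s \<in> FOb ?S (FOb ?T n)" by (rule set_mem[OF S obs(1,2) \<tau>n s])
      have \<mu>s: "Mult M n s \<in> FOb ?S n" by (rule PiE_mem[OF Mult_arr[OF M nU] s])
      have "compose (FOb ?S n) (\<tau> X) (FArr ?S n X g) = compose (FOb ?S n) (FArr ?T n X g) (\<tau> n)"
        using set_natural[OF \<tau> nU X n(3)] by (simp add: compose_eq_iff)
      then have "FArr ?S (FOb ?S X) (FOb ?T X) (\<tau> X) t = FArr ?S (FOb ?T n) (FOb ?T X) (FArr ?T n X g) ?s"
        unfolding ts set_comp[OF S obs(1,3,4) Sg \<tau>X s] set_comp[OF S obs(1,2,4) \<tau>n Tg s] by simp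
      then have "?rhs X t = Mult N X (FArr ?T (FOb ?T n) (FOb ?T X) (FArr ?T n X g) (\<tau> (FOb ?T n) ?s))"
        using set_natural[OF \<tau> obs(2,4) Tg s'] by simp
      also have "\<dots> = FArr ?T n X g (?rhs n s)"
        by (rule Mult_natural[OF N nU X n(3) set_nat_mem[OF \<tau> obs(2) s']])
      also have "\<dots> = FArr ?T n X g (\<tau> n (Mult M n s))" using base[OF n(1) s] by simp
      also have "\<dots> = \<tau> X (FArr ?S n X g (Mult M n s))" using set_natural[OF \<tau> nU X n(3) \<mu>s] by simp
      also have "\<dots> = \<tau> X (Mult M X t)" using Mult_natural[OF M nU X n(3) s] ts by simp
      finally show "\<tau> X (Mult M X t) = ?rhs X t" by simp
    qed
  qed
  show ?thesis
    unfolding is_clone_mor_def is_monad_mor_iff[OF N] u m using is_nat_restrict[OF \<tau>] \<tau> by simp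
qed

subsection \<open>The monad of a clone\<close>

text \<open>The unit of the Kan extension. At finite cardinals \<open>lan A\<close> has the values
  of \<open>tens_ob A incl\<close>, so this map is the inverse of the right unit constraint.\<close>

definition lan_unit :: "'u endo \<Rightarrow> 'u set \<Rightarrow> 'u \<Rightarrow> 'u" where
  "lan_unit A = (\<lambda>n\<in>fincards. \<lambda>a\<in>FOb A n. cls A n (n, a, \<lambda>i\<in>n. i))"

context
  fixes A :: "'u endo"
  assumes A: "fin_ftor A"
begin

lemma lan_unit_in: "n \<in> fincards \<Longrightarrow> a \<in> FOb A n \<Longrightarrow> lan_unit A n a \<in> coend A n"
  by (simp add: lan_unit_def cls_in_coend id_PiE)

lemma lan_map_lan_unit:
  assumes "n \<in> fincards" "a \<in> FOb A n" "h \<in> n \<rightarrow>\<^sub>E X"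
  shows "lan_map A n X h (lan_unit A n a) = cls A X (n, a, h)"
  using assms lan_map_cls[OF A assms(1,2) id_PiE assms(3)]
  by (simp add: lan_unit_def compose_Id_PiE)

lemma lan_unit_natural:
  assumes "n \<in> fincards" "n' \<in> fincards" "v \<in> n \<rightarrow>\<^sub>E n'" "a \<in> FOb A n"
  shows "lan_unit A n' (FArr A n n' v a) = lan_map A n n' v (lan_unit A n a)"
  using cls_slide[OF A assms id_PiE] lan_map_lan_unit[OF assms(1,4,3)] assms fin_mem[OF A assms]
  by (simp add: lan_unit_def Id_compose_PiE)

lemma tens_runit_lan_unit: "n \<in> fincards \<Longrightarrow> a \<in> FOb A n \<Longrightarrow> tens_runit A n (lan_unit A n a) = a"
  using tens_runit_cls[OF A _ _ _ id_PiE] fin_id[OF A] by (simp add: lan_unit_def)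

text \<open>The class \<open>[m, a, f]\<close> goes to \<open>A f a\<close>, whose unit is by
  naturality the image along \<open>f\<close> of the unit of \<open>a\<close>, and that is
  \<open>[m, a, f]\<close> again.\<close>

lemma lan_unit_tens_runit:
  assumes n: "n \<in> fincards" and t: "t \<in> coend A n"
  shows "lan_unit A n (tens_runit A n t) = t"
proof -
  obtain m a f where m: "m \<in> fincards" "a \<in> FOb A m" "f \<in> m \<rightarrow>\<^sub>E n" "t = cls A n (m, a, f)"
    using t by (rule coendE)
  then show ?thesis
    using n tens_runit_cls[OF A n m(1-3)] lan_unit_natural[OF m(1) n m(3,2)] lan_map_lan_unit[OF m(1-3)] by simp
qed

lemma tens_runit_arr:
  assumes n: "n \<in> fincards" shows "tens_runit A n \<in> coend A n \<rightarrow>\<^sub>E FOb A n"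
  unfolding tens_runit_def using n coend_lift_PiE[of A n "\<lambda>(m, a, f). FArr A m n f a"] fin_mem[OF A _ n] by simp

lemma tens_runit_natural:
  assumes n: "n \<in> fincards" "n' \<in> fincards" "v \<in> n \<rightarrow>\<^sub>E n'" and t: "t \<in> coend A n"
  shows "tens_runit A n' (lan_map A n n' v t) = FArr A n n' v (tens_runit A n t)"
  using lan_unit_natural[OF n PiE_mem[OF tens_runit_arr[OF n(1)] t]] lan_unit_tens_runit[OF n(1) t]
    tens_runit_lan_unit[OF n(2) fin_mem[OF A n PiE_mem[OF tens_runit_arr[OF n(1)] t]]] by metis

lemma is_nat_tens_runit: "fin_nat (res (lan A)) A (tens_runit A)"
  by (rule natI) (simp_all add: tens_unit_ext tens_runit_arr tens_runit_natural)

lemma is_nat_lan_unit: "fin_nat A (res (lan A)) (lan_unit A)"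
  by (rule natI) (simp_all add: lan_unit_natural, simp_all add: lan_unit_def cls_in_coend id_PiE)

end

lemma clone_left:
  "is_clone A j c \<Longrightarrow> n \<in> fincards \<Longrightarrow> m \<in> fincards \<Longrightarrow> i \<in> m \<Longrightarrow> f \<in> m \<rightarrow>\<^sub>E FOb A n \<Longrightarrow>
   c n (cls A (FOb A n) (m, j m i, f)) = f i"
  by (simp add: is_clone_def)

lemma clone_right:
  "is_clone A j c \<Longrightarrow> n \<in> fincards \<Longrightarrow> m \<in> fincards \<Longrightarrow> a \<in> FOb A m \<Longrightarrow> f \<in> m \<rightarrow>\<^sub>E n \<Longrightarrow>
   c n (cls A (FOb A n) (m, a, compose m (j n) f)) = FArr A m n f a"
  by (simp add: is_clone_def)

lemma clone_assoc:
  assumes "is_clone A j c" "n \<in> fincards" "m \<in> fincards" "k \<in> fincards" "a \<in> FOb A k"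
    "g \<in> k \<rightarrow>\<^sub>E FOb A m" "h \<in> m \<rightarrow>\<^sub>E FOb A n"
  shows "c n (cls A (FOb A n) (m, c m (cls A (FOb A m) (k, a, g)), h)) =
    c n (cls A (FOb A n) (k, a, \<lambda>i\<in>k. c n (cls A (FOb A n) (m, g i, h))))"
  using assms(1)[unfolded is_clone_def, THEN conjunct2, THEN conjunct2, THEN conjunct2, THEN conjunct2,
      THEN conjunct2, THEN bspec, OF assms(2), THEN bspec, OF assms(3), THEN bspec, OF assms(4),
      THEN bspec, OF assms(5), THEN bspec, OF assms(6), THEN bspec, OF assms(7)] .

text \<open>Away from finite cardinals the unit and multiplication of the monad are known only
  through naturality, and \<open>T n\<close> is in general such a place. Checks at finite
  \<open>n\<close> therefore first replace arguments over \<open>T n\<close> by labellings from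
  finite cardinals, where clone laws apply.\<close>

lemma clone_of_surj:
  assumes "is_clone A j c"
  obtains M where "is_monad (SET U) M" "is_finitary U (Fun M)"
    "is_iso one_cat (clone_of M) (mk_ecat x A j c) (mk_efun undefined x (tens_runit A))"
proof -
  have A: "fin_ftor A" and j: "fin_nat incl A j"
    and c: "fin_nat (tens_ob A A) A c"
    using assms unfolding is_clone_def by blast+
  note left = clone_left[OF assms] and right = clone_right[OF assms] and assoc = clone_assoc[OF assms]
  define T where "T = lan A"
  have T: "set_ftor T" "is_finitary U T"
    unfolding T_def by (rule ftor_lan[OF A], rule finitary_lan[OF A])
  let ?TT = "comp_ftor (SET U) T T" and ?I = "id_ftor (SET U)"
  note TT = ftor_comp_ftor[OF T(1) T(1) is_category_SET] finitary_comp[OF T T]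
  let ?T = "coend A" and ?L = "lan_map A"
  have T_ob: "FOb T X = ?T X" if "X \<in> U" for X using that by (simp add: T_def)
  have T_arr: "FArr T X Y f = ?L X Y f" if "X \<in> U" "Y \<in> U" "f \<in> X \<rightarrow>\<^sub>E Y" for X Y f
    using that by (simp add: T_def)
  have TU: "?T X \<in> U" if "X \<in> U" for X using coend_in_U[OF A that] .
  let ?\<theta> = "tens_runit A" and ?\<phi> = "lan_unit A"
  note \<theta> = tens_runit_arr[OF A] and \<theta>\<phi> = tens_runit_lan_unit[OF A] and \<phi>\<theta> = lan_unit_tens_runit[OF A]
  have jn: "j n i \<in> FOb A n" if "n \<in> fincards" "i \<in> n" for n i using fin_nat_mem[OF j that(1)] that by simp
  have cn: "c n \<in> ?T (FOb A n) \<rightarrow>\<^sub>E FOb A n" if "n \<in> fincards" for n using fin_nat_arr[OF c that] that by simp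
  define \<eta>0 where "\<eta>0 = (\<lambda>n\<in>fincards. \<lambda>i\<in>n. ?\<phi> n (j n i))"
  \<comment> \<open>The composite \<open>T (T n) \<rightarrow> T (A n) \<rightarrow> A n
    \<rightarrow> T n\<close>: apply \<open>?\<theta>\<close> inside, compose in the clone, and
    return by \<open>?\<phi>\<close>.\<close>
  define \<mu>0 where "\<mu>0 = (\<lambda>n\<in>fincards. \<lambda>t\<in>?T (?T n). ?\<phi> n (c n (?L (?T n) (FOb A n) (?\<theta> n) t)))"
  have \<theta>t: "?L (?T n) (FOb A n) (?\<theta> n) t \<in> ?T (FOb A n)" if "n \<in> fincards" "t \<in> ?T (?T n)" for n t
    by (rule PiE_mem[OF lan_map_PiE[OF \<theta>[OF that(1)]] that(2)])
  have c\<theta>t: "c n (?L (?T n) (FOb A n) (?\<theta> n) t) \<in> FOb A n" if "n \<in> fincards" "t \<in> ?T (?T n)" for n t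
    by (rule PiE_mem[OF cn[OF that(1)] \<theta>t[OF that]])
  have "fin_nat (res ?I) (res T) \<eta>0"
  proof (rule natI)
    show "\<eta>0 \<in> extensional (Ob (FIN U))" by (simp add: \<eta>0_def)
    fix n assume "n \<in> Ob (FIN U)"
    then have n: "n \<in> fincards" by simp
    then show "\<eta>0 n \<in> FOb (res ?I) n \<rightarrow>\<^sub>E FOb (res T) n"
      by (simp add: \<eta>0_def T_ob lan_unit_in[OF A] jn)
    fix n' f i assume "n' \<in> Ob (FIN U)" "f \<in> Hom (FIN U) n n'" "i \<in> FOb (res ?I) n"
    then have f: "n' \<in> fincards" "f \<in> n \<rightarrow>\<^sub>E n'" "i \<in> n" using n by simp_all
    have "?\<phi> n' (j n' (f i)) = ?L n n' f (?\<phi> n (j n i))"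
      using fin_natural[OF j n f(1,2)] f n lan_unit_natural[OF A n f(1,2) jn[OF n f(3)]] by simp
    then show "\<eta>0 n' (FArr (res ?I) n n' f i) = FArr (res T) n n' f (\<eta>0 n i)"
      using n f PiE_mem[OF f(2,3)] by (simp add: \<eta>0_def T_arr)
  qed
  then obtain \<eta> where \<eta>: "set_nat ?I T \<eta>" and \<eta>0: "restrict \<eta> fincards = \<eta>0"
    by (rule nat_extend[OF ftor_id_ftor[OF is_category_SET] finitary_id T(1)])
  have \<eta>_fin: "\<eta> n i = ?\<phi> n (j n i)" if "n \<in> fincards" "i \<in> n" for n i
    using fun_cong[OF fun_cong[OF \<eta>0, of n], of i] that by (simp add: \<eta>0_def)
  have "fin_nat (res ?TT) (res T) \<mu>0"
  proof (rule natI)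
    show "\<mu>0 \<in> extensional (Ob (FIN U))" by (simp add: \<mu>0_def)
    fix n assume "n \<in> Ob (FIN U)"
    then have n: "n \<in> fincards" by simp
    then show "\<mu>0 n \<in> FOb (res ?TT) n \<rightarrow>\<^sub>E FOb (res T) n"
      by (simp add: \<mu>0_def T_ob TU lan_unit_in[OF A] c\<theta>t)
    fix n' f t assume "n' \<in> Ob (FIN U)" "f \<in> Hom (FIN U) n n'" "t \<in> FOb (res ?TT) n"
    then have f: "n' \<in> fincards" "f \<in> n \<rightarrow>\<^sub>E n'" and t: "t \<in> ?T (?T n)" using n by (simp_all add: T_ob TU)
    let ?Tf = "?L n n' f"
    have Tf: "?Tf \<in> ?T n \<rightarrow>\<^sub>E ?T n'" by (rule lan_map_PiE[OF f(2)])
    let ?s = "?L (?T n) (FOb A n) (?\<theta> n) t"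
    have Af: "FArr A n n' f \<in> FOb A n \<rightarrow>\<^sub>E FOb A n'" by (rule fin_arr[OF A n f])
    have "compose (?T n) (?\<theta> n') ?Tf = compose (?T n) (FArr A n n' f) (?\<theta> n)"
      using tens_runit_natural[OF A n f] by (simp add: compose_eq_iff)
    then have "?L (?T n') (FOb A n') (?\<theta> n') (?L (?T n) (?T n') ?Tf t) =
      ?L (FOb A n) (FOb A n') (FArr A n n' f) ?s"
      unfolding lan_map_comp[OF A t Tf \<theta>[OF f(1)], symmetric] lan_map_comp[OF A t \<theta>[OF n] Af, symmetric] by simp
    then have "?\<phi> n' (c n' (?L (?T n') (FOb A n') (?\<theta> n') (?L (?T n) (?T n') ?Tf t))) =
      ?\<phi> n' (FArr A n n' f (c n ?s))"
      using fin_natural[OF c n f, of ?s] \<theta>t[OF n t] n f by simp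
    also have "\<dots> = ?Tf (?\<phi> n (c n ?s))" by (rule lan_unit_natural[OF A n f c\<theta>t[OF n t]])
    finally show "\<mu>0 n' (FArr (res ?TT) n n' f t) = FArr (res T) n n' f (\<mu>0 n t)"
      using n f t Tf PiE_mem[OF lan_map_PiE[OF Tf] t] by (simp add: \<mu>0_def T_arr T_ob TU)
  qed
  then obtain \<mu> where \<mu>: "set_nat ?TT T \<mu>" and \<mu>0: "restrict \<mu> fincards = \<mu>0"
    by (rule nat_extend[OF TT T(1)])
  have \<mu>_fin: "\<mu> n t = ?\<phi> n (c n (?L (?T n) (FOb A n) (?\<theta> n) t))"
    if "n \<in> fincards" "t \<in> ?T (?T n)" for n t
    using fun_cong[OF fun_cong[OF \<mu>0, of n], of t] that by (simp add: \<mu>0_def)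
  have \<eta>_arr: "\<eta> X \<in> X \<rightarrow>\<^sub>E ?T X" if "X \<in> U" for X using set_nat_arr[OF \<eta> that] that by (simp add: T_ob)
  have \<mu>_arr: "\<mu> X \<in> ?T (?T X) \<rightarrow>\<^sub>E ?T X" if "X \<in> U" for X
    using set_nat_arr[OF \<mu> that] that by (simp add: T_ob TU)
  have \<eta>_nat: "\<eta> Y (f x) = ?L X Y f (\<eta> X x)" if "X \<in> U" "Y \<in> U" "f \<in> X \<rightarrow>\<^sub>E Y" "x \<in> X" for X Y f x
    using set_natural[OF \<eta> that(1-3), of x] that by (simp add: T_arr)
  have \<mu>_nat: "\<mu> Y (?L (?T X) (?T Y) (?L X Y f) t) = ?L X Y f (\<mu> X t)"
    if "X \<in> U" "Y \<in> U" "f \<in> X \<rightarrow>\<^sub>E Y" "t \<in> ?T (?T X)" for X Y f t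
    using set_natural[OF \<mu> that(1-3), of t] that lan_map_PiE[OF that(3)] by (simp add: T_arr T_ob TU)
  have surj1: "\<exists>n s g. n \<in> fincards \<and> s \<in> ?T n \<and> g \<in> n \<rightarrow>\<^sub>E X \<and> t = ?L n X g s"
    if X: "X \<in> U" and t: "t \<in> ?T X" for X t
  proof -
    have "t \<in> FOb T X" using t X by (simp add: T_ob)
    then obtain n s g where "n \<in> fincards" "s \<in> FOb T n" "g \<in> n \<rightarrow>\<^sub>E X" "t = FArr T n X g s"
      by (rule finitary_surj[OF T X])
    then show ?thesis using X by (intro exI[of _ n] exI[of _ s] exI[of _ g]) (simp add: T_ob T_arr)
  qed
  \<comment> \<open>The presentation runs along \<open>T (T g)\<close>, the shape that naturality of
    \<open>\<mu>\<close> requires; \<open>surj1\<close> at the set \<open>T X\<close> would only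
    give a map into \<open>T X\<close> that need not be of the form \<open>T g\<close>.\<close>
  have surj2: "\<exists>n s g. n \<in> fincards \<and> s \<in> ?T (?T n) \<and> g \<in> n \<rightarrow>\<^sub>E X \<and>
      t = ?L (?T n) (?T X) (?L n X g) s"
    if X: "X \<in> U" and t: "t \<in> ?T (?T X)" for X t
  proof -
    have "t \<in> FOb ?TT X" using t X by (simp add: T_ob TU)
    then obtain n s g where "n \<in> fincards" "s \<in> FOb ?TT n" "g \<in> n \<rightarrow>\<^sub>E X" "t = FArr ?TT n X g s"
      by (rule finitary_surj[OF TT X])
    then show ?thesis
      using X lan_map_PiE[of g n X A] by (intro exI[of _ n] exI[of _ s] exI[of _ g]) (simp add: T_ob T_arr TU)
  qed
  have left_fin: "\<mu> n (\<eta> (?T n) s) = s" if n: "n \<in> fincards" and s: "s \<in> ?T n" for n s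
  proof -
    \<comment> \<open>Here \<open>\<eta>\<close> is taken at \<open>T n\<close>, where no formula is
      at hand; the map with value \<open>s\<close> on the one-element cardinal moves the computation
      to that cardinal, where \<open>\<eta>_fin\<close> applies.\<close>
    define o1 :: "'u set" where "o1 = num ` {..<1}"
    have o1: "o1 \<in> fincards" "num 0 \<in> o1" "o1 \<in> U" by (auto simp: o1_def fincards_def finite_in_U)
    have nU: "n \<in> U" using n by simp
    let ?f = "\<lambda>i\<in>o1. s"
    have f: "?f \<in> o1 \<rightarrow>\<^sub>E ?T n" "?f (num 0) = s" using s o1 by auto
    note j1 = jn[OF o1(1,2)]
    have e: "\<eta> (?T n) s = cls A (?T n) (o1, j o1 (num 0), ?f)"
      using \<eta>_nat[OF o1(3) TU[OF nU] f(1) o1(2)] f(2) \<eta>_fin[OF o1(1,2)] lan_map_lan_unit[OF A o1(1) j1 f(1)] by simp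
    have "\<mu> n (\<eta> (?T n) s) = ?\<phi> n (c n (cls A (FOb A n) (o1, j o1 (num 0), compose o1 (?\<theta> n) ?f)))"
      unfolding e using \<mu>_fin[OF n cls_in_coend[OF o1(1) j1 f(1)]] lan_map_cls[OF A o1(1) j1 f(1) \<theta>[OF n]] by simp
    also have "\<dots> = ?\<phi> n (?\<theta> n s)"
      using left[OF n o1(1,2) compose_PiE[OF f(1) \<theta>[OF n]]] o1(2) by simp
    finally show ?thesis using \<phi>\<theta>[OF n s] by simp
  qed
  have right_fin: "\<mu> n (?L n (?T n) (\<eta> n) s) = s" if n: "n \<in> fincards" and s: "s \<in> ?T n" for n s
  proof -
    have nU: "n \<in> U" using n by simp
    obtain m a f where m: "m \<in> fincards" "a \<in> FOb A m" "f \<in> m \<rightarrow>\<^sub>E n" "s = cls A n (m, a, f)"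
      using s by (rule coendE)
    have f: "compose m (\<eta> n) f \<in> m \<rightarrow>\<^sub>E ?T n" by (rule compose_PiE[OF m(3) \<eta>_arr[OF nU]])
    have e: "?L n (?T n) (\<eta> n) s = cls A (?T n) (m, a, compose m (\<eta> n) f)"
      unfolding m(4) by (rule lan_map_cls[OF A m(1-3) \<eta>_arr[OF nU]])
    have "compose m (?\<theta> n) (compose m (\<eta> n) f) = compose m (j n) f"
      using \<eta>_fin[OF n] \<theta>\<phi>[OF n jn[OF n]] PiE_mem[OF m(3)] by (simp add: compose_eq_iff)
    then have "\<mu> n (?L n (?T n) (\<eta> n) s) = ?\<phi> n (c n (cls A (FOb A n) (m, a, compose m (j n) f)))"
      unfolding e using \<mu>_fin[OF n cls_in_coend[OF m(1,2) f]] lan_map_cls[OF A m(1,2) f \<theta>[OF n]] by simp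
    also have "\<dots> = ?\<phi> n (?\<theta> n s)"
      using right[OF n m(1-3)] tens_runit_cls[OF A n m(1-3)] m(4) by simp
    finally show ?thesis using \<phi>\<theta>[OF n s] by simp
  qed
  have assoc_fin: "\<mu> n (\<mu> (?T n) t) = \<mu> n (?L (?T (?T n)) (?T n) (\<mu> n) t)"
    if n: "n \<in> fincards" and t: "t \<in> ?T (?T (?T n))" for n t
  proof -
    have nU: "n \<in> U" "?T n \<in> U" using n TU by auto
    \<comment> \<open>The inner multiplication sits at the possibly infinite set \<open>T n\<close>;
      presenting \<open>t\<close> over a finite \<open>k\<close> moves it by naturality to
      \<open>\<mu> k\<close>, which has a formula.\<close>
    obtain k r h where k: "k \<in> fincards" "r \<in> ?T (?T k)" "h \<in> k \<rightarrow>\<^sub>E ?T n"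
      "t = ?L (?T k) (?T (?T n)) (?L k (?T n) h) r"
      using surj2[OF nU(2) t] by blast
    have kU: "k \<in> U" using k(1) by simp
    obtain p a f where p: "p \<in> fincards" "a \<in> FOb A p" "f \<in> p \<rightarrow>\<^sub>E ?T k" "r = cls A (?T k) (p, a, f)"
      using k(2) by (rule coendE)
    let ?h = "compose k (?\<theta> n) h"
    let ?f = "compose p (?\<theta> k) f"
    have h: "?h \<in> k \<rightarrow>\<^sub>E FOb A n" by (rule compose_PiE[OF k(3) \<theta>[OF n]])
    have f: "?f \<in> p \<rightarrow>\<^sub>E FOb A k" by (rule compose_PiE[OF p(3) \<theta>[OF k(1)]])
    let ?b = "c k (cls A (FOb A k) (p, a, ?f))"
    have b: "?b \<in> FOb A k" by (rule PiE_mem[OF cn[OF k(1)] cls_in_coend[OF p(1,2) f]])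
    have \<mu>r: "\<mu> k r = ?\<phi> k ?b"
      using \<mu>_fin[OF k(1,2)] lan_map_cls[OF A p(1-3) \<theta>[OF k(1)]] p(4) by simp
    have "\<mu> n (\<mu> (?T n) t) = \<mu> n (?L k (?T n) h (\<mu> k r))"
      unfolding k(4) by (rule arg_cong[OF \<mu>_nat[OF kU nU(2) k(3,2)]])
    also have "\<dots> = \<mu> n (cls A (?T n) (k, ?b, h))"
      unfolding \<mu>r lan_map_lan_unit[OF A k(1) b k(3)] by (rule refl)
    also have "\<dots> = ?\<phi> n (c n (cls A (FOb A n) (k, ?b, ?h)))"
      using \<mu>_fin[OF n cls_in_coend[OF k(1) b k(3)]] lan_map_cls[OF A k(1) b k(3) \<theta>[OF n]] by simp
    also have "\<dots> = ?\<phi> n (c n (cls A (FOb A n) (p, a, \<lambda>i\<in>p. c n (cls A (FOb A n) (k, ?f i, ?h)))))"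
      unfolding assoc[OF n k(1) p(1,2) f h] by (rule refl)
    finally have lhs: "\<mu> n (\<mu> (?T n) t) =
      ?\<phi> n (c n (cls A (FOb A n) (p, a, \<lambda>i\<in>p. c n (cls A (FOb A n) (k, ?f i, ?h)))))" .
    let ?Th = "?L k (?T n) h"
    have Th: "?Th \<in> ?T k \<rightarrow>\<^sub>E ?T (?T n)" by (rule lan_map_PiE[OF k(3)])
    let ?g = "compose p (\<mu> n) (compose p ?Th f)"
    have Thf: "compose p ?Th f \<in> p \<rightarrow>\<^sub>E ?T (?T n)" by (rule compose_PiE[OF p(3) Th])
    have g: "?g \<in> p \<rightarrow>\<^sub>E ?T n" by (rule compose_PiE[OF Thf \<mu>_arr[OF nU(1)]])
    \<comment> \<open>Entry by entry, the labelling on this side becomes the inner substitution of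
      the clone, so the result agrees with the side computed through clone associativity.\<close>
    have "?\<theta> n (\<mu> n (?Th (f i))) = c n (cls A (FOb A n) (k, ?f i, ?h))" if i: "i \<in> p" for i
    proof -
      have fi: "f i \<in> ?T k" "?f i \<in> FOb A k" using PiE_mem[OF p(3) i] PiE_mem[OF f i] .
      have "?Th (f i) = cls A (?T n) (k, ?f i, h)"
        using lan_map_lan_unit[OF A k(1) fi(2) k(3)] \<phi>\<theta>[OF k(1) fi(1)] i by simp
      then have "\<mu> n (?Th (f i)) = ?\<phi> n (c n (cls A (FOb A n) (k, ?f i, ?h)))"
        using \<mu>_fin[OF n cls_in_coend[OF k(1) fi(2) k(3)]] lan_map_cls[OF A k(1) fi(2) k(3) \<theta>[OF n]] by simp
      then show ?thesis using \<theta>\<phi>[OF n PiE_mem[OF cn[OF n] cls_in_coend[OF k(1) fi(2) h]]] by simp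
    qed
    then have \<theta>g: "compose p (?\<theta> n) ?g = (\<lambda>i\<in>p. c n (cls A (FOb A n) (k, ?f i, ?h)))"
      by (auto simp: compose_eq_restrict_iff)
    have "?L (?T (?T n)) (?T n) (\<mu> n) t = cls A (?T n) (p, a, ?g)"
      unfolding k(4) p(4) lan_map_cls[OF A p(1-3) Th] lan_map_cls[OF A p(1,2) Thf \<mu>_arr[OF nU(1)]] by (rule refl)
    then have "\<mu> n (?L (?T (?T n)) (?T n) (\<mu> n) t) =
      ?\<phi> n (c n (cls A (FOb A n) (p, a, compose p (?\<theta> n) ?g)))"
      using \<mu>_fin[OF n cls_in_coend[OF p(1,2) g]] lan_map_cls[OF A p(1,2) g \<theta>[OF n]] by simp
    then show ?thesis unfolding lhs \<theta>g by simp
  qed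
  define M where "M = \<lparr>Fun = T, Unit = \<eta>, Mult = \<mu>\<rparr>"
  have M: "is_monad (SET U) M"
    unfolding is_monad_iff M_def monad.select_convs
  proof (intro conjI ballI T(1) \<eta> \<mu>)
    \<comment> \<open>With \<open>t\<close> the image of \<open>s\<close> under \<open>T g\<close>,
      the left-hand sides of the unit laws at \<open>X\<close> are the images under
      \<open>T g\<close> of those at the finite cardinal \<open>n\<close>.\<close>
    fix X t assume X: "X \<in> U" and "t \<in> FOb T X"
    then have t: "t \<in> ?T X" by (simp add: T_ob)
    obtain n s g where n: "n \<in> fincards" "s \<in> ?T n" "g \<in> n \<rightarrow>\<^sub>E X" "t = ?L n X g s"
      using surj1[OF X t] by blast
    have nU: "n \<in> U" using n(1) by simp
    have Tg: "?L n X g \<in> ?T n \<rightarrow>\<^sub>E ?T X" by (rule lan_map_PiE[OF n(3)])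
    note \<eta>n = \<eta>_arr[OF nU] and \<eta>X = \<eta>_arr[OF X]
    have "\<mu> X (\<eta> (?T X) t) = ?L n X g (\<mu> n (\<eta> (?T n) s))"
      unfolding n(4) \<eta>_nat[OF TU[OF nU] TU[OF X] Tg n(2)]
      by (rule \<mu>_nat[OF nU X n(3) PiE_mem[OF \<eta>_arr[OF TU[OF nU]] n(2)]])
    then show "\<mu> X (\<eta> (FOb T X) t) = t" using left_fin[OF n(1,2)] n(4) X by (simp add: T_ob)
    have "compose n (\<eta> X) g = compose n (?L n X g) (\<eta> n)"
      using \<eta>_nat[OF nU X n(3)] by (simp add: compose_eq_iff)
    then have "?L X (?T X) (\<eta> X) t =
      ?L (?T n) (?T X) (?L n X g) (?L n (?T n) (\<eta> n) s)"
      unfolding n(4) lan_map_comp[OF A n(2,3) \<eta>X, symmetric] lan_map_comp[OF A n(2) \<eta>n Tg, symmetric] by simp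
    then have "\<mu> X (?L X (?T X) (\<eta> X) t) = ?L n X g (\<mu> n (?L n (?T n) (\<eta> n) s))"
      using \<mu>_nat[OF nU X n(3) PiE_mem[OF lan_map_PiE[OF \<eta>n] n(2)]] by simp
    then show "\<mu> X (FArr T X (FOb T X) (\<eta> X) t) = t"
      using right_fin[OF n(1,2)] n(4) X \<eta>X by (simp add: T_ob T_arr TU)
  next
    fix X t assume X: "X \<in> U" and "t \<in> FOb T (FOb T (FOb T X))"
    then have t: "t \<in> ?T (?T (?T X))" by (simp add: T_ob TU)
    \<comment> \<open>The threefold composite is finitary as well, so \<open>t\<close> comes from a
      finite cardinal through \<open>T (T (T g))\<close>, along which both sides of associativity
      are natural.\<close>
    have "t \<in> FOb (comp_ftor (SET U) T ?TT) X" using t X by (simp add: T_ob TU)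
    then obtain n s g where n: "n \<in> fincards" "s \<in> FOb (comp_ftor (SET U) T ?TT) n" "g \<in> n \<rightarrow>\<^sub>E X"
        "t = FArr (comp_ftor (SET U) T ?TT) n X g s"
      by (rule finitary_surj[OF ftor_comp_ftor[OF TT(1) T(1) is_category_SET] finitary_comp[OF TT T] X])
    have nU: "n \<in> U" using n(1) by simp
    let ?g = "?L n X g"
    let ?gg = "?L (?T n) (?T X) ?g"
    have Tg: "?g \<in> ?T n \<rightarrow>\<^sub>E ?T X" by (rule lan_map_PiE[OF n(3)])
    have TTg: "?gg \<in> ?T (?T n) \<rightarrow>\<^sub>E ?T (?T X)" by (rule lan_map_PiE[OF Tg])
    have s: "s \<in> ?T (?T (?T n))" using n(2) nU by (simp add: T_ob TU)
    have ts: "t = ?L (?T (?T n)) (?T (?T X)) ?gg s"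
      using n(3,4) nU X Tg TTg by (simp add: T_ob TU T_arr)
    note \<mu>n = \<mu>_arr[OF nU] and \<mu>X = \<mu>_arr[OF X]
    have "\<mu> X (\<mu> (?T X) t) = \<mu> X (?gg (\<mu> (?T n) s))"
      unfolding ts \<mu>_nat[OF TU[OF nU] TU[OF X] Tg s] by (rule refl)
    also have "\<dots> = ?g (\<mu> n (\<mu> (?T n) s))"
      by (rule \<mu>_nat[OF nU X n(3) PiE_mem[OF \<mu>_arr[OF TU[OF nU]] s]])
    also have "\<dots> = ?g (\<mu> n (?L (?T (?T n)) (?T n) (\<mu> n) s))"
      unfolding assoc_fin[OF n(1) s] by (rule refl)
    also have "\<dots> = \<mu> X (?gg (?L (?T (?T n)) (?T n) (\<mu> n) s))"
      by (rule \<mu>_nat[OF nU X n(3) PiE_mem[OF lan_map_PiE[OF \<mu>n] s], symmetric])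
    also have "?gg (?L (?T (?T n)) (?T n) (\<mu> n) s) = ?L (?T (?T X)) (?T X) (\<mu> X) t"
    proof -
      have "compose (?T (?T n)) ?g (\<mu> n) = compose (?T (?T n)) (\<mu> X) ?gg"
        using \<mu>_nat[OF nU X n(3)] by (simp add: compose_eq_iff)
      then show ?thesis
        unfolding ts lan_map_comp[OF A s \<mu>n Tg, symmetric] lan_map_comp[OF A s TTg \<mu>X, symmetric] by simp
    qed
    finally show "\<mu> X (\<mu> (FOb T X) t) = \<mu> X (FArr T (FOb T (FOb T X)) (FOb T X) (\<mu> X) t)"
      using X \<mu>X by (simp add: T_ob T_arr TU)
  qed
  have FunM: "Fun M = T" "Unit M = \<eta>" "Mult M = \<mu>" by (simp_all add: M_def)
  \<comment> \<open>Every \<open>t\<close> in \<open>T m\<close> is the unit of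
    \<open>?\<theta> m t\<close>; hence the monad multiplication on a class is
    \<open>?\<phi>\<close> of a clone composite, and \<open>?\<theta>\<close> cancels
    \<open>?\<phi>\<close>.\<close>
  have mor: "is_clone_mor (res (Fun M)) (restrict (Unit M) fincards) (clone_mult M) A j c ?\<theta>"
    unfolding is_clone_mor_def
  proof (intro conjI ballI)
    show "fin_nat (res (Fun M)) A ?\<theta>" unfolding FunM T_def by (rule is_nat_tens_runit[OF A])
    show "?\<theta> n (restrict (Unit M) fincards n i) = j n i" if "n \<in> fincards" "i \<in> n" for n i
      using that \<eta>_fin \<theta>\<phi> jn by (simp add: FunM)
    fix n m :: "'u set" and t f
    assume *: "n \<in> fincards" "m \<in> fincards" "t \<in> FOb (res (Fun M)) m" "f \<in> m \<rightarrow>\<^sub>E FOb (res (Fun M)) n"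
    then have t: "t \<in> ?T m" and f: "f \<in> m \<rightarrow>\<^sub>E ?T n" by (simp_all add: FunM T_ob)
    have obs: "m \<in> U" "n \<in> U" using *(1,2) by simp_all
    let ?a = "?\<theta> m t"
    have a: "?a \<in> FOb A m" by (rule PiE_mem[OF \<theta>[OF *(2)] t])
    have "clone_mult M n (cls (res T) (?T n) (m, t, f)) = \<mu> n (?L m (?T n) f t)"
      using clone_mult_cls[OF M *(1,2), of t f] t f obs by (simp add: FunM T_ob T_arr TU)
    also have "?L m (?T n) f t = cls A (?T n) (m, ?a, f)"
      using lan_map_lan_unit[OF A *(2) a f] \<phi>\<theta>[OF *(2) t] by simp
    also have "\<mu> n \<dots> = ?\<phi> n (c n (cls A (FOb A n) (m, ?a, compose m (?\<theta> n) f)))"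
      using \<mu>_fin[OF *(1) cls_in_coend[OF *(2) a f]] lan_map_cls[OF A *(2) a f \<theta>[OF *(1)]] by simp
    finally show "?\<theta> n (clone_mult M n (cls (res (Fun M)) (FOb (res (Fun M)) n) (m, t, f))) =
      c n (cls A (FOb A n) (m, ?\<theta> m t, compose m (?\<theta> n) f))"
      using \<theta>\<phi>[OF *(1) PiE_mem[OF cn[OF *(1)] cls_in_coend[OF *(2) a compose_PiE[OF f \<theta>[OF *(1)]]]]] *(1) obs
      by (simp add: FunM T_ob)
  qed
  have "is_iso one_cat (clone_of M) (mk_ecat x A j c) (mk_efun undefined x ?\<theta>)"
    unfolding clone_of_def
  proof (rule iso_mk_efun[OF is_clone_monad[OF M] assms mor])
    show "fin_nat A (res (Fun M)) ?\<phi>" unfolding FunM T_def by (rule is_nat_lan_unit[OF A])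
  qed (simp_all add: FunM T_ob \<phi>\<theta> \<theta>\<phi>)
  moreover have "is_finitary U (Fun M)" using T(2) FunM by simp
  ultimately show thesis using M by (intro that)
qed

subsection \<open>The equivalence\<close>

lemma MND_f_simps [simp]:
  "M \<in> Ob (MND_f U) \<longleftrightarrow> is_monad (SET U) M \<and> is_finitary U (Fun M)"
  "Hom (MND_f U) M N = {\<tau>. is_monad_mor (SET U) M N \<tau>}"
  "Idn (MND_f U) M = Idn (ftor_cat (SET U) (SET U)) (Fun M)"
  "Cmp (MND_f U) L M N = Cmp (ftor_cat (SET U) (SET U)) (Fun L) (Fun M) (Fun N)"
  by (simp_all add: MND_f_def)

definition clone_ftor :: "(('u set, 'u \<Rightarrow> 'u) monad, 'u set \<Rightarrow> 'u \<Rightarrow> 'u,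
    ('x, 'u endo, 'u set \<Rightarrow> 'u \<Rightarrow> 'u) ecat, ('x, 'u set \<Rightarrow> 'u \<Rightarrow> 'u) efun) ftor" where
  "clone_ftor = \<lparr>FOb = (\<lambda>M\<in>Ob (MND_f U). clone_of M),
     FArr = (\<lambda>M\<in>Ob (MND_f U). \<lambda>N\<in>Ob (MND_f U). \<lambda>\<tau>\<in>Hom (MND_f U) M N.
       mk_efun undefined undefined (restrict \<tau> fincards))\<rparr>"

lemma clone_ftor_ob: "M \<in> Ob (MND_f U) \<Longrightarrow> FOb clone_ftor M = clone_of M"
  by (simp only: clone_ftor_def ftor.select_convs restrict_apply')

lemma clone_ftor_arr:
  "M \<in> Ob (MND_f U) \<Longrightarrow> N \<in> Ob (MND_f U) \<Longrightarrow> \<tau> \<in> Hom (MND_f U) M N \<Longrightarrow>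
   FArr clone_ftor M N \<tau> = mk_efun undefined undefined (restrict \<tau> fincards)"
  by (simp only: clone_ftor_def ftor.select_convs restrict_apply')

lemma clone_mor_restrict:
  assumes "M \<in> Ob (MND_f U)" "N \<in> Ob (MND_f U)" "\<tau> \<in> Hom (MND_f U) M N"
  shows "mk_efun undefined undefined (restrict \<tau> fincards) \<in> Hom one_cat (clone_of M) (clone_of N)"
proof -
  have m: "is_monad (SET U) M" "is_monad (SET U) N" "is_finitary U (Fun M)" "is_monad_mor (SET U) M N \<tau>"
    using assms by auto
  then have "set_nat (Fun M) (Fun N) \<tau>" by (simp add: is_monad_mor_iff)
  then show ?thesis
    unfolding clone_of_def mk_efun_in_Hom[OF is_clone_monad[OF m(1)] is_clone_monad[OF m(2)]]
    using clone_mor_monad_mor_iff[OF m(1-3)] m(4) by blast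
qed

lemma is_ftor_clone_ftor:
  "is_ftor (MND_f U) one_cat clone_ftor"
proof -
  have cat: "is_category (MND_f U)"
    unfolding MND_f_def by (rule is_category_full_sub[OF is_category_monad_cat])
  show ?thesis
    unfolding is_ftor_def
  proof (intro conjI ballI)
    show "FOb clone_ftor \<in> Ob (MND_f U) \<rightarrow>\<^sub>E Ob one_cat"
      by (simp add: clone_ftor_def clone_of_def mk_ecat_in_one_object is_clone_monad)
    show "FArr clone_ftor \<in> (\<Pi>\<^sub>E M\<in>Ob (MND_f U). \<Pi>\<^sub>E N\<in>Ob (MND_f U).
        Hom (MND_f U) M N \<rightarrow>\<^sub>E Hom one_cat (FOb clone_ftor M) (FOb clone_ftor N))"
      using clone_mor_restrict by (auto simp: clone_ftor_def simp del: MND_f_simps)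
  next
    fix M assume M: "M \<in> Ob (MND_f U)"
    have "restrict (Idn (MND_f U) M) fincards = Idn fin_cat (res (Fun M))"
      by (auto simp: fun_eq_iff)
    then show "FArr clone_ftor M M (Idn (MND_f U) M) = Idn one_cat (FOb clone_ftor M)"
      using M category_Idn[OF cat M] unfolding clone_of_def clone_ftor_def
      by (simp only: ftor.select_convs restrict_apply' one_object_Idn)
  next
    fix L M N \<sigma> \<tau> assume L: "L \<in> Ob (MND_f U)" "M \<in> Ob (MND_f U)" "N \<in> Ob (MND_f U)"
      and h: "\<sigma> \<in> Hom (MND_f U) L M" "\<tau> \<in> Hom (MND_f U) M N"
    have "restrict (Cmp (MND_f U) L M N \<tau> \<sigma>) fincards =
        Cmp fin_cat (res (Fun L)) (res (Fun M)) (res (Fun N)) (restrict \<tau> fincards) (restrict \<sigma> fincards)"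
      by (auto simp: fun_eq_iff)
    then show "FArr clone_ftor L N (Cmp (MND_f U) L M N \<tau> \<sigma>) = Cmp one_cat (FOb clone_ftor L)
       (FOb clone_ftor M) (FOb clone_ftor N) (FArr clone_ftor M N \<tau>) (FArr clone_ftor L M \<sigma>)"
      using L h category_Cmp[OF cat L h] unfolding clone_of_def clone_ftor_def
      by (simp only: ftor.select_convs restrict_apply' one_object_Cmp)
  qed
qed

lemma bij_betw_clone_ftor:
  assumes "M \<in> Ob (MND_f U)" "N \<in> Ob (MND_f U)"
  shows "bij_betw (FArr clone_ftor M N) (Hom (MND_f U) M N)
    (Hom one_cat (FOb clone_ftor M)
      (FOb clone_ftor N :: ('x, 'u endo, 'u set \<Rightarrow> 'u \<Rightarrow> 'u) ecat))"
proof -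
  have m: "is_monad (SET U) M" "is_monad (SET U) N" "is_finitary U (Fun M)" using assms by auto
  note clones = is_clone_monad[OF m(1)] is_clone_monad[OF m(2)]
  let ?F = "\<lambda>\<tau>. mk_efun undefined undefined (restrict \<tau> fincards)"
  have "bij_betw ?F (Hom (MND_f U) M N) (Hom one_cat (clone_of M)
      (clone_of N :: ('x, 'u endo, 'u set \<Rightarrow> 'u \<Rightarrow> 'u) ecat))"
    unfolding bij_betw_def
  proof (intro conjI subset_antisym image_subsetI subsetI inj_onI)
    fix \<sigma> \<tau> assume h: "\<sigma> \<in> Hom (MND_f U) M N" "\<tau> \<in> Hom (MND_f U) M N" and eq: "?F \<sigma> = ?F \<tau>"
    have nat: "set_nat (Fun M) (Fun N) \<sigma>" "set_nat (Fun M) (Fun N) \<tau>"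
      using h by (simp_all add: is_monad_mor_iff[OF m(2)])
    have "restrict \<sigma> fincards = restrict \<tau> fincards"
      using arg_cong[OF eq, of "\<lambda>P. EFArr P undefined undefined"] by simp
    then have "\<sigma> n a = \<tau> n a" if "n \<in> fincards" for n a using that by (metis restrict_apply')
    then show "\<sigma> = \<tau>" by (rule nat_eq_finitary[OF monad_ftor[OF m(1)] m(3) nat])
  next
    show "?F \<tau> \<in> Hom one_cat (clone_of M) (clone_of N)" if "\<tau> \<in> Hom (MND_f U) M N" for \<tau>
      by (rule clone_mor_restrict[OF assms that])
  next
    fix P assume P: "P \<in> Hom one_cat (clone_of M) (clone_of N)"
    obtain \<sigma> where \<sigma>: "P = mk_efun undefined undefined \<sigma>" "is_clone_mor (res (Fun M)) (restrict (Unit M) fincards) (clone_mult M)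
      (res (Fun N)) (restrict (Unit N) fincards) (clone_mult N) \<sigma>"
      by (rule one_object_homE[OF P[unfolded clone_of_def] clones])
    have "fin_nat (res (Fun M)) (res (Fun N)) \<sigma>" using \<sigma>(2) unfolding is_clone_mor_def by blast
    \<comment> \<open>The clone morphism is extended as a mere natural transformation; compatibility
      with unit and multiplication is recovered afterwards from its restriction.\<close>
    then obtain \<tau> where \<tau>: "set_nat (Fun M) (Fun N) \<tau>" "restrict \<tau> fincards = \<sigma>"
      by (rule nat_extend[OF monad_ftor[OF m(1)] m(3) monad_ftor[OF m(2)]])
    have "is_monad_mor (SET U) M N \<tau>"
      using clone_mor_monad_mor_iff[OF m \<tau>(1)] \<sigma>(2) \<tau>(2) by simp
    then show "P \<in> ?F ` Hom (MND_f U) M N" using \<sigma>(1) \<tau>(2) by auto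
  qed
  then show ?thesis
    unfolding clone_ftor_ob[OF assms(1)] clone_ftor_ob[OF assms(2)]
    by (rule iffD2[OF bij_betw_cong, rotated]) (rule clone_ftor_arr[OF assms])
qed

lemma equivalent_MND_f_one_object:
  "equivalent_cats (MND_f U) one_cat"
proof (rule equivalent_catsI[OF _ is_category_one_object is_ftor_clone_ftor])
  show "is_category (MND_f U)"
    unfolding MND_f_def by (rule is_category_full_sub[OF is_category_monad_cat])
  fix Z :: "('x, 'u endo, 'u set \<Rightarrow> 'u \<Rightarrow> 'u) ecat"
  assume "Z \<in> Ob one_cat"
  then obtain x A j c where Z: "Z = mk_ecat x A j c" "is_clone A j c" by (rule one_object_obE)
  \<comment> \<open>The isomorphism also renames the object \<open>undefined\<close> of
    \<open>clone_of M\<close> to the object \<open>x\<close> of \<open>Z\<close>.\<close>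
  obtain M where M: "is_monad (SET U) M" "is_finitary U (Fun M)"
    "is_iso one_cat (clone_of M) (mk_ecat x A j c) (mk_efun undefined x (tens_runit A))"
    by (rule clone_of_surj[OF Z(2)])
  then have "M \<in> Ob (MND_f U)" by simp
  moreover from this have "FOb clone_ftor M = (clone_of M :: ('x, 'u endo, 'u set \<Rightarrow> 'u \<Rightarrow> 'u) ecat)"
    by (rule clone_ftor_ob)
  ultimately show "\<exists>M\<in>Ob (MND_f U). \<exists>f. is_iso one_cat (FOb clone_ftor M) Z f"
    using M(3) Z(1) by metis
qed (rule bij_betw_clone_ftor)

end

theorem proposition2p2:
  fixes U :: "'u set set"
  assumes "universe U"
  shows "equivalent_cats (MND_f U)
           (one_object_ecat_cat (FSET U) :: (('u, 'u endo, 'u set \<Rightarrow> 'u \<Rightarrow> 'u) ecat, _) cat)"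
proof -
  interpret set_universe U by unfold_locales (rule assms)
  show ?thesis by (rule equivalent_MND_f_one_object)
qed

end
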